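(* Let $\gamma>0$, $\rho<0$, and let $X_1,\dots,X_n$ be i.i.d. nonnegative random variables with distribution function $F$ whose quantile function $U(t)=F^{\leftarrow}(1-1/t)$, $t\ge1$, satisfies the second-order condition: there is a measurable function $A$, of constant sign near infinity, not identically zero, with $A(t)\to0$ as $t\to\infty$, such that $$\lim_{t\to\infty}\frac{U(tx)/U(t)-x^{\gamma}}{A(t)}=x^{\gamma}\frac{x^{\rho}-1}{\rho}\quad\text{for all }x>0.$$ Let $r\in\mathbb{R}$ with $\gamma r<1/2$, and let $k=k(n)$ be integers with $1\le k<n$, $k(n)\to\infty$, $n/k(n)\to\infty$, and $\lim_{n\to\infty}\sqrt{k}\,A(n/k)=\mu\in(-\infty,\infty)$. Then, as $n\to\infty$, $$\sqrt{k}\big(G_n(k,r,0)-\xi(r,0),\ G_n(k,r,1)-\xi(r,1)\big)\xrightarrow{d}\mu\big(\nu^{(1)}(r),\nu^{(2)}(r)\big)+\big(W^{(1)},W^{(2)}\big),$$ where, with $d_r(m)=1-m\gamma r$, $$\nu^{(1)}(r)=\frac{r}{d_r(1)(d_r(1)-\rho)},\qquad \nu^{(2)}(r)=\frac{1-\rho-\gamma^2r^2}{d_r(1)^2(d_r(1)-\rho)^2},$$ and $(W^{(1)},W^{(2)})$ is a zero-mean Gaussian random vector with $\mathrm{E}(W^{(1)})^2=s_1^2(r)$, $\mathrm{E}(W^{(2)})^2=s_2^2(r)$, $\mathrm{E}(W^{(1)}W^{(2)})=s_{12}(r)$, where $$s_1^2(r)=\frac{\gamma^2r^2}{d_r(2)d_r(1)^2},\quad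 s_2^2(r)=\frac{\gamma^2\big(d_r(2)+2\gamma^4r^4\big)}{d_r(2)^3d_r(1)^4},\quad s_{12}(r)=\frac{\gamma^2 r\big(d_r(1)-\gamma^2r^2\big)}{d_r(2)^2d_r(1)^3}.$$
   Context: For a monotone function $W$, $W^{\leftarrow}(t)=\sup\{x: W(x)\le t\}$. $X_{n,1}\le\dots\le X_{n,n}$ are the order statistics of $X_1,\dots,X_n$. For $x\ge1$, $g_{r,u}(x)=x^r(\ln x)^u$, and $G_n(k,r,u)=\frac1k\sum_{i=0}^{k-1} g_{r,u}\big(X_{n-i,n}/X_{n-k,n}\big)$. Also $\xi(r,u)=\gamma^u\Gamma(1+u)/(1-\gamma r)^{1+u}$, so $\xi(r,0)=1/(1-\gamma r)$ and $\xi(r,1)=\gamma/(1-\gamma r)^2$. $\xrightarrow{d}$ denotes convergence in distribution. *)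

theory Defs
  imports "HOL-Probability.Probability"
begin

definition gen_inv :: "(real \<Rightarrow> real) \<Rightarrow> real \<Rightarrow> real" where
  "gen_inv W t = Sup {x. W x \<le> t}"

text \<open>Order statistic X_{j,n} (1 <= j <= n) of the sample X 0, ..., X (n-1).\<close>
definition order_stat :: "(nat \<Rightarrow> 'a \<Rightarrow> real) \<Rightarrow> nat \<Rightarrow> nat \<Rightarrow> 'a \<Rightarrow> real" where
  "order_stat X j n \<omega> = sort (map (\<lambda>i. X i \<omega>) [0..<n]) ! (j - 1)"

definition g_fun :: "real \<Rightarrow> nat \<Rightarrow> real \<Rightarrow> real" where
  "g_fun r u x = x powr r * (ln x) ^ u"

definition G_n :: "(nat \<Rightarrow> 'a \<Rightarrow> real) \<Rightarrow> nat \<Rightarrow> nat \<Rightarrow> real \<Rightarrow> nat \<Rightarrow> 'a \<Rightarrow> real" where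
  "G_n X n k r u \<omega> =
     (1 / real k) * (\<Sum>i<k. g_fun r u (order_stat X (n - i) n \<omega> / order_stat X (n - k) n \<omega>))"

definition xi :: "real \<Rightarrow> real \<Rightarrow> nat \<Rightarrow> real" where
  "xi \<gamma> r u = \<gamma> ^ u * Gamma (1 + real u) / (1 - \<gamma> * r) ^ (1 + u)"

text \<open>Bivariate Gaussian law on R^2 with mean m, variances v1, v2 and covariance c,
  defined via its one-dimensional projections (Cramer--Wold); degenerate projections
  are point masses.\<close>
definition gaussian2 :: "(real \<times> real) measure \<Rightarrow> real \<times> real \<Rightarrow> real \<Rightarrow> real \<Rightarrow> real \<Rightarrow> bool" where
  "gaussian2 N m v1 v2 c \<longleftrightarrow> prob_space N \<and> sets N = sets borel \<and>
     (\<forall>a b. let mu = a * fst m + b * snd m; s2 = a\<^sup>2 * v1 + 2 * a * b * c + b\<^sup>2 * v2 in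
        distr N borel (\<lambda>z. a * fst z + b * snd z) =
          (if s2 = 0 then return borel mu else density lborel (normal_density mu (sqrt s2))))"

definition conv_distr2 :: "'a measure \<Rightarrow> (nat \<Rightarrow> 'a \<Rightarrow> real \<times> real) \<Rightarrow> (real \<times> real) measure \<Rightarrow> bool" where
  "conv_distr2 M Z N \<longleftrightarrow>
     (\<forall>f :: real \<times> real \<Rightarrow> real. continuous_on UNIV f \<and> bounded (range f) \<longrightarrow>
        (\<lambda>n. integral\<^sup>L M (\<lambda>\<omega>. f (Z n \<omega>))) \<longlonglongrightarrow> integral\<^sup>L N f)"

end

theory Submission
  imports Defs
begin

text \<open>
  Write the sample as \<open>X\<^sub>i = u (E\<^sub>i)\<close> with independent standard exponential \<open>E\<^sub>i\<close> and
  \<open>u t = U (exp t)\<close>. The order statistics see only which index is the \<open>(k+1)\<close>-st largest and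
  which \<open>k\<close> indices lie above it; conditionally on the value \<open>t\<close> at that pivot the
  exceedances \<open>E\<^sub>j - t\<close> are again independent standard exponential, so the statistic is a
  mixture, over a Beta-type law of \<open>exp (- t)\<close> concentrating at \<open>k/n\<close>, of normalised sums of
  \<open>k\<close> independent copies of \<open>g (u (t + E) / u t)\<close>.

  Writing \<open>u (t + x) / u t = exp (\<gamma> x + dev t x)\<close>, the second-order condition says
  \<open>dev t x / a t \<longrightarrow> (exp (\<rho> x) - 1) / \<rho>\<close> pointwise; a Steinhaus-type measure argument upgrades
  this to \<open>\<bar>dev t x\<bar> \<le> C \<bar>a t\<bar>\<close> uniformly in \<open>x \<ge> 0\<close>, which is the domination needed for the
  limit of the characteristic functions of these triangular arrays. Convergence of the
  characteristic functions on the plane gives weak convergence by approximating a bounded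
  continuous function by trigonometric polynomials.
\<close>

section \<open>Second-order regular variation in additive form\<close>

text \<open>The law of the sample may have atoms, so the pivot is chosen by the order of the
  exponentials, which almost surely have no ties; a monotone \<open>u\<close> still transports their
  order statistics to those of the sample. The pivot needs concentration only, not a limit law:
  dividing by it cancels its first-order effect, and in the limit the rest depends on it through
  \<open>sqrt k * a t\<close> alone, which by uniform regular variation tends to \<mu> as soon as
  \<open>exp (- t) * (n / k)\<close> tends to 1. A second-moment bound for the Beta law therefore
  suffices, and no joint limit theorem for threshold and excesses is needed. \<open>A\<close> is
  only measurable, so uniformity in the shift cannot come from continuity and has to come from
  Lebesgue measure. The bias enters as the mean of the array, of order \<open>1 / sqrt k\<close>;
  \<open>\<gamma> * r < 1 / 2\<close> makes the squared majorant integrable. The variance of the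
  limit stays an integral as long as possible, so that its nonnegativity, on which the construction
  of the Gaussian law rests, comes for free.\<close>

lemma pointwise_null_common_point:
  fixes p q :: "nat \<Rightarrow> real \<Rightarrow> real" and s :: "nat \<Rightarrow> real"
  assumes [measurable]: "\<And>n. p n \<in> borel_measurable borel" "\<And>n. q n \<in> borel_measurable borel"
    and p: "\<And>x. (\<lambda>n. p n x) \<longlonglongrightarrow> 0" and q: "\<And>x. (\<lambda>n. q n x) \<longlonglongrightarrow> 0"
    and s: "\<And>n. \<bar>s n\<bar> \<le> 1" and e: "e > 0"
  shows "\<forall>\<^sub>F n in sequentially. \<exists>y\<in>{0..2}. \<bar>p n (s n + y)\<bar> < e \<and> \<bar>q n y\<bar> < e"
proof -
  \<comment> \<open>The window \<open>{-1..3}\<close> contains both \<open>y\<close> and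
    \<open>s n + y\<close> for \<open>y\<close> in \<open>{0..2}\<close>, and its finite length
    makes dominated convergence applicable.\<close>
  define B where "B f n = {x\<in>{-1..3}. e \<le> \<bar>f n x\<bar>}" for f :: "nat \<Rightarrow> real \<Rightarrow> real" and n
  have null: "(\<lambda>n. \<integral>x. indicator (B f n) x \<partial>lborel) \<longlonglongrightarrow> integral\<^sup>L lborel (\<lambda>x::real. 0::real)"
    if [measurable]: "\<And>n. f n \<in> borel_measurable borel" and f: "\<And>x. (\<lambda>n. f n x) \<longlonglongrightarrow> 0" for f
  proof (rule integral_dominated_convergence[where w = "indicator {-1..3::real}"])
    show "AE x in lborel. (\<lambda>n. indicator (B f n) x :: real) \<longlonglongrightarrow> 0"
    proof (intro always_eventually allI)
      fix x
      have "\<forall>\<^sub>F n in sequentially. \<bar>f n x\<bar> < e"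
        using f[of x] e tendsto_rabs_zero order_tendstoD(2) by blast
      then have "\<forall>\<^sub>F n in sequentially. indicator (B f n) x = (0::real)"
        by eventually_elim (auto simp: B_def)
      then show "(\<lambda>n. indicator (B f n) x :: real) \<longlonglongrightarrow> 0"
        by (rule tendsto_eventually)
    qed
  qed (auto simp: B_def split: split_indicator)
  have int: "integrable lborel (indicator (B f n) :: real \<Rightarrow> real)" 
    if [measurable]: "\<And>n. f n \<in> borel_measurable borel" for f n
    by (rule Bochner_Integration.integrable_bound[where f = "indicator {-1..3::real} :: real \<Rightarrow> real"])
       (auto simp: B_def split: split_indicator)
  have "(\<lambda>n. (\<integral>x. indicator (B p n) x \<partial>lborel) + (\<integral>x. indicator (B q n) x \<partial>lborel)) \<longlonglongrightarrow> (0::real)"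
    using tendsto_add[OF null[OF assms(1) p] null[OF assms(2) q]] by simp
  then have "\<forall>\<^sub>F n in sequentially. (\<integral>x. indicator (B p n) x \<partial>lborel) + (\<integral>x. indicator (B q n) x \<partial>lborel)
        < (2::real)"
    by (rule order_tendstoD) simp
  then show ?thesis
  proof eventually_elim
    case (elim n)
    show ?case
    proof (rule ccontr)
      assume "\<not> ?case"
      then have *: "e \<le> \<bar>p n (s n + y)\<bar> \<or> e \<le> \<bar>q n y\<bar>" if "y \<in> {0..2}" for y
        using that by force
      have sh: "integrable lborel (\<lambda>x. indicator (B p n) (s n + x) :: real)"
        using lborel_integrable_real_affine[OF int[of p n, OF assms(1)], of 1 "s n"] by simp
      \<comment> \<open>If every \<open>y\<close> in \<open>{0..2}\<close> were bad, that interval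
        would be covered by the bad set of \<open>q n\<close> and the translate by
        \<open>s n\<close> of the bad set of \<open>p n\<close>. Translation does not change
        measure, so an arbitrary sequence of shifts is harmless, and the two measures together are
        below the length 2.\<close>
      have "(2::real) = integral\<^sup>L lborel (indicator {0..2::real})" by simp
      also have "\<dots> \<le> (\<integral>y. indicator (B p n) (s n + y) + indicator (B q n) y \<partial>lborel)"
      proof (rule integral_mono)
        fix y :: real
        show "indicator {0..2} y \<le> (indicator (B p n) (s n + y) + indicator (B q n) y :: real)"
          using *[of y] s[of n] by (auto simp: B_def split: split_indicator)
      qed (use sh int[OF assms(2)] in auto)
      also have "\<dots> = (\<integral>y. indicator (B p n) (s n + y) \<partial>lborel) + (\<integral>y. indicator (B q n) y \<partial>lborel)"
        by (rule Bochner_Integration.integral_add[OF sh int[OF assms(2)]])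
      also have "(\<integral>y. indicator (B p n) (s n + y) \<partial>lborel) = (\<integral>x. indicator (B p n) x \<partial>lborel :: real)"
        using lborel_integral_real_affine[of 1 "indicator (B p n) :: real \<Rightarrow> real" "s n"] by simp
      finally show False using elim by simp
    qed
  qed
qed

text \<open>Logarithmic coordinates: \<open>a t\<close> stands for \<open>A (exp t)\<close> and
  \<open>s\<close> for \<open>ln x\<close>, so that regular variation becomes a statement about
  translations, for which Lebesgue measure is invariant.\<close>

locale second_order_regular =
  fixes u a :: "real \<Rightarrow> real" and \<gamma> \<rho> :: real
  assumes mono_u: "mono u" and u_nonneg: "\<And>t. 0 \<le> u t"
    and a_measurable[measurable]: "a \<in> borel_measurable borel"
    and a_sign: "(\<forall>\<^sub>F t in at_top. a t > 0) \<or> (\<forall>\<^sub>F t in at_top. a t < 0)"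
    and a_tendsto: "(a \<longlongrightarrow> 0) at_top"
    and \<rho>_neg: "\<rho> < 0"
    and second_order: "\<And>s. ((\<lambda>t. (u (t + s) / u t - exp (\<gamma> * s)) / a t) \<longlongrightarrow>
          exp (\<gamma> * s) * (exp (\<rho> * s) - 1) / \<rho>) at_top"
begin

definition \<psi> :: "real \<Rightarrow> real" where
  "\<psi> s = (exp (\<rho> * s) - 1) / \<rho>"

definition dev :: "real \<Rightarrow> real \<Rightarrow> real" where
  "dev t s = ln (u (t + s)) - ln (u t) - \<gamma> * s"

lemma u_measurable[measurable]: "u \<in> borel_measurable borel"
  by (rule borel_measurable_mono[OF mono_u])

lemma dev_measurable[measurable]: "dev t \<in> borel_measurable borel"
  unfolding dev_def[abs_def] by measurable

lemma shift_at_top: "filterlim (\<lambda>t. t + s) at_top (at_top :: real filter)" for s :: real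
  using filterlim_tendsto_add_at_top[OF tendsto_const[of s] filterlim_ident] by (simp add: add.commute)

lemma a_nonzero: "\<forall>\<^sub>F t in at_top. a t \<noteq> 0"
  using a_sign by (auto elim: eventually_mono)

lemma ratio_tendsto: "((\<lambda>t. u (t + s) / u t) \<longlongrightarrow> exp (\<gamma> * s)) at_top"
proof -
  have "((\<lambda>t. (u (t + s) / u t - exp (\<gamma> * s)) / a t * a t + exp (\<gamma> * s)) \<longlongrightarrow>
      exp (\<gamma> * s) * (exp (\<rho> * s) - 1) / \<rho> * 0 + exp (\<gamma> * s)) at_top"
    by (intro tendsto_intros second_order a_tendsto)
  then have "((\<lambda>t. (u (t + s) / u t - exp (\<gamma> * s)) / a t * a t + exp (\<gamma> * s)) \<longlongrightarrow> exp (\<gamma> * s)) at_top"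
    by (rule tendsto_eq_rhs) simp
  moreover have "\<forall>\<^sub>F t in at_top. (u (t + s) / u t - exp (\<gamma> * s)) / a t * a t + exp (\<gamma> * s) = u (t + s) / u t"
    using a_nonzero by eventually_elim simp
  ultimately show ?thesis
    by (rule Lim_transform_eventually)
qed

lemma u_pos: "\<forall>\<^sub>F t in at_top. u t > 0"
proof -
  have "\<forall>\<^sub>F t in at_top. u (t + 1) / u t > 0"
    using ratio_tendsto[of 1] by (rule order_tendstoD) simp
  then show ?thesis
  proof eventually_elim
    case (elim t)
    \<comment> \<open>Division by zero gives 0, so a positive ratio \<open>u (t + 1) / u t\<close>
      excludes \<open>u t = 0\<close>.\<close>
    then show ?case using u_nonneg[of t] by (cases "u t = 0") auto
  qed
qed

lemma dev_tendsto: "((\<lambda>t. dev t s / a t) \<longlongrightarrow> \<psi> s) at_top"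
proof -
  \<comment> \<open>Caratheodory's form of the derivative of \<open>ln\<close> at 1:
    \<open>ln w\<close> is \<open>g w * (w - 1)\<close> with \<open>g\<close> continuous at 1, which
    can be divided by \<open>a t\<close> without treating \<open>w t = 1\<close> separately.\<close>
  obtain g where g: "\<And>z. ln z - ln 1 = g z * (z - 1)" "isCont g 1" "g 1 = (1::real)"
    using DERIV_ln[of "1::real"] unfolding CARAT_DERIV by (metis inverse_1 zero_less_one)
  define w where "w t = u (t + s) / u t * exp (- (\<gamma> * s))" for t
  have w: "(w \<longlongrightarrow> 1) at_top"
    using tendsto_mult[OF ratio_tendsto[of s] tendsto_const[of "exp (- (\<gamma> * s))"]]
    by (simp add: w_def[abs_def] exp_minus)
  have wa: "((\<lambda>t. (w t - 1) / a t) \<longlongrightarrow> \<psi> s) at_top"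
  proof -
    have "((\<lambda>t. (u (t + s) / u t - exp (\<gamma> * s)) / a t * exp (- (\<gamma> * s))) \<longlongrightarrow>
        exp (\<gamma> * s) * (exp (\<rho> * s) - 1) / \<rho> * exp (- (\<gamma> * s))) at_top"
      by (intro tendsto_intros second_order)
    moreover have "(\<lambda>t. (u (t + s) / u t - exp (\<gamma> * s)) / a t * exp (- (\<gamma> * s))) = (\<lambda>t. (w t - 1) / a t)"
      by (simp add: w_def fun_eq_iff left_diff_distrib flip: exp_add)
    moreover have "exp (\<gamma> * s) * (exp (\<rho> * s) - 1) / \<rho> * exp (- (\<gamma> * s)) = \<psi> s"
      by (simp add: \<psi>_def exp_minus)
    ultimately show ?thesis by simp
  qed
  have lim: "((\<lambda>t. g (w t) * ((w t - 1) / a t)) \<longlongrightarrow> 1 * \<psi> s) at_top"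
    using isCont_tendsto_compose[OF g(2) w] g(3) by (intro tendsto_mult wa) simp
  have "\<forall>\<^sub>F t in at_top. g (w t) * ((w t - 1) / a t) = dev t s / a t"
    using u_pos eventually_compose_filterlim[OF u_pos shift_at_top[of s]]
  proof eventually_elim
    case (elim t)
    then show ?case
      using g(1)[of "w t"] by (simp add: w_def dev_def ln_mult ln_div)
  qed
  then show ?thesis
    using Lim_transform_eventually[OF lim] by simp
qed

text \<open>This cocycle identity is the reason for taking logarithms: errors over consecutive
  shifts add up. It drives the variation of \<open>a\<close>, the local bound and the global
  bound.\<close>

lemma dev_add: "dev t (s + s') = dev t s + dev (t + s) s'"
  by (simp add: dev_def algebra_simps)

text \<open>The second-order condition alone forces \<open>a\<close> to vary regularly with index
  \<rho>: by the cocycle identity \<open>a (t + s) / a t\<close> is a quotient of deviations over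
  the shifts \<open>s + 1\<close>, \<open>s\<close> and 1, each normalised by \<open>a\<close>, and
  the limits of these are known.\<close>

lemma a_ratio_tendsto: "((\<lambda>t. a (t + s) / a t) \<longlongrightarrow> exp (\<rho> * s)) at_top"
proof -
  have psi1: "\<psi> 1 \<noteq> 0" using \<rho>_neg by (simp add: \<psi>_def)
  have shifted: "((\<lambda>t. dev (t + s) 1 / a (t + s)) \<longlongrightarrow> \<psi> 1) at_top"
    by (rule filterlim_compose[OF dev_tendsto shift_at_top])
  have lim: "((\<lambda>t. (dev t (s + 1) / a t - dev t s / a t) / (dev (t + s) 1 / a (t + s))) \<longlongrightarrow>
      (\<psi> (s + 1) - \<psi> s) / \<psi> 1) at_top"
    by (intro tendsto_intros dev_tendsto psi1 shifted)
  have eq: "(\<psi> (s + 1) - \<psi> s) / \<psi> 1 = exp (\<rho> * s)"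
    using \<rho>_neg psi1 by (simp add: \<psi>_def field_simps exp_add)
  have "\<forall>\<^sub>F t in at_top. dev (t + s) 1 / a (t + s) \<noteq> 0"
    using shifted psi1 by (rule tendsto_imp_eventually_ne)
  then have "\<forall>\<^sub>F t in at_top. (dev t (s + 1) / a t - dev t s / a t) / (dev (t + s) 1 / a (t + s)) =
        a (t + s) / a t"
    using a_nonzero by eventually_elim (auto simp: dev_add[of _ s 1] add_divide_distrib)
  then show ?thesis
    by (rule Lim_transform_eventually[OF lim[unfolded eq]])
qed

lemma ln_a_tendsto: "((\<lambda>t. ln (\<bar>a (t + s)\<bar>) - ln (\<bar>a t\<bar>) - \<rho> * s) \<longlongrightarrow> 0) at_top"
proof -
  have lim: "((\<lambda>t. ln (\<bar>a (t + s) / a t\<bar>) - \<rho> * s) \<longlongrightarrow> ln (\<bar>exp (\<rho> * s)\<bar>) - \<rho> * s) at_top"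
    by (intro tendsto_intros a_ratio_tendsto) auto
  have "\<forall>\<^sub>F t in at_top. ln (\<bar>a (t + s) / a t\<bar>) - \<rho> * s = ln (\<bar>a (t + s)\<bar>) - ln (\<bar>a t\<bar>) - \<rho> * s"
    using a_nonzero eventually_compose_filterlim[OF a_nonzero shift_at_top[of s]]
    by eventually_elim (simp add: ln_div abs_divide)
  then have "((\<lambda>t. ln (\<bar>a (t + s)\<bar>) - ln (\<bar>a t\<bar>) - \<rho> * s) \<longlongrightarrow> ln (\<bar>exp (\<rho> * s)\<bar>) - \<rho> * s) at_top"
    by (rule Lim_transform_eventually[OF lim])
  then show ?thesis
    by (rule tendsto_eq_rhs) simp
qed

section \<open>Uniformity over bounded shifts and the global bound on the deviation\<close>

lemma shift_sequentially:
  fixes t s :: "nat \<Rightarrow> real"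
  assumes t: "filterlim t at_top sequentially" and s: "\<And>n. \<bar>s n\<bar> \<le> 1"
  shows "filterlim (\<lambda>n. t n + s n) at_top sequentially"
proof -
  have "filterlim (\<lambda>n. t n + (-1)) at_top sequentially"
    by (rule filterlim_compose[OF shift_at_top t])
  then show ?thesis
  proof (rule filterlim_at_top_mono, intro always_eventually allI)
    show "t n + - 1 \<le> t n + s n" for n
      using s[of n] by linarith
  qed
qed

text \<open>The uniform convergence theorem of regular variation in sequential form. The value at
  the moving shift \<open>s n\<close> is the difference of the value at \<open>s n + y\<close> from
  base \<open>t n\<close> and the value at \<open>y\<close> from base \<open>t n + s n\<close>; a
  common \<open>y\<close> with both small exists although only pointwise limits are known.\<close>

lemma ln_a_tendsto_uniform:
  fixes t s :: "nat \<Rightarrow> real"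
  assumes t: "filterlim t at_top sequentially" and s: "\<And>n. \<bar>s n\<bar> \<le> 1"
  shows "(\<lambda>n. ln (\<bar>a (t n + s n)\<bar>) - ln (\<bar>a (t n)\<bar>) - \<rho> * s n) \<longlonglongrightarrow> 0"
proof (rule LIMSEQ_I)
  fix e :: real assume e: "0 < e"
  let ?p = "\<lambda>t y. ln (\<bar>a (t + y)\<bar>) - ln (\<bar>a t\<bar>) - \<rho> * y"
  have "\<forall>\<^sub>F n in sequentially. \<exists>y\<in>{0..2}. \<bar>?p (t n) (s n + y)\<bar> < e / 2 \<and> \<bar>?p (t n + s n) y\<bar> < e / 2"
  proof (intro pointwise_null_common_point s)
    show "(\<lambda>n. ?p (t n) y) \<longlonglongrightarrow> 0" for y
      by (rule filterlim_compose[OF ln_a_tendsto t])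
    show "(\<lambda>n. ?p (t n + s n) y) \<longlonglongrightarrow> 0" for y
      by (rule filterlim_compose[OF ln_a_tendsto shift_sequentially[OF t s]])
    show "?p (t n) \<in> borel_measurable borel" "?p (t n + s n) \<in> borel_measurable borel" for n
      by measurable
    show "0 < e / 2" using e by simp
  qed
  then have "\<forall>\<^sub>F n in sequentially. norm (?p (t n) (s n) - 0) < e"
  proof eventually_elim
    case (elim n)
    then obtain y where y: "\<bar>?p (t n) (s n + y)\<bar> < e / 2" "\<bar>?p (t n + s n) y\<bar> < e / 2" by blast
    have tri: "\<bar>z - w\<bar> < e" if "\<bar>z\<bar> < e / 2" "\<bar>w\<bar> < e / 2" for z w :: real
      using that by linarith
    have eq: "?p (t n) (s n) = ?p (t n) (s n + y) - ?p (t n + s n) y"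
      by (simp add: distrib_left add.assoc)
    show ?case
      unfolding diff_0_right real_norm_def eq by (rule tri[OF y])
  qed
  then show "\<exists>no. \<forall>n\<ge>no. norm (?p (t n) (s n) - 0) < e"
    by (simp add: eventually_sequentially)
qed

lemma a_ratio_tendsto_uniform:
  fixes t s :: "nat \<Rightarrow> real"
  assumes t: "filterlim t at_top sequentially" and s: "\<And>n. \<bar>s n\<bar> \<le> 1"
  shows "(\<lambda>n. a (t n + s n) / a (t n) * exp (- \<rho> * s n)) \<longlonglongrightarrow> 1"
proof -
  have lim: "(\<lambda>n. exp (ln (\<bar>a (t n + s n)\<bar>) - ln (\<bar>a (t n)\<bar>) - \<rho> * s n)) \<longlonglongrightarrow> exp 0"
    by (intro tendsto_exp ln_a_tendsto_uniform assms)
  have ts: "filterlim (\<lambda>n. t n + s n) at_top sequentially"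
    by (rule shift_sequentially[OF t s])
  have "\<forall>\<^sub>F n in sequentially. a (t n + s n) / a (t n) > 0"
    using a_sign
  proof
    assume *: "\<forall>\<^sub>F t in at_top. a t > 0"
    show ?thesis
      using eventually_compose_filterlim[OF * t] eventually_compose_filterlim[OF * ts]
      by eventually_elim simp
  next
    assume *: "\<forall>\<^sub>F t in at_top. a t < 0"
    show ?thesis
      using eventually_compose_filterlim[OF * t] eventually_compose_filterlim[OF * ts]
      by eventually_elim (simp add: divide_neg_neg)
  qed
  then have "\<forall>\<^sub>F n in sequentially. exp (ln (\<bar>a (t n + s n)\<bar>) - ln (\<bar>a (t n)\<bar>) - \<rho> * s n) =
      a (t n + s n) / a (t n) * exp (- \<rho> * s n)"
  proof eventually_elim
    case (elim n)
    then have "a (t n + s n) \<noteq> 0" "a (t n) \<noteq> 0" by auto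
    moreover have "\<bar>a (t n + s n)\<bar> / \<bar>a (t n)\<bar> = a (t n + s n) / a (t n)"
      using elim by (simp flip: abs_divide)
    ultimately show ?case
      by (simp add: exp_diff exp_minus divide_inverse)
  qed
  then show ?thesis
    using Lim_transform_eventually[OF lim] by simp
qed

lemma \<psi>_bound: "0 \<le> s \<Longrightarrow> \<bar>\<psi> s\<bar> \<le> 1 / \<bar>\<rho>\<bar>"
proof -
  assume "0 \<le> s"
  then have "exp (\<rho> * s) \<le> 1" using \<rho>_neg by (simp add: mult_nonpos_nonneg)
  then have "\<bar>exp (\<rho> * s) - 1\<bar> \<le> 1" using exp_gt_zero[of "\<rho> * s"] by linarith
  then show ?thesis
    unfolding \<psi>_def abs_divide by (rule divide_right_mono) simp
qed

text \<open>A failure for every constant gives sequences \<open>t n\<close>, \<open>s n\<close> with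
  \<open>\<bar>dev\<bar>\<close> above \<open>n * \<bar>a\<bar>\<close>. At a common good point
  \<open>y\<close> the deviations over \<open>s n + y\<close> and over \<open>y\<close> from the
  shifted base are both controlled, and the cocycle identity bounds their difference
  \<open>dev (t n) (s n)\<close>.\<close>

lemma dev_locally_bounded:
  "\<exists>C t0. \<forall>t\<ge>t0. \<forall>s\<in>{0..1}. \<bar>dev t s\<bar> \<le> C * \<bar>a t\<bar>"
proof (rule ccontr)
  assume "\<not> ?thesis"
  then have unbounded: "\<not> (\<forall>t\<ge>real n. \<forall>s\<in>{0..1}. \<bar>dev t s\<bar> \<le> real n * \<bar>a t\<bar>)" for n
    by blast
  have "\<exists>t s. real n \<le> t \<and> s \<in> {0..1} \<and> real n * \<bar>a t\<bar> < \<bar>dev t s\<bar>" for n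
  proof (rule ccontr)
    assume "\<not> ?thesis"
    then have "\<forall>t\<ge>real n. \<forall>s\<in>{0..1}. \<not> real n * \<bar>a t\<bar> < \<bar>dev t s\<bar>"
      by blast
    then show False
      using unbounded[of n] unfolding not_less by blast
  qed
  then obtain t s where t: "\<And>n. real n \<le> t n" and s: "\<And>n. s n \<in> {0..1}"
    and large: "\<And>n. real n * \<bar>a (t n)\<bar> < \<bar>dev (t n) (s n)\<bar>"
    by metis
  have s': "\<bar>s n\<bar> \<le> 1" for n using s[of n] by auto
  have t': "filterlim t at_top sequentially"
    by (rule filterlim_at_top_mono[OF filterlim_real_sequentially]) (use t in auto)
  note ts = shift_sequentially[OF t' s']
  \<comment> \<open>\<psi> is at most \<open>1 / \<bar>\<rho>\<bar>\<close> on the nonnegative half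
    line, so \<open>c\<close> bounds every normalised deviation within distance 1 of \<psi>. The
    final constant \<open>3 * c\<close> is \<open>c\<close> for the first deviation and
    \<open>2 * c\<close> for the second, whose base satisfies
    \<open>\<bar>a (t n + s n)\<bar> \<le> 2 * \<bar>a (t n)\<bar>\<close>.\<close>
  define c where "c = 1 + 1 / \<bar>\<rho>\<bar>"
  have tri: "\<bar>z\<bar> \<le> c" if "\<bar>z - w\<bar> < 1" "\<bar>w\<bar> \<le> 1 / \<bar>\<rho>\<bar>" for z w
    using that abs_triangle_ineq[of "z - w" w] unfolding c_def by (simp del: abs_divide)
  have null: "(\<lambda>n. dev (t' n) y / a (t' n) - \<psi> y) \<longlonglongrightarrow> 0" if "filterlim t' at_top sequentially" for t' ::
        "nat \<Rightarrow> real" and y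
    by (rule LIM_zero[OF filterlim_compose[OF dev_tendsto that]])
  have "\<forall>\<^sub>F n in sequentially. \<exists>y\<in>{0..2}. \<bar>dev (t n) (s n + y) / a (t n) - \<psi> (s n + y)\<bar> < 1 \<and>
      \<bar>dev (t n + s n) y / a (t n + s n) - \<psi> y\<bar> < 1"
  proof (intro pointwise_null_common_point null t' ts s')
    show "(\<lambda>y. dev (t n) y / a (t n) - \<psi> y) \<in> borel_measurable borel"
      "(\<lambda>y. dev (t n + s n) y / a (t n + s n) - \<psi> y) \<in> borel_measurable borel" for n
      unfolding \<psi>_def by measurable
  qed simp
  moreover have "\<forall>\<^sub>F n in sequentially. a (t n + s n) / a (t n) * exp (- \<rho> * s n) < 2"
    using a_ratio_tendsto_uniform[OF t' s'] by (rule order_tendstoD) simp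
  moreover have "\<forall>\<^sub>F n in sequentially. a (t n + s n) / a (t n) * exp (- \<rho> * s n) > 0"
    using a_ratio_tendsto_uniform[OF t' s'] by (rule order_tendstoD) simp
  moreover have "\<forall>\<^sub>F n in sequentially. real n \<ge> 3 * c"
    using filterlim_real_sequentially by (simp add: filterlim_at_top)
  ultimately have "\<forall>\<^sub>F n::nat in sequentially. False"
  proof eventually_elim
    case (elim n)
    then obtain y where y: "y \<in> {0..2}" "\<bar>dev (t n) (s n + y) / a (t n) - \<psi> (s n + y)\<bar> < 1"
      "\<bar>dev (t n + s n) y / a (t n + s n) - \<psi> y\<bar> < 1" by blast
    have sn: "0 \<le> s n" using s[of n] by simp
    have nz: "a (t n) \<noteq> 0" "a (t n + s n) \<noteq> 0" using elim(3) by auto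
    have "\<bar>dev (t n) (s n + y) / a (t n)\<bar> \<le> c"
      by (rule tri[OF y(2) \<psi>_bound]) (use y(1) sn in simp)
    then have 1: "\<bar>dev (t n) (s n + y)\<bar> \<le> c * \<bar>a (t n)\<bar>"
      using nz by (simp add: abs_divide pos_divide_le_eq)
    have "\<bar>dev (t n + s n) y / a (t n + s n)\<bar> \<le> c"
      by (rule tri[OF y(3) \<psi>_bound]) (use y(1) in simp)
    then have 2: "\<bar>dev (t n + s n) y\<bar> \<le> c * \<bar>a (t n + s n)\<bar>"
      using nz by (simp add: abs_divide pos_divide_le_eq)
    have "0 < a (t n + s n) / a (t n)" by (rule zero_less_mult_pos2[OF elim(3) exp_gt_zero])
    moreover have "1 \<le> exp (- \<rho> * s n)" using \<rho>_neg sn by (simp add: mult_nonpos_nonneg)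
    ultimately have "a (t n + s n) / a (t n) \<le> a (t n + s n) / a (t n) * exp (- \<rho> * s n)"
      using mult_left_mono[of 1 "exp (- \<rho> * s n)" "a (t n + s n) / a (t n)"]
      by (simp only: mult_1_right less_imp_le)
    then have "\<bar>a (t n + s n) / a (t n)\<bar> \<le> 2"
      using elim(2) \<open>0 < a (t n + s n) / a (t n)\<close> by linarith
    then have 3: "\<bar>a (t n + s n)\<bar> \<le> 2 * \<bar>a (t n)\<bar>"
      using nz by (simp add: abs_divide pos_divide_le_eq)
    have c: "c \<ge> 0" by (simp add: c_def)
    have "\<bar>dev (t n) (s n)\<bar> \<le> \<bar>dev (t n) (s n + y)\<bar> + \<bar>dev (t n + s n) y\<bar>"
      using abs_triangle_ineq4[of "dev (t n) (s n + y)" "dev (t n + s n) y"] by (simp add: dev_add)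
    also have "\<dots> \<le> c * \<bar>a (t n)\<bar> + c * (2 * \<bar>a (t n)\<bar>)"
      by (intro add_mono 1 order_trans[OF 2 mult_left_mono[OF 3 c]])
    also have "\<dots> = 3 * c * \<bar>a (t n)\<bar>" by simp
    also have "\<dots> \<le> real n * \<bar>a (t n)\<bar>"
      by (rule mult_right_mono) (use elim in auto)
    finally show False using large[of n] by simp
  qed
  then show False by simp
qed

text \<open>Cut the shift into unit steps. As \<rho> is negative, \<open>\<bar>a\<bar>\<close>
  eventually shrinks by a factor \<theta> below 1 in each step, so the local bounds sum to a
  convergent geometric series, however long the shift.\<close>

lemma dev_bounded:
  "\<exists>C t0. C \<ge> 0 \<and> (\<forall>t\<ge>t0. \<forall>s\<ge>0. \<bar>dev t s\<bar> \<le> C * \<bar>a t\<bar>)"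
proof -
  define \<theta> where "\<theta> = (1 + exp \<rho>) / 2"
  have \<theta>: "exp \<rho> < \<theta>" "\<theta> < 1" using \<rho>_neg by (auto simp: \<theta>_def)
  obtain C t0 where C: "\<And>t s. t \<ge> t0 \<Longrightarrow> s \<in> {0..1} \<Longrightarrow> \<bar>dev t s\<bar> \<le> C * \<bar>a t\<bar>"
    using dev_locally_bounded by blast
  have "((\<lambda>t. \<bar>a (t + 1) / a t\<bar>) \<longlongrightarrow> \<bar>exp (\<rho> * 1)\<bar>) at_top"
    by (intro tendsto_intros a_ratio_tendsto)
  then have "\<forall>\<^sub>F t in at_top. \<bar>a (t + 1) / a t\<bar> < \<theta>"
    by (rule order_tendstoD) (use \<theta> in simp)
  then have "\<forall>\<^sub>F t in at_top. \<bar>a (t + 1)\<bar> \<le> \<theta> * \<bar>a t\<bar>"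
    using a_nonzero by eventually_elim (simp add: abs_divide field_simps)
  then obtain t1 where t1: "\<And>t. t \<ge> t1 \<Longrightarrow> \<bar>a (t + 1)\<bar> \<le> \<theta> * \<bar>a t\<bar>"
    by (auto simp: eventually_at_top_linorder)
  \<comment> \<open>The sum of the geometric series, that is, the solution of
    \<open>K = max C 0 + K * \<theta>\<close>; this fixed-point equation lets the induction over
    unit steps return the same constant.\<close>
  define K where "K = max C 0 / (1 - \<theta>)"
  have K1: "K \<ge> 0" "max C 0 = K * (1 - \<theta>)"
    using \<theta> by (auto simp: K_def)
  moreover have "0 \<le> K * \<theta>"
    using K1 \<theta>(1) exp_gt_zero[of \<rho>] by (intro mult_nonneg_nonneg) linarith+
  ultimately have K: "K \<ge> 0" "max C 0 + K * \<theta> = K" "max C 0 \<le> K"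
    by (auto simp: algebra_simps)
  have bound: "\<bar>dev t s\<bar> \<le> K * \<bar>a t\<bar>" if "max t0 t1 \<le> t" "0 \<le> s" "s \<le> real m" for t s m
    using that
  proof (induction m arbitrary: t s)
    case 0
    then show ?case using K by (simp add: dev_def)
  next
    case (Suc m)
    show ?case
    proof (cases "s \<le> 1")
      case True
      then have "\<bar>dev t s\<bar> \<le> C * \<bar>a t\<bar>" using Suc C by auto
      also have "\<dots> \<le> K * \<bar>a t\<bar>" using K by (intro mult_right_mono) auto
      finally show ?thesis .
    next
      case False
      have "\<bar>dev t 1\<bar> \<le> max C 0 * \<bar>a t\<bar>"
        by (rule order_trans[OF C]) (use Suc.prems in \<open>auto intro!: mult_right_mono\<close>)
      moreover have "\<bar>dev (t + 1) (s - 1)\<bar> \<le> K * \<bar>a (t + 1)\<bar>"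
        using Suc.prems False by (intro Suc.IH) auto
      moreover have "K * \<bar>a (t + 1)\<bar> \<le> K * (\<theta> * \<bar>a t\<bar>)"
        using K t1[of t] Suc.prems by (intro mult_left_mono) auto
      moreover have "\<bar>dev t s\<bar> \<le> \<bar>dev t 1\<bar> + \<bar>dev (t + 1) (s - 1)\<bar>"
        using dev_add[of t 1 "s - 1"] abs_triangle_ineq[of "dev t 1" "dev (t + 1) (s - 1)"] by simp
      moreover have "max C 0 * \<bar>a t\<bar> + K * (\<theta> * \<bar>a t\<bar>) = K * \<bar>a t\<bar>"
        using K(2) by (metis distrib_right mult.assoc)
      ultimately show ?thesis by linarith
    qed
  qed
  show ?thesis
  proof (intro exI conjI allI impI)
    show "0 \<le> K" by (rule K)
    fix t s :: real assume ts: "max t0 t1 \<le> t" "0 \<le> s"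
    obtain m :: nat where "s \<le> real m" using real_arch_simple by blast
    then show "\<bar>dev t s\<bar> \<le> K * \<bar>a t\<bar>" by (rule bound[OF ts])
  qed
qed

end

section \<open>Weak convergence in the plane\<close>

text \<open>Frequencies are arbitrary real pairs rather than lattice points, which matches the
  arguments at which characteristic functions converge. Closure under products comes from the
  product-to-sum formulas and need not be built in.\<close>

inductive trig_poly :: "(real \<times> real \<Rightarrow> real) \<Rightarrow> bool" where
  trig_cos: "trig_poly (\<lambda>z. cos (a * fst z + b * snd z))"
| trig_sin: "trig_poly (\<lambda>z. sin (a * fst z + b * snd z))"
| trig_add: "trig_poly f \<Longrightarrow> trig_poly g \<Longrightarrow> trig_poly (\<lambda>z. f z + g z)"
| trig_scale: "trig_poly f \<Longrightarrow> trig_poly (\<lambda>z. c * f z)"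

lemma linear_form_diff_add:
  fixes a a' b b' x y :: real
  shows "(a' - a) * x + (b' - b) * y = (a' * x + b' * y) - (a * x + b * y)"
    "(a' + a) * x + (b' + b) * y = (a' * x + b' * y) + (a * x + b * y)"
  by (simp_all add: algebra_simps)

lemma trig_poly_mult_cos:
  assumes "trig_poly f"
  shows "trig_poly (\<lambda>z. f z * cos (a * fst z + b * snd z))"
  using assms
proof induction
  case (trig_cos a' b')
  have "(\<lambda>z. cos (a' * fst z + b' * snd z) * cos (a * fst z + b * snd z)) =
      (\<lambda>z. 1/2 * (cos ((a' - a) * fst z + (b' - b) * snd z) + cos ((a' + a) * fst z + (b' + b) * snd z)))"
    by (simp add: fun_eq_iff cos_times_cos linear_form_diff_add diff_divide_distrib add_divide_distrib)
  then show ?case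
    by (simp only: trig_poly.intros)
next
  case (trig_sin a' b')
  have "(\<lambda>z. sin (a' * fst z + b' * snd z) * cos (a * fst z + b * snd z)) =
      (\<lambda>z. 1/2 * (sin ((a' + a) * fst z + (b' + b) * snd z) + sin ((a' - a) * fst z + (b' - b) * snd z)))"
    by (simp add: fun_eq_iff sin_times_cos linear_form_diff_add diff_divide_distrib add_divide_distrib)
  then show ?case
    by (simp only: trig_poly.intros)
next
  case (trig_add f g)
  then show ?case by (simp only: distrib_right trig_poly.intros)
next
  case (trig_scale f c)
  then show ?case by (simp only: mult.assoc trig_poly.intros)
qed

lemma trig_poly_mult_sin:
  assumes "trig_poly f"
  shows "trig_poly (\<lambda>z. f z * sin (a * fst z + b * snd z))"
  using assms
proof induction
  case (trig_cos a' b')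
  have "(\<lambda>z. cos (a' * fst z + b' * snd z) * sin (a * fst z + b * snd z)) =
      (\<lambda>z. 1/2 * (sin ((a' + a) * fst z + (b' + b) * snd z) + (-1) * sin ((a' - a) * fst z + (b' - b) *
            snd z)))"
    by (simp add: fun_eq_iff cos_times_sin linear_form_diff_add diff_divide_distrib add_divide_distrib)
  then show ?case
    by (simp only: trig_poly.intros)
next
  case (trig_sin a' b')
  have "(\<lambda>z. sin (a' * fst z + b' * snd z) * sin (a * fst z + b * snd z)) =
      (\<lambda>z. 1/2 * (cos ((a' - a) * fst z + (b' - b) * snd z) + (-1) * cos ((a' + a) * fst z + (b' + b) *
            snd z)))"
    by (simp add: fun_eq_iff sin_times_sin linear_form_diff_add diff_divide_distrib add_divide_distrib)
  then show ?case
    by (simp only: trig_poly.intros)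
next
  case (trig_add f g)
  then show ?case by (simp only: distrib_right trig_poly.intros)
next
  case (trig_scale f c)
  then show ?case by (simp only: mult.assoc trig_poly.intros)
qed

lemma trig_poly_mult:
  assumes "trig_poly g" "trig_poly f"
  shows "trig_poly (\<lambda>z. f z * g z)"
  using assms(1)
proof induction
  case (trig_add g h)
  then show ?case by (simp only: distrib_left trig_poly.intros)
next
  case (trig_scale g c)
  have "(\<lambda>z. f z * (c * g z)) = (\<lambda>z. c * (f z * g z))" by (simp add: fun_eq_iff)
  with trig_scale show ?case by (simp only: trig_poly.intros)
qed (use assms(2) in \<open>simp_all add: trig_poly_mult_cos trig_poly_mult_sin\<close>)

lemma trig_poly_const: "trig_poly (\<lambda>z. c)"
  using trig_scale[OF trig_cos[of 0 0], of c] by simp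

lemma trig_poly_compose_sin:
  assumes "real_polynomial_function q"
  shows "trig_poly (\<lambda>z. q (sin (c * fst z), sin (c * snd z)))"
  using assms
proof induction
  case (linear f)
  interpret bounded_linear f by fact
  have eval: "f (x, y) = f (1, 0) * x + f (0, 1) * y" for x y
  proof -
    have "f (x, y) = f (x *\<^sub>R (1, 0) + y *\<^sub>R (0, 1))" by simp
    also have "\<dots> = f (1, 0) * x + f (0, 1) * y" unfolding add scaleR by simp
    finally show ?thesis .
  qed
  have "(\<lambda>z. f (sin (c * fst z), sin (c * snd z))) =
      (\<lambda>z. f (1, 0) * sin (c * fst z + 0 * snd z) + f (0, 1) * sin (0 * fst z + c * snd z))"
  proof
    fix z :: "real \<times> real"
    show "f (sin (c * fst z), sin (c * snd z)) =
        f (1, 0) * sin (c * fst z + 0 * snd z) + f (0, 1) * sin (0 * fst z + c * snd z)"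
      using eval[of "sin (c * fst z)" "sin (c * snd z)"] by simp
  qed
  then show ?case
    by (simp only: trig_poly.intros)
qed (simp_all add: trig_poly_const trig_poly.intros trig_poly_mult)

lemma trig_poly_continuous: "trig_poly f \<Longrightarrow> continuous_on UNIV f"
  by (induction rule: trig_poly.induct) (auto intro!: continuous_intros)

lemma trig_poly_bounded: "trig_poly f \<Longrightarrow> \<exists>B. \<forall>z. \<bar>f z\<bar> \<le> B"
proof (induction rule: trig_poly.induct)
  case (trig_add f g)
  then obtain B C where "\<forall>z. \<bar>f z\<bar> \<le> B" "\<forall>z. \<bar>g z\<bar> \<le> C" by blast
  then have "\<bar>f z + g z\<bar> \<le> B + C" for z
    by (meson abs_triangle_ineq add_mono order_trans)
  then show ?case by blast
next
  case (trig_scale f c)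
  then obtain B where B: "\<forall>z. \<bar>f z\<bar> \<le> B" by blast
  have "\<bar>c * f z\<bar> \<le> \<bar>c\<bar> * B" for z
    unfolding abs_mult by (intro mult_left_mono B[rule_format]) simp
  then show ?case by blast
qed (auto intro!: exI[of _ 1])

section \<open>Approximating bounded continuous functions by trigonometric polynomials\<close>

lemma integrable_bounded_continuous:
  fixes f :: "real \<times> real \<Rightarrow> real"
  assumes "prob_space N" "sets N = sets borel" "continuous_on UNIV f" "\<And>z. \<bar>f z\<bar> \<le> B"
  shows "integrable N f"
proof -
  interpret prob_space N by fact
  have "f \<in> borel_measurable N"
    using borel_measurable_continuous_onI[OF assms(3)] assms(2) measurable_cong_sets by blast
  then show ?thesis
    using assms(4) by (intro integrable_const_bound[of _ B]) auto
qed

text \<open>A continuous stand-in for the indicator of \<open>\<bar>x\<bar> > T\<close>: its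
  expectation converges under weak convergence, so it can carry the tightness estimate.\<close>

definition cutoff :: "real \<Rightarrow> real \<Rightarrow> real" where
  "cutoff T x = min 1 (max 0 (\<bar>x\<bar> - T))"

lemma cutoff_bounds: "0 \<le> cutoff T x" "cutoff T x \<le> 1"
  by (auto simp: cutoff_def)

lemma cutoff_eq_1: "T + 1 < \<bar>x\<bar> \<Longrightarrow> cutoff T x = 1"
  by (auto simp: cutoff_def)

lemma continuous_on_cutoff[continuous_intros]:
  "continuous_on S f \<Longrightarrow> continuous_on S (\<lambda>x. cutoff T (f x))"
  unfolding cutoff_def by (intro continuous_intros)

lemma cutoff_tendsto: "(\<lambda>n. cutoff (real n) x) \<longlonglongrightarrow> 0"
proof (rule tendsto_eventually)
  have "\<forall>\<^sub>F n in sequentially. \<bar>x\<bar> \<le> real n"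
    using filterlim_real_sequentially by (simp add: filterlim_at_top)
  then show "\<forall>\<^sub>F n in sequentially. cutoff (real n) x = 0"
    by eventually_elim (simp add: cutoff_def)
qed

text \<open>Substituting \<open>sin (c x)\<close> makes the approximating polynomial a trigonometric one that
  is bounded on the whole plane, not only on the square.\<close>

lemma trig_poly_approx:
  fixes f :: "real \<times> real \<Rightarrow> real"
  assumes f: "continuous_on UNIV f" "\<And>z. \<bar>f z\<bar> \<le> B" and "T \<ge> 0" "e > 0"
  obtains p where "trig_poly p"
    "\<And>z. \<bar>f z - p z\<bar> \<le> e + 2 * B * (cutoff T (fst z) + cutoff T (snd z))"
proof -
  \<comment> \<open>Scaled so that \<open>\<bar>x\<bar> \<le> T + 1\<close> means
    \<open>\<bar>c * x\<bar> \<le> pi / 2\<close>, the range on which \<open>arcsin\<close> inverts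
    \<open>sin\<close>. On that square the substitution loses nothing.\<close>
  define c where "c = pi / (2 * (T + 1))"
  have c: "c > 0" using \<open>T \<ge> 0\<close> by (simp add: c_def)
  define F where "F w = f (arcsin (fst w) / c, arcsin (snd w) / c)" for w :: "real \<times> real"
  have "continuous_on ({-1..1} \<times> {-1..1}) F"
    unfolding F_def using c
    by (intro continuous_on_compose2[OF f(1)] continuous_intros) auto
  then obtain q where q: "real_polynomial_function q"
      and qF: "\<And>w. w \<in> {-1..1} \<times> {-1..1} \<Longrightarrow> \<bar>F w - q w\<bar> < e"
    by (rule Stone_Weierstrass_real_polynomial_function[OF compact_Times[OF compact_Icc compact_Icc] _ \<open>e
          > 0\<close>]) blast
  show thesis
  proof (rule that)
    show "trig_poly (\<lambda>z. q (sin (c * fst z), sin (c * snd z)))"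
      by (rule trig_poly_compose_sin[OF q])
    fix z :: "real \<times> real"
    let ?w = "(sin (c * fst z), sin (c * snd z))"
    have near: "\<bar>F ?w - q ?w\<bar> < e" by (rule qF) simp
    have B: "B \<ge> 0" using f(2)[of z] by linarith
    have "\<bar>f z - F ?w\<bar> \<le> 2 * B * (cutoff T (fst z) + cutoff T (snd z))"
    proof (cases "\<bar>fst z\<bar> \<le> T + 1 \<and> \<bar>snd z\<bar> \<le> T + 1")
      case True
      have "arcsin (sin (c * x)) = c * x" if "\<bar>x\<bar> \<le> T + 1" for x
      proof (rule arcsin_sin)
        have "c * \<bar>x\<bar> \<le> c * (T + 1)" using that c by (intro mult_left_mono) auto
        also have "\<dots> = pi / 2" using \<open>T \<ge> 0\<close> by (simp add: c_def field_simps)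
        finally have "\<bar>c * x\<bar> \<le> pi / 2" using c by (simp add: abs_mult)
        then show "- (pi / 2) \<le> c * x" "c * x \<le> pi / 2" by auto
      qed
      then have "F ?w = f z" using True c by (simp add: F_def)
      then show ?thesis using B by (simp add: cutoff_bounds add_nonneg_nonneg)
    next
      \<comment> \<open>Outside the square \<open>f z\<close> and \<open>F\<close> at the folded
        point are unrelated, but each is at most \<open>B\<close> in absolute value, and some cutoff
        equals 1 there.\<close>
      case False
      then consider "T + 1 < \<bar>fst z\<bar>" | "T + 1 < \<bar>snd z\<bar>" by linarith
      then have "1 \<le> cutoff T (fst z) + cutoff T (snd z)"
        by cases (simp_all add: cutoff_eq_1 cutoff_bounds)
      then have "2 * B * 1 \<le> 2 * B * (cutoff T (fst z) + cutoff T (snd z))"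
        using B by (intro mult_left_mono) auto
      moreover have "\<bar>f z - F ?w\<bar> \<le> \<bar>f z\<bar> + \<bar>F ?w\<bar>" by (rule abs_triangle_ineq4)
      moreover have "\<bar>f z\<bar> + \<bar>F ?w\<bar> \<le> B + B" unfolding F_def by (intro add_mono f)
      ultimately show ?thesis by linarith
    qed
    moreover have "\<bar>f z - q ?w\<bar> \<le> \<bar>f z - F ?w\<bar> + \<bar>F ?w - q ?w\<bar>"
      using abs_triangle_ineq[of "f z - F ?w" "F ?w - q ?w"] by simp
    ultimately show "\<bar>f z - q ?w\<bar> \<le> e + 2 * B * (cutoff T (fst z) + cutoff T (snd z))"
      using near by simp
  qed
qed

section \<open>Levy's continuity theorem in the plane for a known limit law\<close>

locale plane_char_convergence =
  fixes \<mu> :: "nat \<Rightarrow> (real \<times> real) measure" and N :: "(real \<times> real) measure"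
  assumes prob_\<mu>: "\<And>m. prob_space (\<mu> m)" and sets_\<mu>: "\<And>m. sets (\<mu> m) = sets borel"
    and prob_N: "prob_space N" and sets_N: "sets N = sets borel"
    and char_tendsto: "\<And>a b. (\<lambda>m. \<integral>z. iexp (a * fst z + b * snd z) \<partial>\<mu> m) \<longlonglongrightarrow>
      (\<integral>z. iexp (a * fst z + b * snd z) \<partial>N)"
begin

sublocale \<mu>: prob_space "\<mu> m" for m by (rule prob_\<mu>)
sublocale N: prob_space N by (rule prob_N)

lemma measurable_eqs: "measurable (\<mu> m) K = measurable borel K" "measurable N K = measurable borel K"
  by (rule measurable_cong_sets[OF sets_\<mu> refl], rule measurable_cong_sets[OF sets_N refl])

lemma trig_poly_tendsto:
  "trig_poly h \<Longrightarrow> (\<lambda>m. integral\<^sup>L (\<mu> m) h) \<longlonglongrightarrow> integral\<^sup>L N h"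
proof (induction rule: trig_poly.induct)
  case (trig_cos a b)
  have "(\<integral>z. cos (a * fst z + b * snd z) \<partial>K) = Re (\<integral>z. iexp (a * fst z + b * snd z) \<partial>K)"
    if "prob_space K" "sets K = sets borel" for K :: "(real \<times> real) measure"
  proof -
    interpret K: prob_space K by fact
    have "integrable K (\<lambda>z. iexp (a * fst z + b * snd z))"
      by (rule K.integrable_const_bound[of _ 1])
         (auto simp: measurable_cong_sets[OF that(2) refl] intro!: borel_measurable_continuous_onI
               continuous_intros)
    then show ?thesis by (simp add: Re_exp flip: integral_Re)
  qed
  then show ?case
    using tendsto_Re[OF char_tendsto[of a b]] by (simp add: prob_\<mu> sets_\<mu> prob_N sets_N)
next
  case (trig_sin a b)
  have "(\<integral>z. sin (a * fst z + b * snd z) \<partial>K) = Im (\<integral>z. iexp (a * fst z + b * snd z) \<partial>K)"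
    if "prob_space K" "sets K = sets borel" for K :: "(real \<times> real) measure"
  proof -
    interpret K: prob_space K by fact
    have "integrable K (\<lambda>z. iexp (a * fst z + b * snd z))"
      by (rule K.integrable_const_bound[of _ 1])
         (auto simp: measurable_cong_sets[OF that(2) refl] intro!: borel_measurable_continuous_onI
               continuous_intros)
    then show ?thesis by (simp add: Im_exp flip: integral_Im)
  qed
  then show ?case
    using tendsto_Im[OF char_tendsto[of a b]] by (simp add: prob_\<mu> sets_\<mu> prob_N sets_N)
next
  case (trig_add f g)
  have "integrable K f" "integrable K g" if "prob_space K" "sets K = sets borel" for K
    using trig_poly_bounded[OF trig_add.hyps(1)] trig_poly_bounded[OF trig_add.hyps(2)]
      integrable_bounded_continuous[OF that] trig_poly_continuous trig_add.hyps by blast+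
  then show ?case
    using tendsto_add[OF trig_add.IH] by (simp add: prob_\<mu> sets_\<mu> prob_N sets_N)
next
  case (trig_scale f c)
  then show ?case by (simp add: tendsto_mult_left)
qed

text \<open>One-dimensional Levy continuity applied to linear images. Its use is for the two
  coordinates, where it replaces a separate tightness argument.\<close>

lemma projection_tendsto:
  fixes h :: "real \<Rightarrow> real"
  assumes "continuous_on UNIV h" "\<And>x. \<bar>h x\<bar> \<le> B"
  shows "(\<lambda>m. \<integral>z. h (a * fst z + b * snd z) \<partial>\<mu> m) \<longlonglongrightarrow> (\<integral>z. h (a * fst z + b * snd z) \<partial>N)"
proof -
  define L where "L z = a * fst z + b * snd z" for z :: "real \<times> real"
  have L[measurable]: "L \<in> borel_measurable borel"
    unfolding L_def by (intro borel_measurable_continuous_onI continuous_intros)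
  have h[measurable]: "h \<in> borel_measurable borel"
    by (intro borel_measurable_continuous_onI assms)
  have L': "L \<in> borel_measurable (\<mu> m)" "L \<in> borel_measurable N" for m
    by (simp_all add: measurable_eqs L)
  have rd: "real_distribution (distr (\<mu> m) borel L)" "real_distribution (distr N borel L)" for m
    using \<mu>.real_distribution_distr N.real_distribution_distr L' by auto
  have char: "char (distr (\<mu> m) borel L) t = (\<integral>z. iexp ((t * a) * fst z + (t * b) * snd z) \<partial>\<mu> m)"
    "char (distr N borel L) t = (\<integral>z. iexp ((t * a) * fst z + (t * b) * snd z) \<partial>N)" for m t
    unfolding char_def using L' by (simp_all add: integral_distr L_def algebra_simps)
  have "weak_conv_m (\<lambda>m. distr (\<mu> m) borel L) (distr N borel L)"
  proof (rule levy_continuity[OF rd])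
    show "(\<lambda>m. char (distr (\<mu> m) borel L) t) \<longlonglongrightarrow> char (distr N borel L) t" for t
      unfolding char by (rule char_tendsto)
  qed
  then have "(\<lambda>m. integral\<^sup>L (distr (\<mu> m) borel L) h) \<longlonglongrightarrow> integral\<^sup>L (distr N borel L) h"
    using assms rd
    by (intro weak_conv_imp_integral_bdd_continuous_conv[where B = B]) 
       (auto simp: continuous_on_eq_continuous_at)
  then show ?thesis
    using L' by (simp add: integral_distr L_def)
qed

text \<open>Expectations of trigonometric polynomials converge by assumption, and the approximation
  error is a constant plus a multiple of the cutoffs. Their expectation is small under
  \<open>N\<close> for large \<open>T\<close>, hence eventually under \<open>\<mu> m\<close> too,
  because the coordinate laws converge.\<close>

theorem bounded_continuous_tendsto:
  fixes f :: "real \<times> real \<Rightarrow> real"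
  assumes f: "continuous_on UNIV f" "\<And>z. \<bar>f z\<bar> \<le> B"
  shows "(\<lambda>m. integral\<^sup>L (\<mu> m) f) \<longlonglongrightarrow> integral\<^sup>L N f"
proof (rule LIMSEQ_I)
  fix e :: real assume e: "0 < e"
  have B: "0 \<le> B" using f(2)[of "(0, 0)"] by linarith
  \<comment> \<open>Five copies of \<open>d\<close> are spent: two on replacing \<open>f\<close> by
    the polynomial under each of the two measures and one on the convergence for the polynomial. The
    sixth makes the inequality strict.\<close>
  define d where "d = e / 6"
  have d: "0 < d" using e by (simp add: d_def)
  \<comment> \<open>Tolerated mass of the cutoffs: the 1 in the denominator keeps it well defined
    for \<open>B = 0\<close>, and \<open>2 * B * q \<le> d\<close> still holds.\<close>
  define q where "q = d / (2 * B + 1)"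
  have q: "0 < q" using d B by (simp add: q_def)
  have qd: "2 * B * q \<le> d" using d B by (simp add: q_def field_simps)
  let ?h = "\<lambda>T z. cutoff T (fst z) + cutoff T (snd z)"
  have h_cont: "continuous_on UNIV (?h T)" for T
    by (intro continuous_intros)
  have h_bound: "\<bar>?h T z\<bar> \<le> 2" for T z
    using cutoff_bounds[of T "fst z"] cutoff_bounds[of T "snd z"] by simp
  have [measurable]: "?h T \<in> borel_measurable N" for T
    unfolding measurable_eqs by (rule borel_measurable_continuous_onI[OF h_cont])
  have "(\<lambda>n. integral\<^sup>L N (?h (real n))) \<longlonglongrightarrow> integral\<^sup>L N (\<lambda>_. 0)"
  proof (rule integral_dominated_convergence[where w = "\<lambda>_. 2"])
    show "AE z in N. (\<lambda>n. ?h (real n) z) \<longlonglongrightarrow> 0"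
      using tendsto_add[OF cutoff_tendsto cutoff_tendsto] by (intro AE_I2) simp
  qed (use h_bound in auto)
  then have "\<forall>\<^sub>F n in sequentially. integral\<^sup>L N (?h (real n)) < q"
    by (rule order_tendstoD) (use q in simp)
  then obtain n where n: "integral\<^sup>L N (?h (real n)) < q"
    by (auto simp: eventually_sequentially)
  define T where "T = real n"
  have T: "T \<ge> 0" by (simp add: T_def)
  obtain p where p: "trig_poly p" "\<And>z. \<bar>f z - p z\<bar> \<le> d + 2 * B * ?h T z"
    using trig_poly_approx[OF f T d] by blast
  have approx: "\<bar>integral\<^sup>L K f - integral\<^sup>L K p\<bar> \<le> 2 * d"
    if K: "prob_space K" "sets K = sets borel" and small: "integral\<^sup>L K (?h T) < q" for K
  proof -
    interpret K: prob_space K by fact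
    have int: "integrable K f" "integrable K (?h T)" "integrable K p"
      using integrable_bounded_continuous[OF K f] integrable_bounded_continuous[OF K h_cont h_bound]
        integrable_bounded_continuous[OF K trig_poly_continuous[OF p(1)]] trig_poly_bounded[OF p(1)]
      by blast+
    have "\<bar>integral\<^sup>L K f - integral\<^sup>L K p\<bar> = \<bar>\<integral>z. f z - p z \<partial>K\<bar>"
      using int by simp
    also have "\<dots> \<le> (\<integral>z. \<bar>f z - p z\<bar> \<partial>K)" by (rule integral_abs_bound)
    also have "\<dots> \<le> (\<integral>z. d + 2 * B * ?h T z \<partial>K)"
      using int p(2) by (intro integral_mono) auto
    also have "\<dots> = d + 2 * B * integral\<^sup>L K (?h T)"
      using int(2) by (subst Bochner_Integration.integral_add) (auto simp: K.prob_space simp del: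
            distrib_left_numeral)
    also have "\<dots> \<le> d + 2 * B * q"
      using small B by (intro add_left_mono mult_left_mono) auto
    finally show ?thesis using qd by simp
  qed
  have "(\<lambda>m. integral\<^sup>L (\<mu> m) (?h T)) \<longlonglongrightarrow> integral\<^sup>L N (?h T)"
  proof -
    have *: "(\<lambda>m. \<integral>z. cutoff T (a * fst z + b * snd z) \<partial>\<mu> m) \<longlonglongrightarrow> (\<integral>z. cutoff T (a * fst z + b * snd z) \<partial>N)"
          for a b
      by (rule projection_tendsto[where B = 1]) (auto simp: cutoff_bounds intro!: continuous_intros)
    have int: "integrable K (\<lambda>z. cutoff T (fst z))" "integrable K (\<lambda>z. cutoff T (snd z))"
      if "prob_space K" "sets K = sets borel" for K :: "(real \<times> real) measure"
      by (rule integrable_bounded_continuous[OF that, where B = 1]; 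
          auto simp: cutoff_bounds intro!: continuous_intros)+
    show ?thesis
      using tendsto_add[OF *[of 1 0] *[of 0 1]] by (simp add: int prob_\<mu> sets_\<mu> prob_N sets_N)
  qed
  then have "\<forall>\<^sub>F m in sequentially. integral\<^sup>L (\<mu> m) (?h T) < q"
    by (rule order_tendstoD) (use n in \<open>simp add: T_def\<close>)
  moreover have "\<forall>\<^sub>F m in sequentially. \<bar>integral\<^sup>L (\<mu> m) p - integral\<^sup>L N p\<bar> < d"
    using tendstoD[OF trig_poly_tendsto[OF p(1)] d] by (simp add: dist_real_def)
  ultimately have "\<forall>\<^sub>F m in sequentially. norm (integral\<^sup>L (\<mu> m) f - integral\<^sup>L N f) < e"
  proof eventually_elim
    case (elim m)
    have tri: "\<bar>x - w\<bar> < e" if "\<bar>x - y\<bar> \<le> 2 * d" "\<bar>y - z\<bar> < d" "\<bar>w - z\<bar> \<le> 2 * d" for x y z w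
      using that e unfolding d_def by linarith
    show ?case
      unfolding real_norm_def
      by (rule tri[OF approx[OF prob_\<mu> sets_\<mu> elim(1)] elim(2) approx[OF prob_N sets_N]])
         (use n in \<open>simp add: T_def\<close>)
  qed
  then show "\<exists>no. \<forall>m\<ge>no. norm (integral\<^sup>L (\<mu> m) f - integral\<^sup>L N f) < e"
    by (simp add: eventually_sequentially)
qed

end

section \<open>Bivariate Gaussian laws\<close>

lemma exp_diff_of_real: "exp (z - complex_of_real y) = exp z * of_real (exp (- y))"
  by (simp add: exp_diff exp_minus divide_inverse flip: exp_of_real)

lemma char_normal_density:
  assumes "0 < \<sigma>"
  shows "char (density lborel (normal_density m \<sigma>)) t = exp (\<i> * of_real (t * m) - of_real (\<sigma>\<^sup>2 * t\<^sup>2 / 2))"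
proof -
  interpret S: prob_space std_normal_distribution
    using prob_space_normal_density[of 1 0] by simp
  have "distributed std_normal_distribution lborel (\<lambda>x. x) std_normal_density"
    by (simp add: distributed_def distr_id2)
  then have "distributed std_normal_distribution lborel (\<lambda>x. m + \<sigma> * x) (normal_density (m + \<sigma> * 0) (\<bar>\<sigma>\<bar> * 1))"
    by (rule S.normal_density_affine) (use assms in auto)
  then have eq: "density lborel (normal_density m \<sigma>) = distr std_normal_distribution lborel (\<lambda>x. m + \<sigma> * x)"
    using assms distributed_distr_eq_density by fastforce
  have "char (density lborel (normal_density m \<sigma>)) t = (\<integral>x. iexp (t * (m + \<sigma> * x)) \<partial>std_normal_distribution)"
    unfolding char_def eq by (subst integral_distr) auto
  also have "\<dots> = (\<integral>x. iexp (t * m) * iexp ((t * \<sigma>) * x) \<partial>std_normal_distribution)"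
    by (simp add: algebra_simps flip: exp_add)
  also have "\<dots> = iexp (t * m) * char std_normal_distribution (t * \<sigma>)"
    unfolding char_def by (rule integral_mult_right_zero)
  also have "\<dots> = exp (\<i> * of_real (t * m) - of_real (\<sigma>\<^sup>2 * t\<^sup>2 / 2))"
    unfolding char_std_normal_distribution exp_diff_of_real
    by (simp add: power_mult_distrib mult.commute)
  finally show ?thesis .
qed

lemma char_return: "char (return borel m) t = iexp (t * m)"
  unfolding char_def by (subst integral_return) auto

text \<open>The hypotheses are positive semidefiniteness of the covariance matrix, degenerate cases
  included. The law is an affine image of two independent standard normals; its projections are
  recognised from their characteristic functions by Levy's uniqueness theorem, point masses among
  them.\<close>

lemma gaussian2_exists:
  fixes v1 v2 c :: real and m :: "real \<times> real"
  assumes "0 \<le> v1" "0 \<le> v2" "c\<^sup>2 \<le> v1 * v2"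
  shows "\<exists>N. gaussian2 N m v1 v2 c \<and> (\<forall>a b. (\<integral>z. iexp (a * fst z + b * snd z) \<partial>N) =
      exp (\<i> * of_real (a * fst m + b * snd m) - of_real ((a\<^sup>2 * v1 + 2 * a * b * c + b\<^sup>2 * v2) / 2)))"
proof -
  \<comment> \<open>\<alpha>, \<beta>, \<delta> are the entries of the lower triangular Cholesky
    factor. For \<open>v1 = 0\<close> the quotient in \<beta> is 0 by the convention on division,
    which is right because then \<open>c = 0\<close>.\<close>
  define \<alpha> where "\<alpha> = sqrt v1"
  define \<beta> where "\<beta> = c / sqrt v1"
  define \<delta> where "\<delta> = sqrt (v2 - \<beta>\<^sup>2)"
  have "\<beta>\<^sup>2 \<le> v2"
    using assms by (cases "v1 = 0") (auto simp: \<beta>_def power_divide field_simps)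
  then have coeffs: "\<alpha>\<^sup>2 = v1" "\<alpha> * \<beta> = c" "\<beta>\<^sup>2 + \<delta>\<^sup>2 = v2"
    using assms by (cases "v1 = 0"; auto simp: \<alpha>_def \<beta>_def \<delta>_def)+
  let ?S = std_normal_distribution
  interpret S: prob_space ?S
    using prob_space_normal_density[of 1 0] by simp
  interpret SS: pair_prob_space ?S ?S ..
  define g where "g w = (fst m + \<alpha> * fst w, snd m + \<beta> * fst w + \<delta> * snd w)" for w :: "real \<times> real"
  have sets_SS: "sets (?S \<Otimes>\<^sub>M ?S) = sets borel"
  proof -
    have "sets (?S \<Otimes>\<^sub>M ?S) = sets (borel \<Otimes>\<^sub>M borel)"
      by (rule sets_pair_measure_cong) simp_all
    then show ?thesis by (simp only: borel_prod)
  qed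
  have g[measurable]: "g \<in> borel_measurable (?S \<Otimes>\<^sub>M ?S)"
    unfolding measurable_cong_sets[OF sets_SS refl] g_def
    by (intro borel_measurable_continuous_onI continuous_intros)
  define N where "N = distr (?S \<Otimes>\<^sub>M ?S) borel g"
  interpret N: prob_space N unfolding N_def by (rule SS.prob_space_distr[OF g])
  have sets_N: "sets N = sets borel" by (simp add: N_def)
  have L: "(\<lambda>z. a * fst z + b * snd z) \<in> borel_measurable (borel :: (real \<times> real) measure)" for a b :: real
    by (intro borel_measurable_continuous_onI continuous_intros)
  have char_N: "(\<integral>z. iexp (a * fst z + b * snd z) \<partial>N) =
      exp (\<i> * of_real (a * fst m + b * snd m) - of_real ((a\<^sup>2 * v1 + 2 * a * b * c + b\<^sup>2 * v2) / 2))" for a b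
  proof -
    let ?f = "\<lambda>x. iexp ((a * \<alpha> + b * \<beta>) * x)" and ?h = "\<lambda>y. iexp ((b * \<delta>) * y)"
    have int: "integrable (?S \<Otimes>\<^sub>M ?S) (\<lambda>(x, y). ?f x * ?h y)"
      by (rule SS.integrable_const_bound[of _ 1]) (auto simp: norm_mult split_beta)
    have "(\<integral>z. iexp (a * fst z + b * snd z) \<partial>N) = (\<integral>w. iexp (a * fst (g w) + b * snd (g w)) \<partial>(?S \<Otimes>\<^sub>M ?S))"
      unfolding N_def by (rule integral_distr[OF g]) (intro borel_measurable_continuous_onI continuous_intros)
    also have "\<dots> = (\<integral>w. iexp (a * fst m + b * snd m) * (case w of (x, y) \<Rightarrow> ?f x * ?h y) \<partial>(?S \<Otimes>\<^sub>M ?S))"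
      by (rule Bochner_Integration.integral_cong) (auto simp: g_def algebra_simps simp flip: exp_add)
    also have "\<dots> = iexp (a * fst m + b * snd m) * (\<integral>w. (case w of (x, y) \<Rightarrow> ?f x * ?h y) \<partial>(?S \<Otimes>\<^sub>M ?S))"
      by (rule integral_mult_right_zero)
    also have "(\<integral>w. (case w of (x, y) \<Rightarrow> ?f x * ?h y) \<partial>(?S \<Otimes>\<^sub>M ?S)) = (\<integral>x. (\<integral>y. ?f x * ?h y \<partial>?S) \<partial>?S)"
      by (rule SS.integral_fst[OF int, symmetric])
    also have "\<dots> = char ?S (a * \<alpha> + b * \<beta>) * char ?S (b * \<delta>)"
      by (simp add: char_def)
    also have "\<dots> = of_real (exp (- ((a * \<alpha> + b * \<beta>)\<^sup>2 + (b * \<delta>)\<^sup>2) / 2))"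
      unfolding char_std_normal_distribution of_real_mult[symmetric] exp_add[symmetric]
      by (simp add: add_divide_distrib diff_divide_distrib)
    also have "(a * \<alpha> + b * \<beta>)\<^sup>2 + (b * \<delta>)\<^sup>2 = a\<^sup>2 * v1 + 2 * a * b * c + b\<^sup>2 * v2"
      unfolding coeffs[symmetric] by (simp add: power2_eq_square algebra_simps)
    finally show ?thesis
      by (simp only: exp_diff_of_real minus_divide_left)
  qed
  have "distr N borel (\<lambda>z. a * fst z + b * snd z) =
      (if s = 0 then return borel M else density lborel (normal_density M (sqrt s)))"
    if M: "M = a * fst m + b * snd m" and s: "s = a\<^sup>2 * v1 + 2 * a * b * c + b\<^sup>2 * v2" for a b M s
  proof (rule Levy_uniqueness)
    have s': "s = (a * \<alpha> + b * \<beta>)\<^sup>2 + (b * \<delta>)\<^sup>2"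
      unfolding s coeffs[symmetric] by (simp add: power2_eq_square algebra_simps)
    have s0: "0 \<le> s" unfolding s' by simp
    have LN: "(\<lambda>z. a * fst z + b * snd z) \<in> borel_measurable N"
      using L measurable_cong_sets[OF sets_N refl] by blast
    show "real_distribution (distr N borel (\<lambda>z. a * fst z + b * snd z))"
      by (rule N.real_distribution_distr[OF LN])
    show "real_distribution (if s = 0 then return borel M else density lborel (normal_density M (sqrt s)))"
      using s0 by (auto simp: real_distribution_def real_distribution_axioms_def
          intro!: prob_space_return prob_space_normal_density)
    show "char (distr N borel (\<lambda>z. a * fst z + b * snd z)) =
      char (if s = 0 then return borel M else density lborel (normal_density M (sqrt s)))"
    proof
      fix t
      have "char (distr N borel (\<lambda>z. a * fst z + b * snd z)) t = (\<integral>z. iexp ((t * a) * fst z + (t * b) *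
            snd z) \<partial>N)"
        unfolding char_def by (subst integral_distr[OF LN]) (auto simp: algebra_simps)
      also have "\<dots> = exp (\<i> * of_real (t * M) - of_real (s * t\<^sup>2 / 2))"
        unfolding char_N M s by (simp add: algebra_simps power2_eq_square add_divide_distrib)
      also have "\<dots> = char (if s = 0 then return borel M else density lborel (normal_density M (sqrt s))) t"
        using s0 char_normal_density[of "sqrt s" M t] by (simp add: char_return)
      finally show "char (distr N borel (\<lambda>z. a * fst z + b * snd z)) t =
        char (if s = 0 then return borel M else density lborel (normal_density M (sqrt s))) t" .
    qed
  qed
  then have "gaussian2 N m v1 v2 c"
    by (simp add: gaussian2_def Let_def N.prob_space_axioms sets_N)
  then show ?thesis
    using char_N by (intro exI[of _ N] conjI allI)
qed

section \<open>Exponential samples and their order statistics\<close>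

abbreviation expo :: "real measure" where
  "expo \<equiv> density lborel (exponential_density 1)"

abbreviation expos :: "'i set \<Rightarrow> ('i \<Rightarrow> real) measure" where
  "expos I \<equiv> PiM I (\<lambda>_. expo)"

interpretation expo: prob_space expo
  by (rule prob_space_exponential_density) simp

lemma expo_UNIV[simp]: "measure expo UNIV = 1"
  using expo.prob_space by simp

interpretation expo_prod: product_sigma_finite "\<lambda>_ :: nat. expo"
  by standard

lemma prob_space_PiM_expo: "prob_space (expos I)"
  by (intro prob_space_PiM expo.prob_space_axioms)

lemma AE_expo_nonneg: "AE t in expo. 0 \<le> t"
  by (subst AE_density) (auto simp: exponential_density_def)

lemma nn_integral_expo:
  assumes [measurable]: "f \<in> borel_measurable borel"
  shows "(\<integral>\<^sup>+x. f x \<partial>expo) = (\<integral>\<^sup>+x. ennreal (exp (- x)) * f x * indicator {0..} x \<partial>lborel)"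
  by (subst nn_integral_density) (auto simp: exponential_density_def intro!: nn_integral_cong split:
        split_indicator)

text \<open>The memoryless property: above \<open>t\<close> the exponential law is its own translate
  by \<open>t\<close> with mass \<open>exp (- t)\<close>.\<close>

lemma nn_integral_expo_shift:
  assumes [measurable]: "f \<in> borel_measurable borel" and t: "0 \<le> t"
  shows "(\<integral>\<^sup>+x. indicator {t<..} x * f x \<partial>expo) = ennreal (exp (- t)) * (\<integral>\<^sup>+x. f (t + x) \<partial>expo)"
proof -
  have "(\<integral>\<^sup>+x. indicator {t<..} x * f x \<partial>expo) =
      (\<integral>\<^sup>+x. ennreal (exp (- x)) * f x * indicator {t<..} x \<partial>lborel)"
    using t by (subst nn_integral_expo) (auto intro!: nn_integral_cong split: split_indicator)
  also have "\<dots> = (\<integral>\<^sup>+x. ennreal (exp (- (t + x))) * f (t + x) * indicator {t<..} (t + x) \<partial>lborel)"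
    by (subst nn_integral_real_affine[where c = 1 and t = t]) auto
  also have "\<dots> = (\<integral>\<^sup>+x. ennreal (exp (- t)) * (ennreal (exp (- x)) * f (t + x) * indicator {0..} x) \<partial>lborel)"
  proof (rule nn_integral_cong_AE)
    \<comment> \<open>The strict threshold and the closed support differ only at the single point
      0.\<close>
    have "AE x in lborel. x \<noteq> (0::real)" by (rule AE_lborel_singleton)
    then show "AE x in lborel. ennreal (exp (- (t + x))) * f (t + x) * indicator {t<..} (t + x) =
        ennreal (exp (- t)) * (ennreal (exp (- x)) * f (t + x) * indicator {0..} x)"
      by eventually_elim (auto simp: exp_add exp_diff ennreal_mult mult_ac divide_inverse exp_minus split:
            split_indicator)
  qed
  also have "\<dots> = ennreal (exp (- t)) * (\<integral>\<^sup>+x. f (t + x) \<partial>expo)"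
    by (subst nn_integral_cmult) (auto simp: nn_integral_expo)
  finally show ?thesis .
qed

lemma emeasure_expo_lessThan:
  assumes "0 \<le> t"
  shows "emeasure expo {..<t} = ennreal (1 - exp (- t))"
proof -
  have "emeasure expo {..t} = emeasure expo {..<t}"
    by (rule emeasure_eq_AE) (use AE_lborel_singleton[of t] in \<open>auto simp: AE_density\<close>)
  then show ?thesis
    using emeasure_erlang_density[of 1 0 t] assms by (simp add: erlang_CDF_0)
qed

text \<open>Against the exponential density the integrand is
  \<open>fact m / (1 - l) ^ (m + 1)\<close> times the Erlang density of rate \<open>1 - l\<close>,
  whose total mass is 1.\<close>

lemma has_bochner_integral_expo_moment:
  assumes "l < 1"
  shows "has_bochner_integral expo (\<lambda>x. exp (l * x) * x ^ m) (fact m / (1 - l) ^ (m + 1))"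
proof (rule has_bochner_integral_nn_integral)
  have l: "0 < 1 - l" using assms by simp
  show "AE x in expo. 0 \<le> exp (l * x) * x ^ m"
    using AE_expo_nonneg by eventually_elim simp
  have "(\<integral>\<^sup>+x. ennreal (exp (l * x) * x ^ m) \<partial>expo) =
      (\<integral>\<^sup>+x. ennreal (fact m / (1 - l) ^ (m + 1)) * ennreal (erlang_density m (1 - l) x * x ^ 0) \<partial>lborel)"
    unfolding nn_integral_density[OF measurable_compose[OF borel_measurable_erlang_density
          measurable_ennreal], simplified]
  proof (subst nn_integral_density, simp, simp, rule nn_integral_cong)
    fix x :: real
    have "exponential_density 1 x * (exp (l * x) * x ^ m) = fact m / (1 - l) ^ (m + 1) * erlang_density m
          (1 - l) x"
      using l by (auto simp: exponential_density_def erlang_density_def algebra_simps exp_diff exp_minus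
            field_simps)
    then show "ennreal (exponential_density 1 x) * ennreal (exp (l * x) * x ^ m) =
        ennreal (fact m / (1 - l) ^ (m + 1)) * ennreal (erlang_density m (1 - l) x * x ^ 0)"
      using l by (simp add: ennreal_mult'[symmetric] exponential_density_nonneg)
  qed
  also have "\<dots> = ennreal (fact m / (1 - l) ^ (m + 1))"
    using l by (subst nn_integral_cmult) (auto simp: nn_integral_erlang_ith_moment[OF l, of m 0, simplified])
  finally show "(\<integral>\<^sup>+x. ennreal (exp (l * x) * x ^ m) \<partial>expo) = ennreal (fact m / (1 - l) ^ (m + 1))" .
  show "0 \<le> fact m / (1 - l) ^ (m + 1)" using l by simp
qed simp

text \<open>Under the exponential law \<open>exp (- t)\<close> is uniform on the unit interval, so
  this is the Beta integral. Writing one factor as \<open>1 - exp (- t)\<close> and expanding gives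
  the induction on \<open>q\<close>.\<close>

lemma has_bochner_integral_expo_beta:
  "has_bochner_integral expo (\<lambda>t. exp (- t) ^ k * (1 - exp (- t)) ^ q) (fact q * fact k / fact (k + q + 1))"
proof (induction q arbitrary: k)
  case 0
  have "(\<lambda>x. exp (- real k * x) * x ^ 0) = (\<lambda>t. exp (- t) ^ k * (1 - exp (- t)) ^ 0)"
    by (simp add: fun_eq_iff exp_of_nat_mult[symmetric])
  then show ?case
    using has_bochner_integral_expo_moment[of "- real k" 0] by (simp add: add.commute)
next
  case (Suc q)
  have "has_bochner_integral expo (\<lambda>t. exp (- t) ^ k * (1 - exp (- t)) ^ q - exp (- t) ^ Suc k *
        (1 - exp (- t)) ^ q)
      (fact q * fact k / fact (k + q + 1) - fact q * fact (Suc k) / fact (Suc k + q + 1))"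
    by (intro has_bochner_integral_diff Suc.IH)
  moreover have "(\<lambda>t::real. exp (- t) ^ k * (1 - exp (- t)) ^ q - exp (- t) ^ Suc k * (1 - exp (- t)) ^ q) =
      (\<lambda>t. exp (- t) ^ k * (1 - exp (- t)) ^ Suc q)"
    by (simp add: fun_eq_iff algebra_simps)
  moreover have "fact q * fact k / fact (k + q + 1) - fact q * fact (Suc k) / fact (Suc k + q + 1) =
      (fact (Suc q) * fact k / fact (k + Suc q + 1) :: real)"
  proof -
    define c where "c = (fact (k + q + 1) :: real)"
    have "c > 0" by (simp add: c_def)
    moreover have "fact (Suc k + q + 1) = (real k + real q + 2) * c" "fact (k + Suc q + 1) =
          (real k + real q + 2) * c"
      by (simp_all add: c_def algebra_simps)
    moreover have "real k + real q + 2 > 0" by simp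
    ultimately show ?thesis
      unfolding c_def[symmetric] fact_Suc by (simp add: divide_simps) (simp add: algebra_simps)
  qed
  ultimately show ?case by simp
qed

section \<open>Order statistics through sorted lists\<close>

lemma sorted_nth_le_iff:
  assumes "sorted xs" "j < length xs"
  shows "xs ! j \<le> c \<longleftrightarrow> j < length (filter (\<lambda>x. x \<le> c) xs)"
  using assms
proof (induction xs arbitrary: j)
  case (Cons y ys)
  show ?case
  proof (cases "y \<le> c")
    case True
    then show ?thesis using Cons by (cases j) auto
  next
    case False
    then have "filter (\<lambda>x. x \<le> c) (y # ys) = []"
      using Cons.prems by (auto simp: filter_empty_conv)
    moreover have "y \<le> (y # ys) ! j"
      using Cons.prems by (cases j) auto
    ultimately show ?thesis using False by simp
  qed
qed simp

text \<open>Entry \<open>j\<close>, counted from 0, of the sorted sample is at most \<open>c\<close>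
  exactly when more than \<open>j\<close> observations are; sorting thus reduces to a finite sum of
  indicators.\<close>

lemma measurable_sort_nth[measurable]:
  assumes [measurable]: "\<And>i. i < n \<Longrightarrow> Y i \<in> borel_measurable M" and "j < n"
  shows "(\<lambda>\<omega>. sort (map (\<lambda>i. Y i \<omega>) [0..<n]) ! j :: real) \<in> borel_measurable M"
proof (rule borel_measurableI_le)
  fix c
  have "sort (map (\<lambda>i. Y i \<omega>) [0..<n]) ! j \<le> c \<longleftrightarrow> real j < (\<Sum>i<n. if Y i \<omega> \<le> c then 1 else 0)" for \<omega>
  proof -
    have "length (filter (\<lambda>x. x \<le> c) (sort (map (\<lambda>i. Y i \<omega>) [0..<n]))) =
        length (filter (\<lambda>x. x \<le> c) (map (\<lambda>i. Y i \<omega>) [0..<n]))"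
      by (metis mset_filter mset_sort size_mset)
    also have "\<dots> = length (filter (\<lambda>i. Y i \<omega> \<le> c) [0..<n])"
      by (simp add: filter_map comp_def)
    also have "\<dots> = card {i. i < n \<and> Y i \<omega> \<le> c}"
      by (subst length_filter_conv_card) (auto intro!: arg_cong[where f = card])
    also have "real \<dots> = (\<Sum>i<n. if Y i \<omega> \<le> c then 1 else 0)"
      by (subst sum.If_cases) (auto intro!: arg_cong[where f = card])
    finally have len: "real (length (filter (\<lambda>x. x \<le> c) (sort (map (\<lambda>i. Y i \<omega>) [0..<n])))) =
        (\<Sum>i<n. if Y i \<omega> \<le> c then 1 else 0)" .
    show ?thesis
      unfolding len[symmetric] of_nat_less_iff
      using sorted_nth_le_iff[of "sort (map (\<lambda>i. Y i \<omega>) [0..<n])" j c] \<open>j < n\<close> by simp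
  qed
  then show "{\<omega> \<in> space M. sort (map (\<lambda>i. Y i \<omega>) [0..<n]) ! j \<le> c} \<in> sets M"
    by simp
qed

lemma measurable_order_stat:
  assumes "\<And>i. i < n \<Longrightarrow> Y i \<in> borel_measurable M" and "1 \<le> j" "j \<le> n"
  shows "order_stat Y j n \<in> borel_measurable M"
  unfolding order_stat_def[abs_def] using assms by (intro measurable_sort_nth) auto

lemma mset_sorted_list_of_set: "mset (sorted_list_of_set S) = mset_set S"
  by (metis mset_sorted_list_of_multiset sorted_list_of_mset_set)

text \<open>Weak inequalities are enough, since sorting does not see which of several tied indices
  serves as pivot. This admits images of a sample under a monotone map that is not
  injective.\<close>

lemma sort_map_split:
  fixes y :: "nat \<Rightarrow> real"
  assumes i: "i < n" "i \<notin> S" and S: "S \<subseteq> {..<n}"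
    and above: "\<And>j. j \<in> S \<Longrightarrow> y i \<le> y j"
    and below: "\<And>j. j \<in> {..<n} - insert i S \<Longrightarrow> y j \<le> y i"
  shows "sort (map y [0..<n]) =
    sort (map y (sorted_list_of_set ({..<n} - insert i S))) @ [y i] @ sort (map y (sorted_list_of_set S))"
proof (rule properties_for_sort)
  have fin: "finite S" using S finite_subset by blast
  have "mset_set {0..<n} = mset_set (({..<n} - insert i S) \<union> ({i} \<union> S))"
    using i S by (intro arg_cong[where f = mset_set]) auto
  also have "\<dots> = mset_set ({..<n} - insert i S) + (mset_set {i} + mset_set S)"
    using fin i by (subst mset_set_Union; auto simp: mset_set_Union)
  finally show "mset (sort (map y (sorted_list_of_set ({..<n} - insert i S))) @ [y i] @
      sort (map y (sorted_list_of_set S))) = mset (map y [0..<n])"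
    using fin by (simp add: mset_sorted_list_of_set)
  show "sorted (sort (map y (sorted_list_of_set ({..<n} - insert i S))) @ [y i] @ sort
        (map y (sorted_list_of_set S)))"
    using fin above below by (fastforce simp: sorted_append intro: order_trans)
qed

lemma order_stat_top:
  fixes Y :: "nat \<Rightarrow> 'a \<Rightarrow> real" and h :: "real \<Rightarrow> 'b::comm_monoid_add"
  assumes i: "i < n" "i \<notin> S" and S: "S \<subseteq> {..<n}" "card S = k"
    and above: "\<And>j. j \<in> S \<Longrightarrow> Y i \<omega> \<le> Y j \<omega>"
    and below: "\<And>j. j \<in> {..<n} - insert i S \<Longrightarrow> Y j \<omega> \<le> Y i \<omega>"
  shows "order_stat Y (n - k) n \<omega> = Y i \<omega>"
    and "(\<Sum>l<k. h (order_stat Y (n - l) n \<omega>)) = (\<Sum>j\<in>S. h (Y j \<omega>))"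
proof -
  have fin: "finite S" using S finite_subset by blast
  define lo where "lo = sort (map (\<lambda>i. Y i \<omega>) (sorted_list_of_set ({..<n} - insert i S)))"
  define hi where "hi = sort (map (\<lambda>i. Y i \<omega>) (sorted_list_of_set S))"
  have split: "sort (map (\<lambda>i. Y i \<omega>) [0..<n]) = lo @ [Y i \<omega>] @ hi"
    unfolding lo_def hi_def by (rule sort_map_split) (use assms in auto)
  have hi: "length hi = k" using S by (simp add: hi_def)
  have "length (sort (map (\<lambda>i. Y i \<omega>) [0..<n])) = n" by simp
  then have n: "n = length lo + 1 + k" unfolding split using hi by simp
  show "order_stat Y (n - k) n \<omega> = Y i \<omega>"
    unfolding order_stat_def split using n by (simp add: nth_append)
  have "(\<Sum>l<k. h (order_stat Y (n - l) n \<omega>)) = (\<Sum>l<k. h (hi ! (k - Suc l)))"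
  proof (rule sum.cong[OF refl])
    fix l assume "l \<in> {..<k}"
    \<comment> \<open>The list index of \<open>order_stat\<close> is one less than its rank, and one
      further position is taken by the pivot between \<open>lo\<close> and \<open>hi\<close>:
      increasing \<open>l\<close> walks through \<open>hi\<close> from its end.\<close>
    then have "n - l - 1 = Suc (length lo + (k - Suc l))" using n by auto
    then show "h (order_stat Y (n - l) n \<omega>) = h (hi ! (k - Suc l))"
      unfolding order_stat_def split by (simp add: nth_append)
  qed
  also have "\<dots> = (\<Sum>l<k. h (hi ! l))"
    by (rule sum.nat_diff_reindex)
  also have "\<dots> = sum_list (map h hi)"
    using hi by (simp add: sum_list_sum_nth atLeast0LessThan)
  also have "\<dots> = sum_mset (image_mset h (mset hi))"
    by (simp flip: sum_mset_sum_list)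
  also have "mset hi = image_mset (\<lambda>i. Y i \<omega>) (mset_set S)"
    by (simp add: hi_def mset_sorted_list_of_set)
  also have "sum_mset (image_mset h (image_mset (\<lambda>i. Y i \<omega>) (mset_set S))) = (\<Sum>j\<in>S. h (Y j \<omega>))"
    by (simp add: sum_unfold_sum_mset multiset.map_comp comp_def)
  finally show "(\<Sum>l<k. h (order_stat Y (n - l) n \<omega>)) = (\<Sum>j\<in>S. h (Y j \<omega>))" .
qed

section \<open>Decomposing the sample space by the pivot\<close>

definition pivots :: "nat \<Rightarrow> nat \<Rightarrow> (nat \<times> nat set) set" where
  "pivots n k = {(i, S). i < n \<and> S \<subseteq> {..<n} - {i} \<and> card S = k}"

text \<open>Strict inequalities make the events of different pivots disjoint; samples with a tie at
  the pivot value are left out and turn out to be negligible.\<close>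

definition pivot_event :: "nat \<Rightarrow> nat \<times> nat set \<Rightarrow> (nat \<Rightarrow> real) \<Rightarrow> bool" where
  "pivot_event n p x \<longleftrightarrow> (\<forall>j\<in>snd p. x (fst p) < x j) \<and> (\<forall>j\<in>{..<n} - insert (fst p) (snd p). x j < x (fst p))"

lemma pivots_eq: "pivots n k = Sigma {..<n} (\<lambda>i. {S. S \<subseteq> {..<n} - {i} \<and> card S = k})"
  by (auto simp: pivots_def)

lemma finite_pivots: "finite (pivots n k)"
  unfolding pivots_eq by (intro finite_SigmaI) (auto intro: finite_subset[of _ "Pow {..<n}"])

lemma card_pivots:
  assumes "k < n"
  shows "real (card (pivots n k)) = fact n / (fact (n - 1 - k) * fact k)"
proof -
  have "card (pivots n k) = (\<Sum>i<n. card {S. S \<subseteq> {..<n} - {i} \<and> card S = k})"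
    unfolding pivots_eq by (rule card_SigmaI) (auto intro: finite_subset[of _ "Pow {..<n}"])
  also have "\<dots> = (\<Sum>i<n. (n - 1) choose k)"
    by (rule sum.cong) (auto simp: n_subsets)
  finally have "real (card (pivots n k)) = real n * real ((n - 1) choose k)" by simp
  also have "\<dots> = fact n / (fact (n - 1 - k) * fact k)"
    using assms by (subst binomial_fact) (auto simp: fact_reduce[of n] mult_ac)
  finally show ?thesis .
qed

text \<open>The set component consists of all indices whose value exceeds the pivot value. A smaller
  pivot value would have a strictly larger such set, against the common cardinality
  \<open>k\<close>; with equal pivot values, strictness forbids two different pivot indices.\<close>

lemma pivot_event_unique:
  assumes "p \<in> pivots n k" "p' \<in> pivots n k" "pivot_event n p x" "pivot_event n p' x"
  shows "p = p'"
proof -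
  have S: "snd p = {j. j < n \<and> x (fst p) < x j}" if "p \<in> pivots n k" "pivot_event n p x" for p
  proof (rule set_eqI, rule iffI)
    fix j assume "j \<in> snd p"
    then show "j \<in> {j. j < n \<and> x (fst p) < x j}"
      using that by (auto simp: pivots_def pivot_event_def)
  next
    fix j assume j: "j \<in> {j. j < n \<and> x (fst p) < x j}"
    show "j \<in> snd p"
    proof (rule ccontr)
      assume "j \<notin> snd p"
      then have "j \<in> {..<n} - insert (fst p) (snd p)" using j by auto
      then have "x j < x (fst p)" using that(2) unfolding pivot_event_def by blast
      then show False using j by simp
    qed
  qed
  have lt: False if "x (fst p) < x (fst p')" and "p \<in> pivots n k" "p' \<in> pivots n k" "pivot_event n p x"
        "pivot_event n p' x" for p p'
  proof -
    have "snd p' \<subset> snd p"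
      unfolding S[OF that(2,4)] S[OF that(3,5)] using that(1,3) by (force simp: pivots_def)
    moreover have "finite (snd p)" unfolding S[OF that(2,4)] by simp
    ultimately have "card (snd p') < card (snd p)" by (intro psubset_card_mono)
    then show False using that(2,3) by (auto simp: pivots_def)
  qed
  have eq: "x (fst p) = x (fst p')"
    using lt[of p p'] lt[of p' p] assms by (meson linorder_neqE_linordered_idom)
  have "fst p = fst p'"
  proof (rule ccontr)
    assume "fst p \<noteq> fst p'"
    then have "fst p' \<in> snd p \<or> fst p' \<in> {..<n} - insert (fst p) (snd p)"
      using assms(2) by (auto simp: pivots_def)
    then show False using assms(3) eq by (auto simp: pivot_event_def)
  qed
  then show ?thesis
    using S[OF assms(1,3)] S[OF assms(2,4)] by (simp add: prod_eq_iff)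
qed

section \<open>Integration over products of exponential laws\<close>

lemma measurable_expo: "measurable expo K = measurable borel K"
  by (rule measurable_cong_sets) simp_all

lemma measurable_PiM_expo_component:
  assumes "j \<in> I" shows "(\<lambda>x. x j) \<in> borel_measurable (expos I)"
proof -
  have "(\<lambda>x. x j) \<in> measurable (expos I) expo"
    using measurable_component_singleton[OF assms, of "\<lambda>_. expo"] by simp
  then show ?thesis
    by (simp cong: measurable_cong_sets)
qed

lemma measurable_PiM_expo_sum:
  fixes v :: "real \<Rightarrow> real \<times> real"
  assumes "S \<subseteq> I" "v \<in> borel_measurable borel"
  shows "(\<lambda>x. \<Sum>j\<in>S. v (x j)) \<in> borel_measurable (expos I)"
  by (intro borel_measurable_sum measurable_compose[OF measurable_PiM_expo_component assms(2)])
     (use assms in auto)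

lemma measurable_PiM_expo_prod:
  fixes v :: "real \<Rightarrow> ennreal"
  assumes "S \<subseteq> I" "v \<in> borel_measurable borel"
  shows "(\<lambda>x. \<Prod>j\<in>S. v (x j)) \<in> borel_measurable (expos I)"
  by (intro borel_measurable_prod_ennreal measurable_compose[OF measurable_PiM_expo_component assms(2)])
     (use assms in auto)

lemma measurable_nn_integral_expo_sum:
  fixes w :: "real \<Rightarrow> real \<Rightarrow> real \<times> real" and H :: "real \<times> real \<Rightarrow> ennreal"
  assumes w: "(\<lambda>(t, x). w t x) \<in> borel_measurable (borel \<Otimes>\<^sub>M borel)"
    and H[measurable]: "H \<in> borel_measurable borel" and c[measurable]: "c \<in> borel_measurable borel"
  shows "(\<lambda>t. \<integral>\<^sup>+x. H (c t + (\<Sum>j<k. w t (x j))) \<partial>expos {..<k}) \<in> borel_measurable borel"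
proof -
  interpret P: prob_space "expos {..<k}" by (rule prob_space_PiM_expo)
  have "(\<lambda>p. w (fst p) (snd p j)) \<in> borel_measurable (borel \<Otimes>\<^sub>M expos {..<k})" if "j < k" for j
  proof -
    have [measurable]: "(\<lambda>x. x j) \<in> borel_measurable (expos {..<k})"
      by (rule measurable_PiM_expo_component) (use that in simp)
    have "(\<lambda>p. (fst p, snd p j)) \<in> measurable (borel \<Otimes>\<^sub>M expos {..<k}) (borel \<Otimes>\<^sub>M borel)"
      by measurable
    from measurable_compose[OF this w] show ?thesis by simp
  qed
  then have [measurable]: "(\<lambda>p. \<Sum>j<k. w (fst p) (snd p j)) \<in> borel_measurable (borel \<Otimes>\<^sub>M expos {..<k})"
    by (intro borel_measurable_sum) auto
  have "(\<lambda>p. H (c (fst p) + (\<Sum>j<k. w (fst p) (snd p j)))) \<in> borel_measurable (borel \<Otimes>\<^sub>M expos {..<k})"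
    by measurable
  then show ?thesis
    by (intro P.borel_measurable_nn_integral) (simp add: split_beta)
qed

text \<open>Coordinates are integrated out one at a time; each restriction \<open>x j > t\<close>
  costs a factor \<open>exp (- t)\<close> and leaves a fresh excess. \<open>H\<close> is general in
  the induction so that the contribution of the coordinate held fixed can be absorbed into it. The
  index set is normalised to an initial segment, so only its size survives.\<close>

lemma nn_integral_top:
  fixes w :: "real \<Rightarrow> real \<times> real" and H :: "real \<times> real \<Rightarrow> ennreal" and S :: "nat set"
  assumes "finite S" and w[measurable]: "w \<in> borel_measurable borel" and H: "H \<in> borel_measurable borel"
    and t: "0 \<le> t"
  shows "(\<integral>\<^sup>+x. (\<Prod>j\<in>S. indicator {t<..} (x j)) * H (\<Sum>j\<in>S. w (x j)) \<partial>expos S) =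
    ennreal (exp (- t)) ^ card S * (\<integral>\<^sup>+x. H (\<Sum>j<card S. w (t + x j)) \<partial>expos {..<card S})"
  using assms(1) H
proof (induction S arbitrary: H rule: finite_induct)
  case empty
  then show ?case by (simp add: PiM_empty nn_integral_count_space_finite)
next
  case (insert i S)
  note H[measurable] = insert.prems
  let ?k = "card S"
  have wt[measurable]: "(\<lambda>x. w (t + x)) \<in> borel_measurable borel" by measurable
  define \<Phi> where "\<Phi> c = (\<integral>\<^sup>+x. H (c + (\<Sum>j<?k. w (t + x j))) \<partial>expos {..<?k})" for c
  have "(\<lambda>y. \<Phi> (w y)) \<in> borel_measurable borel" 
    unfolding \<Phi>_def by (rule measurable_nn_integral_expo_sum) (auto simp: split_beta)
  note \<Phi>[measurable] = this
  have prod_upd: "(\<Prod>j\<in>insert i S. indicator {t<..} ((x(i := y)) j)) = indicator {t<..} y *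
        (\<Prod>j\<in>S. indicator {t<..} (x j) :: ennreal)" for x y
    using insert.hyps by (simp add: prod.insert, intro arg_cong2[where f = "(*)"] refl prod.cong) auto
  have sum_upd: "(\<Sum>j\<in>insert i S. w ((x(i := y)) j)) = w y + (\<Sum>j\<in>S. w (x j))" for x y
    using insert.hyps by (simp add: sum.insert, intro arg_cong2[where f = "(+)"] refl sum.cong) auto
  have mS: "(\<lambda>x. (\<Prod>j\<in>S. indicator {t<..} (x j)) * H (w y + (\<Sum>j\<in>S. w (x j)))) \<in> borel_measurable (expos S)" for y
  proof -
    have [measurable]: "(\<lambda>x. \<Prod>j\<in>S. indicator {t<..} (x j) :: ennreal) \<in> borel_measurable (expos S)"
      "(\<lambda>x. \<Sum>j\<in>S. w (x j)) \<in> borel_measurable (expos S)"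
      by (intro measurable_PiM_expo_prod measurable_PiM_expo_sum w order_refl borel_measurable_indicator; simp)+
    show ?thesis by measurable
  qed
  have "(\<lambda>x. (\<Prod>j\<in>insert i S. indicator {t<..} (x j)) * H (\<Sum>j\<in>insert i S. w (x j))) \<in> borel_measurable
        (expos (insert i S))"
  proof -
    have [measurable]: "(\<lambda>x. \<Prod>j\<in>insert i S. indicator {t<..} (x j) :: ennreal) \<in> borel_measurable
          (expos (insert i S))"
      "(\<lambda>x. \<Sum>j\<in>insert i S. w (x j)) \<in> borel_measurable (expos (insert i S))"
      by (intro measurable_PiM_expo_prod measurable_PiM_expo_sum w order_refl borel_measurable_indicator; simp)+
    show ?thesis by measurable
  qed
  then have "(\<integral>\<^sup>+x. (\<Prod>j\<in>insert i S. indicator {t<..} (x j)) * H (\<Sum>j\<in>insert i S. w (x j)) \<partial>expos (insert i S)) =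
      (\<integral>\<^sup>+y. (\<integral>\<^sup>+x. indicator {t<..} y * ((\<Prod>j\<in>S. indicator {t<..} (x j)) * H (w y + (\<Sum>j\<in>S. w (x j))))
            \<partial>expos S) \<partial>expo)"
    by (subst expo_prod.product_nn_integral_insert_rev[OF insert.hyps(1,2)]) (simp_all only: prod_upd
          sum_upd mult.assoc)
  also have "\<dots> = (\<integral>\<^sup>+y. indicator {t<..} y * (ennreal (exp (- t)) ^ ?k * \<Phi> (w y)) \<partial>expo)"
  proof (rule nn_integral_cong)
    fix y
    \<comment> \<open>The induction hypothesis is used for \<open>H\<close> translated by the
      contribution of coordinate \<open>i\<close>.\<close>
    have "(\<lambda>c. H (w y + c)) \<in> borel_measurable borel" by measurable
    from insert.IH[OF this] show "(\<integral>\<^sup>+x. indicator {t<..} y * ((\<Prod>j\<in>S. indicator {t<..} (x j)) * H (w y +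
          (\<Sum>j\<in>S. w (x j)))) \<partial>expos S) =
        indicator {t<..} y * (ennreal (exp (- t)) ^ ?k * \<Phi> (w y))"
      by (subst nn_integral_cmult[OF mS]) (simp add: \<Phi>_def)
  qed
  also have "\<dots> = ennreal (exp (- t)) * (\<integral>\<^sup>+y. ennreal (exp (- t)) ^ ?k * \<Phi> (w (t + y)) \<partial>expo)"
    by (rule nn_integral_expo_shift[OF _ t]) measurable
  also have "\<dots> = ennreal (exp (- t)) ^ Suc ?k * (\<integral>\<^sup>+y. \<Phi> (w (t + y)) \<partial>expo)"
    by (subst nn_integral_cmult) (auto simp: measurable_expo mult.assoc)
  also have "(\<integral>\<^sup>+y. \<Phi> (w (t + y)) \<partial>expo) = (\<integral>\<^sup>+x. H (\<Sum>j<Suc ?k. w (t + x j)) \<partial>expos {..<Suc ?k})"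
  proof -
    have "(\<lambda>x. \<Sum>j<Suc ?k. w (t + x j)) \<in> borel_measurable (expos {..<Suc ?k})"
      by (intro measurable_PiM_expo_sum[where v = "\<lambda>x. w (t + x)"] wt order_refl)
    from measurable_compose[OF this H] have "(\<lambda>x. H (\<Sum>j<Suc ?k. w (t + x j))) \<in> borel_measurable
          (expos (insert ?k {..<?k}))"
      by (simp only: lessThan_Suc)
    then have "(\<integral>\<^sup>+x. H (\<Sum>j<Suc ?k. w (t + x j)) \<partial>expos {..<Suc ?k}) =
        (\<integral>\<^sup>+y. (\<integral>\<^sup>+x. H (\<Sum>j<Suc ?k. w (t + (x(?k := y)) j)) \<partial>expos {..<?k}) \<partial>expo)"
      unfolding lessThan_Suc by (subst expo_prod.product_nn_integral_insert_rev) simp_all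
    also have "\<dots> = (\<integral>\<^sup>+y. \<Phi> (w (t + y)) \<partial>expo)"
      unfolding \<Phi>_def by (intro nn_integral_cong arg_cong[where f = H]) (auto simp: add.commute intro!:
            sum.cong)
    finally show ?thesis by simp
  qed
  finally show ?case
    using insert.hyps by simp
qed

text \<open>Fubini with the pivot coordinate outermost. Given its value \<open>t\<close>, the
  \<open>k\<close> coordinates above become independent excesses, the other \<open>n - 1 - k\<close>
  contribute only their probability of lying below. The result does not depend on the pivot chosen,
  so summing over pivots is mere multiplication.\<close>

lemma nn_integral_pivot:
  fixes w :: "real \<Rightarrow> real \<Rightarrow> real \<times> real" and H :: "real \<times> real \<Rightarrow> ennreal" and S :: "nat set"
  assumes "(i, S) \<in> pivots n k"
    and w: "(\<lambda>(t, x). w t x) \<in> borel_measurable (borel \<Otimes>\<^sub>M borel)"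
    and H[measurable]: "H \<in> borel_measurable borel"
  shows "(\<lambda>x. of_bool (pivot_event n (i, S) x) * H (\<Sum>j\<in>S. w (x i) (x j))) \<in> borel_measurable
        (expos {..<n})" (is ?m)
    and "(\<integral>\<^sup>+x. of_bool (pivot_event n (i, S) x) * H (\<Sum>j\<in>S. w (x i) (x j)) \<partial>expos {..<n}) =
    (\<integral>\<^sup>+t. ennreal (exp (- t) ^ k * (1 - exp (- t)) ^ (n - 1 - k)) *
        (\<integral>\<^sup>+x. H (\<Sum>j<k. w t (t + x j)) \<partial>expos {..<k}) \<partial>expo)" (is ?e)
proof -
  have i: "i < n" "i \<notin> S" and S: "S \<subseteq> {..<n}" "card S = k" and fin: "finite S"
    using assms(1) finite_subset[of S "{..<n}"] by (auto simp: pivots_def)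
  define R where "R = {..<n} - insert i S"
  have R: "finite R" "S \<inter> R = {}" "i \<notin> S \<union> R" "insert i (S \<union> R) = {..<n}" "card R = n - 1 - k"
    using i S fin by (auto simp: R_def card_Diff_subset)
  have w_meas[measurable]: "w t \<in> borel_measurable borel" for t
    using measurable_compose[OF measurable_Pair1' w] by simp
  let ?P = "expos {..<n}"
  have event: "of_bool (pivot_event n (i, S) x) =
      (\<Prod>j\<in>S. of_bool (x i < x j)) * (\<Prod>j\<in>R. of_bool (x j < x i) :: ennreal)" for x
    using fin R(1) by (auto simp: pivot_event_def R_def[symmetric] prod_zero_iff Ball_def)
  have comp[measurable]: "(\<lambda>x. x j) \<in> borel_measurable ?P" if "j < n" for j
    by (rule measurable_PiM_expo_component) (use that in simp)
  show meas: ?m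
  proof -
    have "(\<lambda>x. w (x i) (x j)) \<in> borel_measurable ?P" if "j \<in> S" for j
    proof -
      have [measurable]: "(\<lambda>x. x i) \<in> borel_measurable ?P" "(\<lambda>x. x j) \<in> borel_measurable ?P"
        using that S i by (auto intro!: comp)
      have "(\<lambda>x. (x i, x j)) \<in> measurable ?P (borel \<Otimes>\<^sub>M borel)" by measurable
      from measurable_compose[OF this w] show ?thesis by simp
    qed
    then have [measurable]: "(\<lambda>x. \<Sum>j\<in>S. w (x i) (x j)) \<in> borel_measurable ?P"
      by (rule borel_measurable_sum)
    have lt: "(\<lambda>x. of_bool (x j < x l) :: ennreal) \<in> borel_measurable ?P" if "j < n" "l < n" for j l
    proof -
      have [measurable]: "(\<lambda>x. x j) \<in> borel_measurable ?P" "(\<lambda>x. x l) \<in> borel_measurable ?P"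
        using that by (auto intro!: comp)
      show ?thesis unfolding of_bool_def by measurable
    qed
    have [measurable]: "(\<lambda>x. \<Prod>j\<in>S. of_bool (x i < x j) :: ennreal) \<in> borel_measurable ?P"
      "(\<lambda>x. \<Prod>j\<in>R. of_bool (x j < x i) :: ennreal) \<in> borel_measurable ?P"
      using i S by (auto intro!: borel_measurable_prod_ennreal lt simp: R_def)
    show ?thesis unfolding event by measurable
  qed
  have upd: "of_bool (pivot_event n (i, S) (x(i := t))) * H (\<Sum>j\<in>S. w ((x(i := t)) i) ((x(i := t)) j)) =
      (\<Prod>j\<in>S. indicator {t<..} (x j)) * (\<Prod>j\<in>R. indicator {..<t} (x j)) * H (\<Sum>j\<in>S. w t (x j))" for x t
  proof -
    have "(\<Prod>j\<in>S. of_bool ((x(i := t)) i < (x(i := t)) j)) = (\<Prod>j\<in>S. indicator {t<..} (x j) :: ennreal)"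
      using i by (intro prod.cong) (auto simp: indicator_def)
    moreover have "(\<Prod>j\<in>R. of_bool ((x(i := t)) j < (x(i := t)) i)) = (\<Prod>j\<in>R. indicator {..<t} (x j) :: ennreal)"
      using R(3) by (intro prod.cong) (auto simp: indicator_def)
    moreover have "(\<Sum>j\<in>S. w ((x(i := t)) i) ((x(i := t)) j)) = (\<Sum>j\<in>S. w t (x j))"
      using i by (intro sum.cong) auto
    ultimately show ?thesis unfolding event by simp
  qed
  have inner: "(\<integral>\<^sup>+x. (\<Prod>j\<in>S. indicator {t<..} (x j)) * (\<Prod>j\<in>R. indicator {..<t} (x j)) *
        H (\<Sum>j\<in>S. w t (x j)) \<partial>expos (S \<union> R)) =
      ennreal (exp (- t) ^ k * (1 - exp (- t)) ^ (n - 1 - k)) * (\<integral>\<^sup>+x. H (\<Sum>j<k. w t (t + x j)) \<partial>expos {..<k})"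
    if t: "0 \<le> t" for t
  proof -
    let ?A = "\<lambda>x. (\<Prod>j\<in>S. indicator {t<..} (x j) :: ennreal) * H (\<Sum>j\<in>S. w t (x j))"
    have mA: "?A \<in> borel_measurable (expos I)" if "S \<subseteq> I" for I
    proof -
      have [measurable]: "(\<lambda>x. \<Prod>j\<in>S. indicator {t<..} (x j) :: ennreal) \<in> borel_measurable (expos I)"
        "(\<lambda>x. \<Sum>j\<in>S. w t (x j)) \<in> borel_measurable (expos I)"
        by (intro measurable_PiM_expo_prod measurable_PiM_expo_sum w_meas that borel_measurable_indicator;
              simp)+
      show ?thesis by measurable
    qed
    have mB: "(\<lambda>x. \<Prod>j\<in>R. indicator {..<t} (x j) :: ennreal) \<in> borel_measurable (expos I)" if "R \<subseteq> I" for I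
      by (intro measurable_PiM_expo_prod that borel_measurable_indicator) simp
    have "(\<integral>\<^sup>+x. (\<Prod>j\<in>S. indicator {t<..} (x j)) * (\<Prod>j\<in>R. indicator {..<t} (x j)) * H (\<Sum>j\<in>S. w t (x j))
          \<partial>expos (S \<union> R)) =
        (\<integral>\<^sup>+x. ?A x * (\<Prod>j\<in>R. indicator {..<t} (x j)) \<partial>expos (S \<union> R))"
      by (simp add: mult_ac)
    also have "\<dots> = (\<integral>\<^sup>+x. (\<integral>\<^sup>+y. ?A (merge S R (x, y)) * (\<Prod>j\<in>R. indicator {..<t} (merge S R (x, y) j))
          \<partial>expos R) \<partial>expos S)"
      by (rule expo_prod.product_nn_integral_fold[OF R(2) fin R(1)]) (intro borel_measurable_times_ennreal
            mA mB; simp)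
    also have "\<dots> = (\<integral>\<^sup>+x. (\<integral>\<^sup>+y. ?A x * (\<Prod>j\<in>R. indicator {..<t} (y j)) \<partial>expos R) \<partial>expos S)"
    proof (intro nn_integral_cong)
      fix x y
      have "(\<Prod>j\<in>S. indicator {t<..} (merge S R (x, y) j)) = (\<Prod>j\<in>S. indicator {t<..} (x j) :: ennreal)"
        "(\<Sum>j\<in>S. w t (merge S R (x, y) j)) = (\<Sum>j\<in>S. w t (x j))"
        "(\<Prod>j\<in>R. indicator {..<t} (merge S R (x, y) j)) = (\<Prod>j\<in>R. indicator {..<t} (y j) :: ennreal)"
        using R(2) by (auto intro!: prod.cong sum.cong simp: merge_def)
      then show "?A (merge S R (x, y)) * (\<Prod>j\<in>R. indicator {..<t} (merge S R (x, y) j)) =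
            ?A x * (\<Prod>j\<in>R. indicator {..<t} (y j))"
        by simp
    qed
    also have "\<dots> = (\<integral>\<^sup>+x. ?A x * ennreal (1 - exp (- t)) ^ (n - 1 - k) \<partial>expos S)"
    proof (intro nn_integral_cong)
      fix x
      have "(\<integral>\<^sup>+y. (\<Prod>j\<in>R. indicator {..<t} (y j)) \<partial>expos R) = (\<Prod>j\<in>R. integral\<^sup>N expo (indicator {..<t}))"
        by (rule expo_prod.product_nn_integral_prod[OF R(1)]) simp
      also have "\<dots> = ennreal (1 - exp (- t)) ^ (n - 1 - k)"
        using R(5) by (simp add: emeasure_expo_lessThan[OF t])
      finally show "(\<integral>\<^sup>+y. ?A x * (\<Prod>j\<in>R. indicator {..<t} (y j)) \<partial>expos R) =
            ?A x * ennreal (1 - exp (- t)) ^ (n - 1 - k)"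
        by (subst nn_integral_cmult[OF mB]) simp_all
    qed
    also have "\<dots> = (\<integral>\<^sup>+x. ?A x \<partial>expos S) * ennreal (1 - exp (- t)) ^ (n - 1 - k)"
      by (rule nn_integral_multc[OF mA]) simp
    also have "(\<integral>\<^sup>+x. ?A x \<partial>expos S) = ennreal (exp (- t)) ^ k * (\<integral>\<^sup>+x. H (\<Sum>j<k. w t (t + x j)) \<partial>expos {..<k})"
      using nn_integral_top[OF fin w_meas H t] S(2) by simp
    finally show ?thesis
      using t by (simp add: ennreal_mult ennreal_power mult_ac)
  qed
  have "(\<integral>\<^sup>+x. of_bool (pivot_event n (i, S) x) * H (\<Sum>j\<in>S. w (x i) (x j)) \<partial>?P) =
      (\<integral>\<^sup>+t. (\<integral>\<^sup>+x. of_bool (pivot_event n (i, S) (x(i := t))) * H (\<Sum>j\<in>S. w ((x(i := t)) i) ((x(i := t))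
            j)) \<partial>expos (S \<union> R)) \<partial>expo)"
    using meas R(1,3) fin unfolding R(4)[symmetric]
    by (subst expo_prod.product_nn_integral_insert_rev) auto
  also have "\<dots> = (\<integral>\<^sup>+t. ennreal (exp (- t) ^ k * (1 - exp (- t)) ^ (n - 1 - k)) *
        (\<integral>\<^sup>+x. H (\<Sum>j<k. w t (t + x j)) \<partial>expos {..<k}) \<partial>expo)"
    unfolding upd by (rule nn_integral_cong_AE, use AE_expo_nonneg in eventually_elim, rule inner)
  finally show ?e .
qed

text \<open>For \<open>k < n\<close>, the density of the \<open>(k+1)\<close>-st largest of
  \<open>n\<close> exponentials relative to the law of a single one; in the variable
  \<open>exp (- t)\<close> it is the Beta density with parameters \<open>k + 1\<close> and
  \<open>n - k\<close>.\<close>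

definition pivot_weight :: "nat \<Rightarrow> nat \<Rightarrow> real \<Rightarrow> real" where
  "pivot_weight n k t = fact n / (fact (n - 1 - k) * fact k) * (exp (- t) ^ k * (1 - exp (- t)) ^ (n - 1 - k))"

lemma pivot_weight_measurable[measurable]: "pivot_weight n k \<in> borel_measurable borel"
  unfolding pivot_weight_def[abs_def] by measurable

lemma pivot_weight_nonneg: "0 \<le> t \<Longrightarrow> 0 \<le> pivot_weight n k t"
  unfolding pivot_weight_def by (intro mult_nonneg_nonneg divide_nonneg_nonneg) auto

lemma pivot_weight_moment:
  assumes "k < n"
  shows "has_bochner_integral expo (\<lambda>t. pivot_weight n k t * exp (- t) ^ m) (fact n * fact (k + m) /
        (fact k * fact (n + m)))"
proof -
  have eq: "k + m + (n - 1 - k) + 1 = n + m" using assms by simp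
  have "has_bochner_integral expo
      (\<lambda>t. fact n / (fact (n - 1 - k) * fact k) * (exp (- t) ^ (k + m) * (1 - exp (- t)) ^ (n - 1 - k)))
      (fact n / (fact (n - 1 - k) * fact k) * (fact (n - 1 - k) * fact (k + m) / fact (n + m)))"
    using has_bochner_integral_expo_beta[of "k + m" "n - 1 - k"] unfolding eq
    by (intro has_bochner_integral_mult_right)
  moreover have "(\<lambda>t. fact n / (fact (n - 1 - k) * fact k) * (exp (- t) ^ (k + m) * (1 - exp (- t)) ^ (n -
        1 - k))) =
      (\<lambda>t::real. pivot_weight n k t * exp (- t) ^ m)"
    by (simp add: fun_eq_iff pivot_weight_def power_add mult_ac)
  moreover have "fact n / (fact (n - 1 - k) * fact k) * (fact (n - 1 - k) * fact (k + m) / fact (n + m)) =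
      (fact n * fact (k + m) / (fact k * fact (n + m)) :: real)"
    by simp
  ultimately show ?thesis by simp
qed

lemma pivot_weight_integral:
  assumes "k < n"
  shows "integrable expo (pivot_weight n k)" "integral\<^sup>L expo (pivot_weight n k) = 1"
  using pivot_weight_moment[OF assms, of 0] by (auto simp: has_bochner_integral_iff)

text \<open>Expand the square and insert the Beta moments of order 0, 1 and 2. The value is written
  in \<open>1 / k\<close> and \<open>1 / n\<close> so that its limit 1 - 2 + 1 = 0 can be read off
  termwise.\<close>

lemma pivot_weight_chebyshev:
  assumes "k < n" "1 \<le> k"
  shows "has_bochner_integral expo (\<lambda>t. pivot_weight n k t * (exp (- t) * (real n / real k) - 1)\<^sup>2)
    ((1 + 1 / real k) * (1 + 2 / real k) / ((1 + 1 / real n) * (1 + 2 / real n)) - 2 * ((1 + 1 / real k) /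
          (1 + 1 / real n)) + 1)"
proof -
  let ?c = "real n / real k"
  have pos: "real n > 0" "real k > 0" using assms by auto
  have "has_bochner_integral expo
     (\<lambda>t. ?c\<^sup>2 * (pivot_weight n k t * exp (- t) ^ 2) - 2 * ?c * (pivot_weight n k t * exp (- t) ^ 1) +
           pivot_weight n k t * exp (- t) ^ 0)
     (?c\<^sup>2 * (fact n * fact (k + 2) / (fact k * fact (n + 2))) - 2 * ?c * (fact n * fact (k + 1) /
           (fact k * fact (n + 1))) +
      fact n * fact (k + 0) / (fact k * fact (n + 0)))"
    by (intro has_bochner_integral_add has_bochner_integral_diff has_bochner_integral_mult_right
          pivot_weight_moment assms)
  moreover have "(\<lambda>t. ?c\<^sup>2 * (pivot_weight n k t * exp (- t) ^ 2) - 2 * ?c * (pivot_weight n k t *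
        exp (- t) ^ 1) + pivot_weight n k t * exp (- t) ^ 0) =
      (\<lambda>t. pivot_weight n k t * (exp (- t) * ?c - 1)\<^sup>2)"
    by (simp add: fun_eq_iff power2_eq_square algebra_simps)
  moreover have "?c\<^sup>2 * (fact n * fact (k + 2) / (fact k * fact (n + 2))) = (1 + 1 / real k) * (1 + 2 /
        real k) / ((1 + 1 / real n) * (1 + 2 / real n))"
  proof -
    have "fact (k + 2) = (real k + 1) * (real k + 2) * fact k" "fact (n + 2) = (real n + 1) * (real n +
          2) * fact n"
      by (simp_all add: numeral_2_eq_2 algebra_simps)
    then have "fact n * fact (k + 2) / (fact k * fact (n + 2)) = (real k + 1) * (real k + 2) /
          ((real n + 1) * (real n + 2))"
      by (simp only:) simp
    moreover have "1 + 1 / real k = (real k + 1) / real k" "1 + 2 / real k = (real k + 2) / real k"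
      "1 + 1 / real n = (real n + 1) / real n" "1 + 2 / real n = (real n + 2) / real n"
      using pos by (simp_all add: field_simps)
    ultimately show ?thesis
      using pos by (simp only:) (simp add: power2_eq_square divide_simps)
  qed
  moreover have "2 * ?c * (fact n * fact (k + 1) / (fact k * fact (n + 1))) = 2 * ((1 + 1 / real k) /
        (1 + 1 / real n))"
  proof -
    have "fact (k + 1) = (real k + 1) * fact k" "fact (n + 1) = (real n + 1) * fact n"
      by (simp_all add: algebra_simps)
    then have "fact n * fact (k + 1) / (fact k * fact (n + 1)) = (real k + 1) / (real n + 1)"
      by (simp only:) simp
    moreover have "1 + 1 / real k = (real k + 1) / real k" "1 + 1 / real n = (real n + 1) / real n" 
      using pos by (simp_all add: field_simps)
    ultimately show ?thesis
      using pos by (simp only:) (simp add: divide_simps)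
  qed
  ultimately show ?thesis by simp
qed

lemma pivot_weight_concentration:
  fixes k :: "nat \<Rightarrow> nat"
  assumes k: "\<forall>\<^sub>F n in sequentially. 1 \<le> k n \<and> k n < n" and k_top: "filterlim k at_top sequentially" and
        \<delta>: "0 < \<delta>"
  shows "(\<lambda>n. \<integral>t. pivot_weight n (k n) t * of_bool (\<delta> \<le> \<bar>exp (- t) * (real n / real (k n)) - 1\<bar>) \<partial>expo) \<longlonglongrightarrow> 0"
proof (rule tendsto_sandwich[where f = "\<lambda>_. 0"])
  define V where "V n = (1 + 1 / real (k n)) * (1 + 2 / real (k n)) / ((1 + 1 / real n) * (1 + 2 / real n)) -
      2 * ((1 + 1 / real (k n)) / (1 + 1 / real n)) + 1" for n
  have kr: "filterlim (\<lambda>n. real (k n)) at_top sequentially"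
    by (rule filterlim_compose[OF filterlim_real_sequentially k_top])
  have z: "(\<lambda>n. c / real (k n)) \<longlonglongrightarrow> 0" "(\<lambda>n. c / real n) \<longlonglongrightarrow> 0" for c
    by (rule real_tendsto_divide_at_top[OF tendsto_const kr], rule real_tendsto_divide_at_top[OF
          tendsto_const filterlim_real_sequentially])
  have "V \<longlonglongrightarrow> (1 + 0) * (1 + 0) / ((1 + 0) * (1 + 0)) - 2 * ((1 + 0) / (1 + 0)) + 1"
    unfolding V_def by (intro tendsto_intros z) auto
  then have V: "(\<lambda>n. V n / \<delta>\<^sup>2) \<longlonglongrightarrow> 0"
    using tendsto_divide_zero by fastforce
  then show "(\<lambda>n. V n / \<delta>\<^sup>2) \<longlonglongrightarrow> 0" .
  show "\<forall>\<^sub>F n in sequentially. 0 \<le> (\<integral>t. pivot_weight n (k n) t * of_bool (\<delta> \<le> \<bar>exp (- t) * (real n /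
        real (k n)) - 1\<bar>) \<partial>expo)"
  proof (rule always_eventually, rule allI, rule integral_nonneg_AE)
    fix n
    show "AE t in expo. 0 \<le> pivot_weight n (k n) t * of_bool (\<delta> \<le> \<bar>exp (- t) * (real n / real (k n)) - 1\<bar>)"
      using AE_expo_nonneg by eventually_elim (intro mult_nonneg_nonneg pivot_weight_nonneg; simp)
  qed
  show "\<forall>\<^sub>F n in sequentially. (\<integral>t. pivot_weight n (k n) t * of_bool (\<delta> \<le> \<bar>exp (- t) * (real n /
        real (k n)) - 1\<bar>) \<partial>expo) \<le> V n / \<delta>\<^sup>2"
    using k
  proof eventually_elim
    case (elim n)
    let ?c = "real n / real (k n)"
    have cheb: "has_bochner_integral expo (\<lambda>t. pivot_weight n (k n) t * (exp (- t) * ?c - 1)\<^sup>2 / \<delta>\<^sup>2)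
          (V n / \<delta>\<^sup>2)"
      unfolding V_def by (intro has_bochner_integral_divide_zero pivot_weight_chebyshev) (use elim in auto)
    have bound: "of_bool (\<delta> \<le> \<bar>y\<bar>) \<le> y\<^sup>2 / \<delta>\<^sup>2" for y
    proof (cases "\<delta> \<le> \<bar>y\<bar>")
      case True
      then have "\<delta>\<^sup>2 \<le> \<bar>y\<bar>\<^sup>2" using \<delta> by (intro power_mono) auto
      then show ?thesis using \<delta> True by simp
    qed simp
    have "(\<integral>t. pivot_weight n (k n) t * of_bool (\<delta> \<le> \<bar>exp (- t) * ?c - 1\<bar>) \<partial>expo) \<le>
        (\<integral>t. pivot_weight n (k n) t * (exp (- t) * ?c - 1)\<^sup>2 / \<delta>\<^sup>2 \<partial>expo)"
    proof (rule integral_mono_AE)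
      show "integrable expo (\<lambda>t. pivot_weight n (k n) t * (exp (- t) * ?c - 1)\<^sup>2 / \<delta>\<^sup>2)"
        using cheb by (simp add: has_bochner_integral_iff)
      have "integrable expo (pivot_weight n (k n))"
        using elim by (intro pivot_weight_integral) auto
      then show "integrable expo (\<lambda>t. pivot_weight n (k n) t * of_bool (\<delta> \<le> \<bar>exp (- t) * ?c - 1\<bar>))"
        by (rule Bochner_Integration.integrable_bound) (auto simp: of_bool_def)
      show "AE t in expo. pivot_weight n (k n) t * of_bool (\<delta> \<le> \<bar>exp (- t) * ?c - 1\<bar>) \<le>
            pivot_weight n (k n) t * (exp (- t) * ?c - 1)\<^sup>2 / \<delta>\<^sup>2"
        using AE_expo_nonneg
      proof eventually_elim
        case (elim t)
        show ?case
          using mult_left_mono[OF bound[of "exp (- t) * ?c - 1"] pivot_weight_nonneg[OF elim, of n "k n"]]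
                by simp
      qed
    qed
    also have "\<dots> = V n / \<delta>\<^sup>2" using cheb by (simp add: has_bochner_integral_iff)
    finally show ?case .
  qed
qed simp

text \<open>The convergence hypothesis is sequential, which lets the conditional problem be treated
  for deterministic threshold sequences only. Uniformity in a window around the concentration point
  is recovered by contradiction, and the mass outside the window vanishes.\<close>

lemma pivot_weight_average_tendsto:
  fixes k :: "nat \<Rightarrow> nat" and \<phi> :: "nat \<Rightarrow> real \<Rightarrow> real"
  assumes k: "\<forall>\<^sub>F n in sequentially. 1 \<le> k n \<and> k n < n" and k_top: "filterlim k at_top sequentially"
    and \<phi>[measurable]: "\<And>n. \<phi> n \<in> borel_measurable borel" and B: "\<And>n t. \<bar>\<phi> n t\<bar> \<le> B" and L: "\<bar>L\<bar> \<le> B"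
    and lim: "\<And>N t. filterlim N at_top sequentially \<Longrightarrow>
      (\<lambda>m. exp (- t m) * (real (N m) / real (k (N m)))) \<longlonglongrightarrow> 1 \<Longrightarrow> (\<lambda>m. \<phi> (N m) (t m)) \<longlonglongrightarrow> L"
  shows "(\<lambda>n. \<integral>t. pivot_weight n (k n) t * \<phi> n t \<partial>expo) \<longlonglongrightarrow> L"
proof (rule LIMSEQ_I)
  fix e :: real assume e: "0 < e"
  let ?c = "\<lambda>n. real n / real (k n)"
  have "\<exists>\<delta>>0. \<forall>\<^sub>F n in sequentially. \<forall>t. \<bar>exp (- t) * ?c n - 1\<bar> < \<delta> \<longrightarrow> \<bar>\<phi> n t - L\<bar> \<le> e / 2"
  proof (rule ccontr)
    \<comment> \<open>Counterexamples \<open>n \<ge> m\<close> for windows of width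
      \<open>1 / (m + 1)\<close> form sequences to which \<open>lim\<close> applies. Its indices
      only have to tend to infinity, so no monotone subsequence has to be extracted.\<close>
    assume neg: "\<not> ?thesis"
    have "\<exists>n\<ge>m. \<exists>t. \<bar>exp (- t) * ?c n - 1\<bar> < 1 / real (Suc m) \<and> \<not> \<bar>\<phi> n t - L\<bar> \<le> e / 2" for m
    proof (rule ccontr)
      assume "\<not> ?thesis"
      then have "\<forall>n\<ge>m. \<forall>t. \<bar>exp (- t) * ?c n - 1\<bar> < 1 / real (Suc m) \<longrightarrow> \<bar>\<phi> n t - L\<bar> \<le> e / 2" by blast
      then have "\<forall>\<^sub>F n in sequentially. \<forall>t. \<bar>exp (- t) * ?c n - 1\<bar> < 1 / real (Suc m) \<longrightarrow> \<bar>\<phi> n t - L\<bar> \<le> e / 2"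
        unfolding eventually_sequentially by blast
      moreover have "0 < 1 / real (Suc m)" by simp
      ultimately show False using neg by blast
    qed
    then obtain N where N: "\<And>m. m \<le> N m" "\<And>m. \<exists>t. \<bar>exp (- t) * ?c (N m) - 1\<bar> < 1 / real (Suc m) \<and>
          \<not> \<bar>\<phi> (N m) t - L\<bar> \<le> e / 2"
      by metis
    from N(2) obtain t where t: "\<And>m. \<bar>exp (- t m) * ?c (N m) - 1\<bar> < 1 / real (Suc m)" "\<And>m. \<not> \<bar>\<phi> (N m)
          (t m) - L\<bar> \<le> e / 2"
      by metis
    have "filterlim N at_top sequentially"
      by (rule filterlim_at_top_mono[OF filterlim_ident]) (use N(1) in simp)
    moreover have "(\<lambda>m. exp (- t m) * ?c (N m)) \<longlonglongrightarrow> 1"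
    proof -
      have "(\<lambda>m. 1 / real (Suc m)) \<longlonglongrightarrow> 0"
        using LIMSEQ_inverse_real_of_nat by (simp add: inverse_eq_divide)
      then have "(\<lambda>m. exp (- t m) * ?c (N m) - 1) \<longlonglongrightarrow> 0"
        by (rule Lim_null_comparison[rotated]) (use t(1) in \<open>auto intro!: always_eventually less_imp_le\<close>)
      then show ?thesis using LIM_zero_iff by blast
    qed
    ultimately have "(\<lambda>m. \<phi> (N m) (t m)) \<longlonglongrightarrow> L" by (rule lim)
    then have "\<forall>\<^sub>F m in sequentially. \<bar>\<phi> (N m) (t m) - L\<bar> < e / 2"
      using tendstoD[of _ L sequentially "e / 2"] e by (simp add: dist_real_def)
    then obtain m where "\<bar>\<phi> (N m) (t m) - L\<bar> < e / 2" by (auto simp: eventually_sequentially)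
    then show False using t(2)[of m] by simp
  qed
  then obtain \<delta> where \<delta>: "\<delta> > 0" and near: "\<forall>\<^sub>F n in sequentially. \<forall>t. \<bar>exp (- t) * ?c n - 1\<bar> < \<delta> \<longrightarrow>
        \<bar>\<phi> n t - L\<bar> \<le> e / 2"
    by blast
  have B0: "0 \<le> B" using L by linarith
  \<comment> \<open>The mass left outside the window, where only the crude bound
    \<open>2 * B\<close> for the difference from the limit is available.\<close>
  define far where "far n = (\<integral>t. pivot_weight n (k n) t * of_bool (\<delta> \<le> \<bar>exp (- t) * ?c n - 1\<bar>) \<partial>expo)" for n
  have "(\<lambda>n. 2 * B * far n) \<longlonglongrightarrow> 2 * B * 0"
    unfolding far_def by (intro tendsto_mult tendsto_const pivot_weight_concentration k k_top \<delta>)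
  then have "\<forall>\<^sub>F n in sequentially. 2 * B * far n < e / 2"
    by (rule order_tendstoD) (use e in simp)
  then have "\<forall>\<^sub>F n in sequentially. norm ((\<integral>t. pivot_weight n (k n) t * \<phi> n t \<partial>expo) - L) < e"
    using near k
  proof eventually_elim
    case (elim n)
    then have kn: "k n < n" by simp
    note W = pivot_weight_integral[OF kn]
    let ?W = "pivot_weight n (k n)"
    have ob: "integrable expo (\<lambda>t. ?W t * of_bool (\<delta> \<le> \<bar>exp (- t) * ?c n - 1\<bar>))"
      by (rule Bochner_Integration.integrable_bound[OF W(1)]) (auto simp: of_bool_def)
    have diffB: "\<bar>\<phi> n t - L\<bar> \<le> 2 * B" for t
      using B[of n t] L abs_triangle_ineq4[of "\<phi> n t" L] by linarith
    have int: "integrable expo (\<lambda>t. ?W t * (\<phi> n t - L))"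
    proof (rule Bochner_Integration.integrable_bound[of _ "\<lambda>t. 2 * B * ?W t"])
      show "AE t in expo. norm (?W t * (\<phi> n t - L)) \<le> norm (2 * B * ?W t)"
      proof (rule AE_I2)
        fix t
        have "\<bar>?W t\<bar> * \<bar>\<phi> n t - L\<bar> \<le> \<bar>?W t\<bar> * (2 * B)"
          by (rule mult_left_mono[OF diffB]) simp
        then show "norm (?W t * (\<phi> n t - L)) \<le> norm (2 * B * ?W t)"
          using B0 by (simp add: abs_mult mult_ac)
      qed
    qed (use W in auto)
    have "(\<lambda>t. ?W t * \<phi> n t) = (\<lambda>t. ?W t * (\<phi> n t - L) + ?W t * L)"
      by (simp add: algebra_simps)
    then have "(\<integral>t. ?W t * \<phi> n t \<partial>expo) = (\<integral>t. ?W t * (\<phi> n t - L) \<partial>expo) + (\<integral>t. ?W t * L \<partial>expo)"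
      using int W by simp
    then have "norm ((\<integral>t. ?W t * \<phi> n t \<partial>expo) - L) = \<bar>\<integral>t. ?W t * (\<phi> n t - L) \<partial>expo\<bar>"
      using W by simp
    also have "\<dots> \<le> (\<integral>t. \<bar>?W t * (\<phi> n t - L)\<bar> \<partial>expo)" by (rule integral_abs_bound)
    also have "\<dots> \<le> (\<integral>t. e / 2 * ?W t + 2 * B * (?W t * of_bool (\<delta> \<le> \<bar>exp (- t) * ?c n - 1\<bar>)) \<partial>expo)"
    proof (rule integral_mono_AE)
      show "AE t in expo. \<bar>?W t * (\<phi> n t - L)\<bar> \<le> e / 2 * ?W t + 2 * B * (?W t * of_bool (\<delta> \<le>
            \<bar>exp (- t) * ?c n - 1\<bar>))"
        using AE_expo_nonneg
      proof eventually_elim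
        case t: (elim t)
        have W0: "0 \<le> ?W t" by (rule pivot_weight_nonneg[OF t])
        have "\<bar>\<phi> n t - L\<bar> \<le> e / 2 + 2 * B * of_bool (\<delta> \<le> \<bar>exp (- t) * ?c n - 1\<bar>)"
        proof (cases "\<delta> \<le> \<bar>exp (- t) * ?c n - 1\<bar>")
          case True
          then show ?thesis using diffB[of t] e by simp
        next
          case False
          then have "\<bar>exp (- t) * ?c n - 1\<bar> < \<delta>" by simp
          then show ?thesis using elim(2) False by simp
        qed
        from mult_left_mono[OF this W0] show ?case
          using W0 by (simp only: abs_mult abs_of_nonneg distrib_left mult_ac)
      qed
    qed (use int W ob in auto)
    also have "\<dots> = e / 2 + 2 * B * far n"
      unfolding far_def using W ob by simp
    finally show ?case using elim(1) by simp
  qed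
  then show "\<exists>no. \<forall>n\<ge>no. norm ((\<integral>t. pivot_weight n (k n) t * \<phi> n t \<partial>expo) - L) < e"
    by (simp add: eventually_sequentially)
qed

text \<open>Ties need no direct treatment: the events are disjoint, each has probability
  \<open>fact (n - 1 - k) * fact k / fact n\<close>, and this is the reciprocal of their number, so
  together they carry full mass.\<close>

lemma AE_pivot_event:
  assumes "k < n"
  shows "AE x in expos {..<n}. \<exists>p\<in>pivots n k. pivot_event n p x"
    and "\<And>x. \<exists>p\<in>pivots n k. pivot_event n p x \<Longrightarrow> (\<Sum>p\<in>pivots n k. of_bool (pivot_event n p x)) = (1::ennreal)"
proof -
  let ?P = "expos {..<n}"
  interpret P: prob_space ?P by (rule prob_space_PiM_expo)
  have meas[measurable]: "(\<lambda>x. of_bool (pivot_event n p x) :: ennreal) \<in> borel_measurable ?P"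
    and int: "(\<integral>\<^sup>+x. of_bool (pivot_event n p x) \<partial>?P) = ennreal (fact (n - 1 - k) * fact k / fact n)"
    if "p \<in> pivots n k" for p
  proof -
    interpret K: prob_space "expos {..<k}" by (rule prob_space_PiM_expo)
    have p: "(fst p, snd p) \<in> pivots n k" using that by simp
    \<comment> \<open>With zero summands and \<open>H\<close> constantly 1 the pivot formula
      computes the probability of a single pivot event.\<close>
    have w: "(\<lambda>(t, x). (\<lambda>_ _. (0, 0)) t x :: real \<times> real) \<in> borel_measurable (borel \<Otimes>\<^sub>M borel ::
          (real \<times> real) measure)"
      by (simp add: split_beta)
    have H: "(\<lambda>_. 1 :: ennreal) \<in> borel_measurable (borel :: (real \<times> real) measure)" by simp
    note piv = nn_integral_pivot[OF p w H]
    show "(\<lambda>x. of_bool (pivot_event n p x) :: ennreal) \<in> borel_measurable ?P"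
      using piv(1) by simp
    have "(\<integral>\<^sup>+x. of_bool (pivot_event n p x) \<partial>?P) = (\<integral>\<^sup>+t. ennreal (exp (- t) ^ k * (1 - exp (- t)) ^ (n -
          1 - k)) \<partial>expo)"
      using piv(2) by (simp add: K.emeasure_space_1)
    also have "\<dots> = ennreal (integral\<^sup>L expo (\<lambda>t. exp (- t) ^ k * (1 - exp (- t)) ^ (n - 1 - k)))"
    proof (rule nn_integral_eq_integral)
      show "integrable expo (\<lambda>t. exp (- t) ^ k * (1 - exp (- t)) ^ (n - 1 - k))"
        using has_bochner_integral_expo_beta by (simp add: has_bochner_integral_iff)
      show "AE t in expo. 0 \<le> exp (- t) ^ k * (1 - exp (- t)) ^ (n - 1 - k)"
        using AE_expo_nonneg by eventually_elim simp
    qed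
    also have "integral\<^sup>L expo (\<lambda>t. exp (- t) ^ k * (1 - exp (- t)) ^ (n - 1 - k)) = fact (n - 1 - k) *
          fact k / fact n"
      using has_bochner_integral_expo_beta[of k "n - 1 - k"] assms by (simp add: has_bochner_integral_iff)
    finally show "(\<integral>\<^sup>+x. of_bool (pivot_event n p x) \<partial>?P) = ennreal (fact (n - 1 - k) * fact k / fact n)" .
  qed
  show one: "(\<Sum>p\<in>pivots n k. of_bool (pivot_event n p x)) = (1::ennreal)" if "\<exists>p\<in>pivots n k. pivot_event n
        p x" for x
  proof -
    from that obtain p where p: "p \<in> pivots n k" "pivot_event n p x" by blast
    have "(\<Sum>q\<in>pivots n k. of_bool (pivot_event n q x)) = (\<Sum>q\<in>pivots n k. if q = p then 1 else 0 :: ennreal)"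
      using p pivot_event_unique by (intro sum.cong) (auto simp: of_bool_def)
    then show ?thesis using p finite_pivots by simp
  qed
  let ?E = "{x \<in> space ?P. (\<Sum>p\<in>pivots n k. of_bool (pivot_event n p x)) = (1::ennreal)}"
  have sum_meas: "(\<lambda>x. \<Sum>p\<in>pivots n k. of_bool (pivot_event n p x) :: ennreal) \<in> borel_measurable ?P"
    by (rule borel_measurable_sum) (rule meas)
  then have E: "?E \<in> sets ?P" by measurable
  have cases: "(\<Sum>p\<in>pivots n k. of_bool (pivot_event n p x)) = (0::ennreal) \<or> (\<Sum>p\<in>pivots n k. of_bool
        (pivot_event n p x)) = (1::ennreal)" for x
    using one[of x] by (cases "\<exists>p\<in>pivots n k. pivot_event n p x") auto
  have "emeasure ?P ?E = (\<integral>\<^sup>+x. indicator ?E x \<partial>?P)" using E by simp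
  also have "\<dots> = (\<integral>\<^sup>+x. (\<Sum>p\<in>pivots n k. of_bool (pivot_event n p x)) \<partial>?P)"
  proof (rule nn_integral_cong)
    fix x assume "x \<in> space ?P"
    then show "indicator ?E x = (\<Sum>p\<in>pivots n k. of_bool (pivot_event n p x) :: ennreal)"
      using cases[of x] by (auto simp: indicator_def)
  qed
  also have "\<dots> = (\<Sum>p\<in>pivots n k. ennreal (fact (n - 1 - k) * fact k / fact n))"
    by (subst nn_integral_sum) (auto simp: meas int)
  also have "\<dots> = ennreal (real (card (pivots n k)) * (fact (n - 1 - k) * fact k / fact n))"
    unfolding sum_constant ennreal_of_nat_eq_real_of_nat by (rule ennreal_mult'[symmetric]) simp
  also have "\<dots> = 1" using card_pivots[OF assms] by simp
  finally have "AE x in ?P. x \<in> ?E"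
    using P.AE_iff_emeasure_eq_1 E by (simp add: P.emeasure_eq_measure P.AE_prob_1)
  then show "AE x in ?P. \<exists>p\<in>pivots n k. pivot_event n p x"
  proof eventually_elim
    case (elim x)
    show ?case
    proof (rule ccontr)
      assume "\<not> ?case"
      then have "(\<Sum>p\<in>pivots n k. of_bool (pivot_event n p x)) = (0::ennreal)" by auto
      then show False using elim by simp
    qed
  qed
qed

text \<open>Split the integral along the pivot events. All of them contribute the same amount, and
  their number is precisely the normalising constant in \<open>pivot_weight\<close>.\<close>

lemma nn_integral_order_stat:
  fixes u :: "real \<Rightarrow> real" and g :: "real \<Rightarrow> real \<times> real" and H :: "real \<times> real \<Rightarrow> ennreal"
  assumes kn: "k < n" and u: "mono u" and g[measurable]: "g \<in> borel_measurable borel"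
    and H[measurable]: "H \<in> borel_measurable borel"
  defines "Y \<equiv> \<lambda>i x. u (x i)"
  shows "(\<integral>\<^sup>+x. H (\<Sum>l<k. g (order_stat Y (n - l) n x / order_stat Y (n - k) n x)) \<partial>expos {..<n}) =
    (\<integral>\<^sup>+t. ennreal (pivot_weight n k t) * (\<integral>\<^sup>+x. H (\<Sum>j<k. g (u (t + x j) / u t)) \<partial>expos {..<k}) \<partial>expo)"
proof -
  let ?P = "expos {..<n}"
  let ?\<Psi> = "\<lambda>t. \<integral>\<^sup>+x. H (\<Sum>j<k. g (u (t + x j) / u t)) \<partial>expos {..<k}"
  have [measurable]: "u \<in> borel_measurable borel" by (rule borel_measurable_mono[OF u])
  define w where "w t x = g (u x / u t)" for t x
  have w: "(\<lambda>(t, x). w t x) \<in> borel_measurable (borel \<Otimes>\<^sub>M borel)"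
    unfolding w_def by measurable
  have ws: "(\<lambda>(t, x). w t (t + x)) \<in> borel_measurable (borel \<Otimes>\<^sub>M borel)"
    unfolding w_def by measurable
  have \<Psi>[measurable]: "?\<Psi> \<in> borel_measurable borel"
    using measurable_nn_integral_expo_sum[OF ws H, of "\<lambda>_. 0" k] by (simp add: w_def)
  have on_pivot: "of_bool (pivot_event n p x) * H (\<Sum>l<k. g (order_stat Y (n - l) n x / order_stat Y (n -
        k) n x)) =
      of_bool (pivot_event n p x) * H (\<Sum>j\<in>snd p. w (x (fst p)) (x j))" if p: "p \<in> pivots n k" for p x
  proof (cases "pivot_event n p x")
    case True
    have "fst p < n" "fst p \<notin> snd p" "snd p \<subseteq> {..<n}" "card (snd p) = k"
      using p by (auto simp: pivots_def)
    \<comment> \<open>A monotone \<open>u\<close> may merge distinct exponentials, so strictness is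
      lost here; the description of the top order statistics survives this.\<close>
    moreover have "Y (fst p) x \<le> Y j x" if "j \<in> snd p" for j
      using True that monoD[OF u] by (auto simp: Y_def pivot_event_def less_imp_le)
    moreover have "Y j x \<le> Y (fst p) x" if "j \<in> {..<n} - insert (fst p) (snd p)" for j
      using True that monoD[OF u, of "x j" "x (fst p)"] less_imp_le unfolding Y_def pivot_event_def by blast
    ultimately have *: "order_stat Y (n - k) n x = Y (fst p) x"
      "(\<Sum>l<k. h (order_stat Y (n - l) n x)) = (\<Sum>j\<in>snd p. h (Y j x))" for h :: "real \<Rightarrow> real \<times> real"
      using order_stat_top[of "fst p" n "snd p" k Y x] by blast+
    have "(\<Sum>l<k. g (order_stat Y (n - l) n x / order_stat Y (n - k) n x)) = (\<Sum>j\<in>snd p. w (x (fst p)) (x j))"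
      unfolding *(1) using *(2)[of "\<lambda>v. g (v / Y (fst p) x)"] by (simp add: w_def Y_def)
    then show ?thesis by simp
  qed simp
  have "(\<integral>\<^sup>+x. H (\<Sum>l<k. g (order_stat Y (n - l) n x / order_stat Y (n - k) n x)) \<partial>?P) =
      (\<integral>\<^sup>+x. (\<Sum>p\<in>pivots n k. of_bool (pivot_event n p x) * H (\<Sum>j\<in>snd p. w (x (fst p)) (x j))) \<partial>?P)"
  proof (rule nn_integral_cong_AE)
    show "AE x in ?P. H (\<Sum>l<k. g (order_stat Y (n - l) n x / order_stat Y (n - k) n x)) =
        (\<Sum>p\<in>pivots n k. of_bool (pivot_event n p x) * H (\<Sum>j\<in>snd p. w (x (fst p)) (x j)))"
      using AE_pivot_event(1)[OF kn]
    proof eventually_elim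
      case (elim x)
      let ?h = "H (\<Sum>l<k. g (order_stat Y (n - l) n x / order_stat Y (n - k) n x))"
      have "?h = (\<Sum>p\<in>pivots n k. of_bool (pivot_event n p x)) * ?h"
        using AE_pivot_event(2)[OF kn elim] by simp
      also have "\<dots> = (\<Sum>p\<in>pivots n k. of_bool (pivot_event n p x) * ?h)"
        by (rule sum_distrib_right)
      also have "\<dots> = (\<Sum>p\<in>pivots n k. of_bool (pivot_event n p x) * H (\<Sum>j\<in>snd p. w (x (fst p)) (x j)))"
        by (rule sum.cong[OF refl on_pivot])
      finally show ?case .
    qed
  qed
  also have "\<dots> = (\<Sum>p\<in>pivots n k. \<integral>\<^sup>+x. of_bool (pivot_event n p x) * H (\<Sum>j\<in>snd p. w (x (fst p)) (x j)) \<partial>?P)"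
    using nn_integral_pivot(1)[OF _ w H, where n = n and k = k] by (intro nn_integral_sum) (auto simp:
          split_paired_all)
  also have "\<dots> = (\<Sum>p\<in>pivots n k. \<integral>\<^sup>+t. ennreal (exp (- t) ^ k * (1 - exp (- t)) ^ (n - 1 - k)) * ?\<Psi> t \<partial>expo)"
    using nn_integral_pivot(2)[OF _ w H, where n = n and k = k] by (intro sum.cong) (auto simp: w_def)
  also have "\<dots> = ennreal (real (card (pivots n k))) * (\<integral>\<^sup>+t. ennreal (exp (- t) ^ k * (1 - exp (- t)) ^
        (n - 1 - k)) * ?\<Psi> t \<partial>expo)"
    by (simp add: ennreal_of_nat_eq_real_of_nat)
  also have "\<dots> = (\<integral>\<^sup>+t. ennreal (real (card (pivots n k))) * (ennreal (exp (- t) ^ k * (1 - exp (- t)) ^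
        (n - 1 - k)) * ?\<Psi> t) \<partial>expo)"
    by (rule nn_integral_cmult[symmetric]) (simp add: measurable_expo)
  also have "\<dots> = (\<integral>\<^sup>+t. ennreal (pivot_weight n k t) * ?\<Psi> t \<partial>expo)"
    unfolding pivot_weight_def card_pivots[OF kn]
    by (rule nn_integral_cong, subst ennreal_mult', simp, rule mult.assoc[symmetric])
  finally show ?thesis .
qed

section \<open>A central limit theorem for triangular arrays\<close>

lemma real_nat_mult_exp_minus_one_tendsto:
  fixes \<theta> :: complex and K :: "nat \<Rightarrow> nat"
  assumes K: "filterlim K at_top sequentially"
  shows "(\<lambda>m. of_nat (K m) * (exp (\<theta> / of_nat (K m)) - 1)) \<longlonglongrightarrow> \<theta>"
proof -
  have K0: "\<forall>\<^sub>F m in sequentially. K m > 0"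
    using K[unfolded filterlim_at_top, rule_format, of 1] by eventually_elim simp
  have "((\<lambda>h. exp (\<theta> * h)) has_field_derivative \<theta>) (at 0)"
    by (auto intro!: derivative_eq_intros)
  then have "((\<lambda>h. (exp (\<theta> * h) - 1) / h) \<longlongrightarrow> \<theta>) (at 0)"
    by (simp add: has_field_derivative_iff)
  moreover have "filterlim (\<lambda>m. 1 / (of_nat (K m) :: complex)) (at 0) sequentially"
  proof (rule filterlim_atI)
    have "filterlim (\<lambda>m. of_nat (K m) :: complex) at_infinity sequentially"
      by (rule filterlim_compose[OF tendsto_of_nat K])
    then show "(\<lambda>m. 1 / (of_nat (K m) :: complex)) \<longlonglongrightarrow> 0"
      by (rule tendsto_divide_0[OF tendsto_const])
    show "\<forall>\<^sub>F m in sequentially. 1 / (of_nat (K m) :: complex) \<noteq> 0"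
      using K0 by eventually_elim simp
  qed
  ultimately have "(\<lambda>m. (exp (\<theta> * (1 / of_nat (K m))) - 1) / (1 / of_nat (K m))) \<longlonglongrightarrow> \<theta>"
    by (rule filterlim_compose)
  then show ?thesis
    by (simp add: mult.commute)
qed

text \<open>Compare with the \<open>K m\<close>-th power of \<open>exp (\<theta> / K m)\<close>.
  Both bases lie in the unit disc, the second because \<open>Re \<theta> \<le> 0\<close>, so the
  powers differ by at most \<open>K m\<close> times the difference of the bases. No complex
  logarithm is involved.\<close>

lemma power_tendsto_exp:
  fixes \<phi> :: "nat \<Rightarrow> complex" and K :: "nat \<Rightarrow> nat"
  assumes K: "filterlim K at_top sequentially" and le: "\<And>m. norm (\<phi> m) \<le> 1" and \<theta>: "Re \<theta> \<le> 0"
    and lim: "(\<lambda>m. of_nat (K m) * (\<phi> m - 1)) \<longlonglongrightarrow> \<theta>"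
  shows "(\<lambda>m. \<phi> m ^ K m) \<longlonglongrightarrow> exp \<theta>"
proof -
  have K0: "\<forall>\<^sub>F m in sequentially. K m > 0"
    using K[unfolded filterlim_at_top, rule_format, of 1] by eventually_elim simp
  let ?b = "\<lambda>m. exp (\<theta> / of_nat (K m))"
  have "(\<lambda>m. norm (of_nat (K m) * (\<phi> m - 1) - of_nat (K m) * (?b m - 1))) \<longlonglongrightarrow> norm (\<theta> - \<theta>)"
    by (intro tendsto_intros lim real_nat_mult_exp_minus_one_tendsto K)
  then have null: "(\<lambda>m. norm (of_nat (K m) * (\<phi> m - 1) - of_nat (K m) * (?b m - 1))) \<longlonglongrightarrow> 0" by simp
  have "(\<lambda>m. \<phi> m ^ K m - ?b m ^ K m) \<longlonglongrightarrow> 0"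
  proof (rule Lim_null_comparison[OF _ null], intro always_eventually allI)
    fix m
    have "norm (?b m) \<le> 1"
      using \<theta> by (simp add: divide_nonpos_nonneg Re_divide_of_nat)
    from norm_power_diff[OF le this]
    have "norm (\<phi> m ^ K m - ?b m ^ K m) \<le> real (K m) * norm (\<phi> m - ?b m)" .
    also have "\<dots> = norm (of_nat (K m) * (\<phi> m - 1) - of_nat (K m) * (?b m - 1))"
    proof -
      have "of_nat (K m) * (\<phi> m - 1) - of_nat (K m) * (?b m - 1) = of_nat (K m) * (\<phi> m - ?b m)"
        by (simp add: algebra_simps)
      then show ?thesis by (simp only: norm_mult norm_of_nat)
    qed
    finally show "norm (\<phi> m ^ K m - ?b m ^ K m) \<le> norm (of_nat (K m) * (\<phi> m - 1) - of_nat (K m) * (?b m - 1))" .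
  qed
  moreover have "\<forall>\<^sub>F m in sequentially. \<phi> m ^ K m - ?b m ^ K m = \<phi> m ^ K m - exp \<theta>"
    using K0 by eventually_elim (simp flip: exp_of_nat_mult)
  ultimately have "(\<lambda>m. \<phi> m ^ K m - exp \<theta>) \<longlonglongrightarrow> 0"
    by (rule Lim_transform_eventually)
  then show ?thesis by (simp add: LIM_zero_iff)
qed

lemma iexp_approx_quadratic: "norm (iexp y - (1 + \<i> * of_real y) + of_real (y\<^sup>2 / 2)) \<le> \<bar>y\<bar> ^ 3 / 6"
  using iexp_approx1[of y 2] by (simp add: eval_nat_numeral power_mult_distrib algebra_simps)

text \<open>One square-integrable majorant for all rows takes the place of a Lindeberg condition.
  The rows need not be centred: a mean of order \<open>1 / sqrt K\<close> survives in the limit as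
  the drift \<beta>.\<close>

theorem (in prob_space) triangular_clt:
  fixes \<zeta> :: "nat \<Rightarrow> 'a \<Rightarrow> real" and K :: "nat \<Rightarrow> nat"
  assumes K: "filterlim K at_top sequentially" and K0: "\<And>m. K m > 0"
    and [measurable]: "\<And>m. \<zeta> m \<in> borel_measurable M" "z \<in> borel_measurable M" "w \<in> borel_measurable M"
    and lim: "AE x in M. (\<lambda>m. \<zeta> m x) \<longlonglongrightarrow> z x"
    and dom: "\<And>m. AE x in M. \<bar>\<zeta> m x\<bar> \<le> w x" and w2: "integrable M (\<lambda>x. (w x)\<^sup>2)"
    and mean: "(\<lambda>m. sqrt (real (K m)) * expectation (\<zeta> m)) \<longlonglongrightarrow> \<beta>"
  shows "(\<lambda>m. (\<integral>x. iexp (\<zeta> m x / sqrt (real (K m))) \<partial>M) ^ K m) \<longlonglongrightarrow>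
    exp (\<i> * of_real \<beta> - of_real (expectation (\<lambda>x. (z x)\<^sup>2) / 2))"
proof (rule power_tendsto_exp[OF K])
  let ?s = "\<lambda>m. sqrt (real (K m))"
  let ?\<phi> = "\<lambda>m. \<integral>x. iexp (\<zeta> m x / ?s m) \<partial>M"
  have s0: "?s m > 0" for m using K0[of m] by simp
  have int_iexp: "integrable M (\<lambda>x. iexp (\<zeta> m x / ?s m))" for m
    by (rule integrable_const_bound[of _ 1]) auto
  show "norm (?\<phi> m) \<le> 1" for m
  proof -
    have "norm (?\<phi> m) \<le> (\<integral>x. norm (iexp (\<zeta> m x / ?s m)) \<partial>M)" by (rule integral_norm_bound)
    then show ?thesis by (simp add: prob_space)
  qed
  show "Re (\<i> * of_real \<beta> - of_real (expectation (\<lambda>x. (z x)\<^sup>2) / 2)) \<le> 0"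
    by (simp add: integral_nonneg_AE)
  have int_w: "integrable M w"
    using square_integrable_imp_integrable[OF assms(5) w2] .
  have int_\<zeta>: "integrable M (\<zeta> m)" for m
    by (rule Bochner_Integration.integrable_bound[OF int_w]) (use dom[of m] in \<open>auto elim!: eventually_mono\<close>)
  \<comment> \<open>The rescaled second-order Taylor remainder of the characteristic function.
    Keeping the linear term apart is what isolates the drift.\<close>
  define A where "A m x = of_nat (K m) * (iexp (\<zeta> m x / ?s m) - (1 + \<i> * of_real (\<zeta> m x / ?s m)))" for m x
  have [measurable]: "A m \<in> borel_measurable M" for m
    unfolding A_def by measurable
  have A_bound: "norm (A m x) \<le> (\<zeta> m x)\<^sup>2 / 2" for m x
  proof -
    let ?y = "\<zeta> m x / ?s m"
    have "norm (iexp ?y - (1 + \<i> * of_real ?y)) \<le> ?y\<^sup>2 / 2"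
      using iexp_approx1[of ?y 1] by (simp add: numeral_2_eq_2)
    then have "norm (A m x) \<le> real (K m) * (?y\<^sup>2 / 2)"
      unfolding A_def norm_mult norm_of_nat by (intro mult_left_mono) auto
    also have "\<dots> = (\<zeta> m x)\<^sup>2 / 2"
      using K0[of m] by (simp add: power_divide)
    finally show ?thesis .
  qed
  have "(\<lambda>m. integral\<^sup>L M (A m)) \<longlonglongrightarrow> integral\<^sup>L M (\<lambda>x. of_real (- ((z x)\<^sup>2 / 2)))"
  proof (rule integral_dominated_convergence[where w = "\<lambda>x. (w x)\<^sup>2 / 2"])
    show "AE x in M. (\<lambda>m. A m x) \<longlonglongrightarrow> of_real (- ((z x)\<^sup>2 / 2))"
      using lim
    proof eventually_elim
      case (elim x)
      have "(\<lambda>m. A m x + of_real ((\<zeta> m x)\<^sup>2 / 2)) \<longlonglongrightarrow> 0"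
      proof (rule Lim_null_comparison[where g = "\<lambda>m. \<bar>\<zeta> m x\<bar> ^ 3 / 6 / ?s m"], intro always_eventually allI)
        fix m
        let ?y = "\<zeta> m x / ?s m"
        \<comment> \<open>The cubic estimate identifies the limit at a fixed \<open>x\<close> only;
          domination relies on the quadratic estimate \<open>A_bound\<close>, so third moments are
          never integrated.\<close>
        have "norm (iexp ?y - (1 + \<i> * of_real ?y) + of_real (?y\<^sup>2 / 2)) \<le> \<bar>?y\<bar> ^ 3 / 6"
          by (rule iexp_approx_quadratic)
        then have "real (K m) * norm (iexp ?y - (1 + \<i> * of_real ?y) + of_real (?y\<^sup>2 / 2)) \<le>
              real (K m) * (\<bar>?y\<bar> ^ 3 / 6)"
          by (intro mult_left_mono) auto
        also have "\<dots> = \<bar>\<zeta> m x\<bar> ^ 3 / 6 / ?s m"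
        proof -
          have "real (K m) = ?s m * ?s m" by simp
          then show ?thesis
            using s0[of m] by (simp add: abs_divide power_divide power3_eq_cube field_simps)
        qed
        also have "real (K m) * norm (iexp ?y - (1 + \<i> * of_real ?y) + of_real (?y\<^sup>2 / 2)) =
            norm (A m x + of_real ((\<zeta> m x)\<^sup>2 / 2))"
        proof -
          have "real (K m) * ?y\<^sup>2 = (\<zeta> m x)\<^sup>2" using K0[of m] by (simp add: power_divide)
          then have "of_real ((\<zeta> m x)\<^sup>2 / 2) = (of_nat (K m) * of_real (?y\<^sup>2 / 2) :: complex)"
            by (metis (no_types) of_real_mult of_real_of_nat_eq times_divide_eq_right)
          then have "A m x + of_real ((\<zeta> m x)\<^sup>2 / 2) = of_nat (K m) * (iexp ?y - (1 + \<i> * of_real ?y) +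
                of_real (?y\<^sup>2 / 2))"
            unfolding A_def by (simp only: distrib_left)
          then show ?thesis by (simp only: norm_mult norm_of_nat)
        qed
        finally show "norm (A m x + of_real ((\<zeta> m x)\<^sup>2 / 2)) \<le> \<bar>\<zeta> m x\<bar> ^ 3 / 6 / ?s m" .
      next
        have "(\<lambda>m. \<bar>\<zeta> m x\<bar> ^ 3 / 6) \<longlonglongrightarrow> \<bar>z x\<bar> ^ 3 / 6"
          by (intro tendsto_intros elim) simp
        moreover have "filterlim ?s at_top sequentially"
          by (rule filterlim_compose[OF sqrt_at_top filterlim_compose[OF filterlim_real_sequentially K]])
        ultimately show "(\<lambda>m. \<bar>\<zeta> m x\<bar> ^ 3 / 6 / ?s m) \<longlonglongrightarrow> 0"
          by (rule real_tendsto_divide_at_top)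
      qed
      moreover have "(\<lambda>m. complex_of_real ((\<zeta> m x)\<^sup>2 / 2)) \<longlonglongrightarrow> of_real ((z x)\<^sup>2 / 2)"
        by (intro tendsto_intros elim) simp
      ultimately have "(\<lambda>m. (A m x + of_real ((\<zeta> m x)\<^sup>2 / 2)) - of_real ((\<zeta> m x)\<^sup>2 / 2)) \<longlonglongrightarrow>
            0 - of_real ((z x)\<^sup>2 / 2)"
        by (rule tendsto_diff)
      then show ?case by simp
    qed
    show "AE x in M. norm (A m x) \<le> (w x)\<^sup>2 / 2" for m
      using dom[of m]
    proof eventually_elim
      case (elim x)
      have "(\<zeta> m x)\<^sup>2 \<le> (w x)\<^sup>2" using elim by (metis abs_ge_zero power2_abs power_mono)
      then show ?case using A_bound[of m x] by simp
    qed
  qed (use w2 in auto)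
  then have A: "(\<lambda>m. integral\<^sup>L M (A m)) \<longlonglongrightarrow> - of_real (expectation (\<lambda>x. (z x)\<^sup>2) / 2)"
    unfolding integral_complex_of_real by simp
  have eq: "of_nat (K m) * (?\<phi> m - 1) = integral\<^sup>L M (A m) + \<i> * of_real (?s m * expectation (\<zeta> m))" for m
  proof -
    have int: "integrable M (\<lambda>x. 1 + \<i> * complex_of_real (\<zeta> m x / ?s m))"
      using int_\<zeta>[of m] by simp
    have "integral\<^sup>L M (A m) = of_nat (K m) * (\<integral>x. iexp (\<zeta> m x / ?s m) - (1 + \<i> * of_real (\<zeta> m x / ?s m)) \<partial>M)"
      unfolding A_def by (rule integral_mult_right_zero)
    also have "(\<integral>x. iexp (\<zeta> m x / ?s m) - (1 + \<i> * of_real (\<zeta> m x / ?s m)) \<partial>M) =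
        ?\<phi> m - (\<integral>x. 1 + \<i> * complex_of_real (\<zeta> m x / ?s m) \<partial>M)"
      by (rule Bochner_Integration.integral_diff[OF int_iexp int])
    also have "(\<integral>x. 1 + \<i> * complex_of_real (\<zeta> m x / ?s m) \<partial>M) = 1 + \<i> * of_real (expectation (\<zeta> m) / ?s m)"
    proof -
      have "(\<integral>x. 1 + \<i> * complex_of_real (\<zeta> m x / ?s m) \<partial>M) = (\<integral>x. 1 \<partial>M) + (\<integral>x. \<i> * complex_of_real
            (\<zeta> m x / ?s m) \<partial>M)"
        using int_\<zeta>[of m] by (intro Bochner_Integration.integral_add) auto
      also have "(\<integral>x. \<i> * complex_of_real (\<zeta> m x / ?s m) \<partial>M) = \<i> * of_real (expectation (\<zeta> m) / ?s m)"
        by (simp only: integral_mult_right_zero integral_complex_of_real integral_divide_zero)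
      finally show ?thesis by (simp add: prob_space)
    qed
    finally have "integral\<^sup>L M (A m) = of_nat (K m) * (?\<phi> m - (1 + \<i> * of_real (expectation (\<zeta> m) / ?s m)))" .
    moreover have "of_nat (K m) * (\<i> * of_real (expectation (\<zeta> m) / ?s m)) =
          \<i> * of_real (?s m * expectation (\<zeta> m))"
    proof -
      have "real (K m) * (expectation (\<zeta> m) / ?s m) = ?s m * expectation (\<zeta> m)"
        using s0[of m] by (simp add: field_simps flip: mult.assoc)
      then have "of_nat (K m) * complex_of_real (expectation (\<zeta> m) / ?s m) = of_real (?s m * expectation (\<zeta> m))"
        by (metis (no_types) of_real_mult of_real_of_nat_eq)
      then show ?thesis by (simp only: mult.left_commute)
    qed
    ultimately show ?thesis
      by (simp only: right_diff_distrib distrib_left) simp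
  qed
  show "(\<lambda>m. of_nat (K m) * (?\<phi> m - 1)) \<longlonglongrightarrow> \<i> * of_real \<beta> - of_real (expectation (\<lambda>x. (z x)\<^sup>2) / 2)"
    unfolding eq using tendsto_add[OF A tendsto_mult[OF tendsto_const[of \<i>] tendsto_of_real[OF mean]]]
    by (simp add: add.commute)
qed

lemma abs_exp_minus_one_le: "\<bar>exp x - 1\<bar> \<le> \<bar>x\<bar> * exp \<bar>x\<bar>" for x :: real
proof (cases "0 \<le> x")
  case True
  have "1 - x \<le> exp (- x)" using exp_ge_add_one_self[of "- x"] by simp
  then have "(1 - x) * exp x \<le> exp (- x) * exp x" by (rule mult_right_mono) simp
  then have "exp x - 1 \<le> x * exp x" by (simp add: algebra_simps flip: exp_add)
  then show ?thesis using True by simp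
next
  case False
  have "1 - exp x \<le> - x" using exp_ge_add_one_self[of x] by linarith
  also have "\<dots> \<le> - x * exp (- x)" using False by (simp add: mult_le_cancel_left1)
  finally show ?thesis using False by simp
qed

section \<open>Tilted exponential moments and the limiting characteristic function\<close>

lemma integrable_expo_moment: "l < 1 \<Longrightarrow> integrable expo (\<lambda>x. exp (l * x) * x ^ m)"
  using has_bochner_integral_expo_moment by (auto simp: has_bochner_integral_iff)

text \<open>The combination of \<open>g_fun r 0\<close> and \<open>g_fun r 1\<close> with
  coefficients \<open>a\<close>, \<open>b\<close>, evaluated at \<open>exp y\<close>: a projection
  of the statistic on the logarithmic scale.\<close>

definition tilt :: "real \<Rightarrow> real \<Rightarrow> real \<Rightarrow> real \<Rightarrow> real" where
  "tilt r a b y = exp (r * y) * (a + b * y)"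

lemma tilt_measurable[measurable]: "tilt r a b \<in> borel_measurable borel"
  unfolding tilt_def[abs_def] by measurable

lemma tilt_derivative: "(tilt r a b has_real_derivative exp (r * y) * (r * (a + b * y) + b)) (at y)"
  unfolding tilt_def by (auto intro!: derivative_eq_intros simp: algebra_simps)

text \<open>An estimate linear in the perturbation, with a factor growing only like
  \<open>exp (r * y)\<close> times an affine function of \<open>\<bar>y\<bar>\<close>; it supplies
  the majorant for the bias.\<close>

lemma tilt_diff_bound:
  assumes "\<bar>d\<bar> \<le> 1"
  shows "\<bar>tilt r a b (y + d) - tilt r a b y\<bar> \<le> \<bar>d\<bar> * (exp (r * y) * (\<bar>r\<bar> * exp \<bar>r\<bar> * (\<bar>a\<bar> + \<bar>b\<bar> *
        (\<bar>y\<bar> + 1)) + \<bar>b\<bar>))"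
proof -
  have eq: "tilt r a b (y + d) - tilt r a b y = exp (r * y) * ((exp (r * d) - 1) * (a + b * (y + d)) + b * d)"
    by (simp add: tilt_def algebra_simps exp_add)
  have "\<bar>r * d\<bar> \<le> \<bar>r\<bar>" using assms by (simp add: abs_mult mult_left_le)
  then have "\<bar>r * d\<bar> * exp \<bar>r * d\<bar> \<le> \<bar>r * d\<bar> * exp \<bar>r\<bar>" by (intro mult_left_mono) auto
  then have 1: "\<bar>exp (r * d) - 1\<bar> \<le> \<bar>d\<bar> * (\<bar>r\<bar> * exp \<bar>r\<bar>)"
    using abs_exp_minus_one_le[of "r * d"] by (simp add: abs_mult mult_ac)
  have "\<bar>a + b * (y + d)\<bar> \<le> \<bar>a\<bar> + \<bar>b\<bar> * \<bar>y + d\<bar>"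
    using abs_triangle_ineq[of a "b * (y + d)"] by (simp add: abs_mult)
  also have "\<dots> \<le> \<bar>a\<bar> + \<bar>b\<bar> * (\<bar>y\<bar> + 1)"
    using assms abs_triangle_ineq[of y d] by (intro add_left_mono mult_left_mono) auto
  finally have "\<bar>(exp (r * d) - 1) * (a + b * (y + d))\<bar> \<le> (\<bar>d\<bar> * (\<bar>r\<bar> * exp \<bar>r\<bar>)) * (\<bar>a\<bar> + \<bar>b\<bar> * (\<bar>y\<bar> + 1))"
    unfolding abs_mult by (intro mult_mono 1) auto
  then have "\<bar>(exp (r * d) - 1) * (a + b * (y + d)) + b * d\<bar> \<le> (\<bar>d\<bar> * (\<bar>r\<bar> * exp \<bar>r\<bar>)) * (\<bar>a\<bar> + \<bar>b\<bar> *
        (\<bar>y\<bar> + 1)) + \<bar>b\<bar> * \<bar>d\<bar>"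
    using abs_triangle_ineq[of "(exp (r * d) - 1) * (a + b * (y + d))" "b * d"] by (simp add: abs_mult)
  then have "\<bar>tilt r a b (y + d) - tilt r a b y\<bar> \<le> exp (r * y) * ((\<bar>d\<bar> * (\<bar>r\<bar> * exp \<bar>r\<bar>)) * (\<bar>a\<bar> + \<bar>b\<bar> *
        (\<bar>y\<bar> + 1)) + \<bar>b\<bar> * \<bar>d\<bar>)"
    unfolding eq abs_mult[of "exp _"] abs_exp_cancel by (intro mult_left_mono) auto
  also have "\<dots> = \<bar>d\<bar> * (exp (r * y) * (\<bar>r\<bar> * exp \<bar>r\<bar> * (\<bar>a\<bar> + \<bar>b\<bar> * (\<bar>y\<bar> + 1)) + \<bar>b\<bar>))"
    by (simp add: algebra_simps)
  finally show ?thesis .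
qed

text \<open>The value is \<open>a * xi \<gamma> r 0 + b * xi \<gamma> r 1\<close>, the centring of
  the statistic.\<close>

lemma tilt_mean:
  assumes "\<gamma> * r < 1"
  shows "has_bochner_integral expo (\<lambda>x. tilt r a b (\<gamma> * x)) (a / (1 - \<gamma> * r) + b * \<gamma> / (1 - \<gamma> * r)\<^sup>2)"
proof -
  let ?p = "\<gamma> * r"
  have "has_bochner_integral expo (\<lambda>x. a * (exp (?p * x) * x ^ 0) + b * \<gamma> * (exp (?p * x) * x ^ 1))
     (a * (fact 0 / (1 - ?p) ^ (0 + 1)) + b * \<gamma> * (fact 1 / (1 - ?p) ^ (1 + 1)))"
    by (intro has_bochner_integral_add has_bochner_integral_mult_right has_bochner_integral_expo_moment assms)
  moreover have "(\<lambda>x. a * (exp (?p * x) * x ^ 0) + b * \<gamma> * (exp (?p * x) * x ^ 1)) = (\<lambda>x. tilt r a b (\<gamma> * x))"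
    by (simp add: fun_eq_iff tilt_def algebra_simps)
  ultimately show ?thesis by (simp add: power2_eq_square)
qed

text \<open>\<open>x\<close> and \<open>y\<close> are the reciprocals of \<open>d_r(2)\<close> and
  \<open>d_r(1)\<close>. In these variables the variance is polynomial, which leaves an identity of
  polynomials to check.\<close>

lemma tilt_variance:
  assumes "\<gamma> * r < 1 / 2"
  defines "x \<equiv> inverse (1 - 2 * (\<gamma> * r))" and "y \<equiv> inverse (1 - \<gamma> * r)"
  shows "integral\<^sup>L expo (\<lambda>t. (tilt r a b (\<gamma> * t) - (a / (1 - \<gamma> * r) + b * \<gamma> / (1 - \<gamma> * r)\<^sup>2))\<^sup>2) =
    a\<^sup>2 * (x - y\<^sup>2) + 2 * a * b * (\<gamma> * x\<^sup>2 - \<gamma> * y ^ 3) + b\<^sup>2 * (2 * \<gamma>\<^sup>2 * x ^ 3 - \<gamma>\<^sup>2 * y ^ 4)"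
proof -
  let ?p = "\<gamma> * r" and ?q = "2 * (\<gamma> * r)"
  have p: "?p < 1" "?q < 1" using assms by auto
  define c where "c = a * y + b * \<gamma> * y\<^sup>2"
  have c: "a / (1 - \<gamma> * r) + b * \<gamma> / (1 - \<gamma> * r)\<^sup>2 = c"
    by (simp add: c_def y_def divide_inverse power_inverse)
  have "has_bochner_integral expo
    (\<lambda>t. a\<^sup>2 * (exp (?q * t) * t ^ 0) + 2 * a * b * \<gamma> * (exp (?q * t) * t ^ 1) + b\<^sup>2 * \<gamma>\<^sup>2 *
          (exp (?q * t) * t ^ 2)
      + c\<^sup>2 * (exp (0 * t) * t ^ 0) - 2 * c * tilt r a b (\<gamma> * t))
    (a\<^sup>2 * (fact 0 / (1 - ?q) ^ (0 + 1)) + 2 * a * b * \<gamma> * (fact 1 / (1 - ?q) ^ (1 + 1)) + b\<^sup>2 * \<gamma>\<^sup>2 *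
          (fact 2 / (1 - ?q) ^ (2 + 1))
      + c\<^sup>2 * (fact 0 / (1 - 0) ^ (0 + 1)) - 2 * c * c)"
    using tilt_mean[OF p(1), of a b] unfolding c
    by (intro has_bochner_integral_add has_bochner_integral_diff has_bochner_integral_mult_right
          has_bochner_integral_expo_moment p) auto
  moreover have "(\<lambda>t. a\<^sup>2 * (exp (?q * t) * t ^ 0) + 2 * a * b * \<gamma> * (exp (?q * t) * t ^ 1) + b\<^sup>2 * \<gamma>\<^sup>2 *
        (exp (?q * t) * t ^ 2)
      + c\<^sup>2 * (exp (0 * t) * t ^ 0) - 2 * c * tilt r a b (\<gamma> * t)) = (\<lambda>t. (tilt r a b (\<gamma> * t) - c)\<^sup>2)"
  proof
    fix t :: real
    have "exp (?q * t) = (exp (r * (\<gamma> * t)))\<^sup>2"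
      by (simp add: power2_eq_square mult_ac flip: exp_add)
    then show "a\<^sup>2 * (exp (?q * t) * t ^ 0) + 2 * a * b * \<gamma> * (exp (?q * t) * t ^ 1) + b\<^sup>2 * \<gamma>\<^sup>2 *
          (exp (?q * t) * t ^ 2)
      + c\<^sup>2 * (exp (0 * t) * t ^ 0) - 2 * c * tilt r a b (\<gamma> * t) = (tilt r a b (\<gamma> * t) - c)\<^sup>2"
      by (simp add: tilt_def power2_eq_square algebra_simps)
  qed
  moreover have "a\<^sup>2 * (fact 0 / (1 - ?q) ^ (0 + 1)) + 2 * a * b * \<gamma> * (fact 1 / (1 - ?q) ^ (1 + 1)) +
        b\<^sup>2 * \<gamma>\<^sup>2 * (fact 2 / (1 - ?q) ^ (2 + 1))
      + c\<^sup>2 * (fact 0 / (1 - 0) ^ (0 + 1)) - 2 * c * c = 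
      a\<^sup>2 * x + 2 * a * b * \<gamma> * x\<^sup>2 + b\<^sup>2 * \<gamma>\<^sup>2 * (2 * x ^ 3) - c\<^sup>2"
    by (simp add: x_def divide_inverse power_inverse power2_eq_square eval_nat_numeral)
  moreover have "a\<^sup>2 * x + 2 * a * b * \<gamma> * x\<^sup>2 + b\<^sup>2 * \<gamma>\<^sup>2 * (2 * x ^ 3) - c\<^sup>2 =
      a\<^sup>2 * (x - y\<^sup>2) + 2 * a * b * (\<gamma> * x\<^sup>2 - \<gamma> * y ^ 3) + b\<^sup>2 * (2 * \<gamma>\<^sup>2 * x ^ 3 - \<gamma>\<^sup>2 * y ^ 4)"
    unfolding c_def by algebra
  ultimately show ?thesis
    unfolding c by (simp only: has_bochner_integral_iff)
qed

text \<open>The first-order effect of the deviation: the limit \<psi> of \<open>dev / a\<close>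
  integrated against the derivative of \<open>tilt\<close> at \<open>\<gamma> * x\<close>. The
  coefficients of \<open>a\<close> and \<open>b\<close> are the two biases \<nu> of the
  theorem.\<close>

lemma tilt_bias:
  assumes "\<gamma> * r < 1" and \<rho>: "\<rho> < 0"
  defines "d \<equiv> 1 - \<gamma> * r"
  shows "has_bochner_integral expo (\<lambda>x. (exp (\<rho> * x) - 1) / \<rho> * (exp (r * (\<gamma> * x)) *
        (r * (a + b * (\<gamma> * x)) + b)))
    (a * (r / (d * (d - \<rho>))) + b * ((1 - \<rho> - \<gamma>\<^sup>2 * r\<^sup>2) / (d\<^sup>2 * (d - \<rho>)\<^sup>2)))"
proof -
  let ?p = "\<gamma> * r"
  \<comment> \<open>The affine factor of the derivative is \<open>A + B * x\<close>.\<close>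
  define A where "A = r * a + b"
  define B where "B = b * ?p"
  define e where "e = d - \<rho>"
  have d: "d > 0" "e > 0" using assms by (auto simp: d_def e_def)
  have l: "?p < 1" "?p + \<rho> < 1" using assms by auto
  have de: "1 - ?p = d" "1 - (?p + \<rho>) = e" by (simp_all add: d_def e_def)
  have "has_bochner_integral expo
     (\<lambda>x. A / \<rho> * (exp ((?p + \<rho>) * x) * x ^ 0) + B / \<rho> * (exp ((?p + \<rho>) * x) * x ^ 1)
        - A / \<rho> * (exp (?p * x) * x ^ 0) - B / \<rho> * (exp (?p * x) * x ^ 1))
     (A / \<rho> * (fact 0 / (1 - (?p + \<rho>)) ^ (0 + 1)) + B / \<rho> * (fact 1 / (1 - (?p + \<rho>)) ^ (1 + 1))
        - A / \<rho> * (fact 0 / (1 - ?p) ^ (0 + 1)) - B / \<rho> * (fact 1 / (1 - ?p) ^ (1 + 1)))"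
    by (intro has_bochner_integral_add has_bochner_integral_diff has_bochner_integral_mult_right
          has_bochner_integral_expo_moment l)
  moreover have "(\<lambda>x. A / \<rho> * (exp ((?p + \<rho>) * x) * x ^ 0) + B / \<rho> * (exp ((?p + \<rho>) * x) * x ^ 1)
        - A / \<rho> * (exp (?p * x) * x ^ 0) - B / \<rho> * (exp (?p * x) * x ^ 1)) =
      (\<lambda>x. (exp (\<rho> * x) - 1) / \<rho> * (exp (r * (\<gamma> * x)) * (r * (a + b * (\<gamma> * x)) + b)))"
  proof
    fix x :: real
    have "exp ((?p + \<rho>) * x) = exp (r * (\<gamma> * x)) * exp (\<rho> * x)"
      by (simp add: algebra_simps flip: exp_add)
    moreover have "exp (?p * x) = exp (r * (\<gamma> * x))"
      by (simp add: mult_ac)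
    ultimately show "A / \<rho> * (exp ((?p + \<rho>) * x) * x ^ 0) + B / \<rho> * (exp ((?p + \<rho>) * x) * x ^ 1)
        - A / \<rho> * (exp (?p * x) * x ^ 0) - B / \<rho> * (exp (?p * x) * x ^ 1) =
      (exp (\<rho> * x) - 1) / \<rho> * (exp (r * (\<gamma> * x)) * (r * (a + b * (\<gamma> * x)) + b))"
      using \<rho> by (simp add: A_def B_def divide_simps) (simp add: algebra_simps)
  qed
  moreover have "A / \<rho> * (fact 0 / (1 - (?p + \<rho>)) ^ (0 + 1)) + B / \<rho> * (fact 1 / (1 - (?p + \<rho>)) ^ (1 + 1))
        - A / \<rho> * (fact 0 / (1 - ?p) ^ (0 + 1)) - B / \<rho> * (fact 1 / (1 - ?p) ^ (1 + 1)) =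
      a * (r / (d * e)) + b * ((1 - \<rho> - \<gamma>\<^sup>2 * r\<^sup>2) / (d\<^sup>2 * e\<^sup>2))"
  proof -
    have 1: "1 / \<rho> * (1 / e - 1 / d) = 1 / (d * e)"
      using d \<rho> by (simp add: divide_simps) (simp add: e_def)
    have 2: "1 / \<rho> * (1 / e\<^sup>2 - 1 / d\<^sup>2) = (2 * d - \<rho>) / (d\<^sup>2 * e\<^sup>2)"
      using d \<rho> by (simp add: divide_simps) (simp add: e_def power2_eq_square algebra_simps)
    \<comment> \<open>Decomposes the numerator of the second bias: \<open>d * e\<close> comes from
      the constant summand \<open>b\<close> in \<open>A\<close>, the remaining term from the slope
      \<open>B\<close>.\<close>
    have "1 - \<rho> - \<gamma>\<^sup>2 * r\<^sup>2 = d * e + ?p * (2 * d - \<rho>)"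
      by (simp add: d_def e_def power2_eq_square algebra_simps)
    then have 3: "(1 - \<rho> - \<gamma>\<^sup>2 * r\<^sup>2) / (d\<^sup>2 * e\<^sup>2) = 1 / (d * e) + ?p * ((2 * d - \<rho>) / (d\<^sup>2 * e\<^sup>2))"
      using d by (simp add: add_divide_distrib power2_eq_square)
    have "A / \<rho> * (fact 0 / (1 - (?p + \<rho>)) ^ (0 + 1)) + B / \<rho> * (fact 1 / (1 - (?p + \<rho>)) ^ (1 + 1))
        - A / \<rho> * (fact 0 / (1 - ?p) ^ (0 + 1)) - B / \<rho> * (fact 1 / (1 - ?p) ^ (1 + 1)) =
        A * (1 / \<rho> * (1 / e - 1 / d)) + B * (1 / \<rho> * (1 / e\<^sup>2 - 1 / d\<^sup>2))"
      unfolding de by (simp add: right_diff_distrib power2_eq_square)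
    also have "\<dots> = a * (r / (d * e)) + b * ((1 - \<rho> - \<gamma>\<^sup>2 * r\<^sup>2) / (d\<^sup>2 * e\<^sup>2))"
      unfolding 1 2 3 A_def B_def by (simp add: algebra_simps add_divide_distrib)
    finally show ?thesis .
  qed
  ultimately show ?thesis by (simp add: e_def)
qed

text \<open>The variance is left as an integral of a square; its closed form enters only once the
  Gaussian law is named.\<close>

definition limit_char :: "real \<Rightarrow> real \<Rightarrow> real \<Rightarrow> real \<Rightarrow> real \<Rightarrow> real \<Rightarrow> complex" where
  "limit_char \<gamma> \<rho> r \<mu> a b =
    exp (\<i> * of_real (\<mu> * (a * (r / ((1 - \<gamma> * r) * (1 - \<gamma> * r - \<rho>))) +
          b * ((1 - \<rho> - \<gamma>\<^sup>2 * r\<^sup>2) / ((1 - \<gamma> * r)\<^sup>2 * (1 - \<gamma> * r - \<rho>)\<^sup>2))))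
      - of_real (integral\<^sup>L expo
          (\<lambda>x. (tilt r a b (\<gamma> * x) - (a / (1 - \<gamma> * r) + b * \<gamma> / (1 - \<gamma> * r)\<^sup>2))\<^sup>2) / 2))"

context second_order_regular
begin

lemma ratio_eq_exp:
  assumes "0 < u t" "0 \<le> x"
  shows "a0 * g_fun r 0 (u (t + x) / u t) + b0 * g_fun r 1 (u (t + x) / u t) = tilt r a0 b0 (\<gamma> * x + dev t x)"
proof -
  have "0 < u (t + x)" using assms monoD[OF mono_u, of t "t + x"] by simp
  then have "ln (u (t + x) / u t) = \<gamma> * x + dev t x" "u (t + x) / u t \<noteq> 0"
    using assms by (simp_all add: ln_div dev_def)
  then show ?thesis
    unfolding g_fun_def tilt_def powr_def by (simp only: if_False) (simp add: algebra_simps)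
qed

text \<open>For a deterministic threshold sequence the perturbation of the summand is
  \<open>a (t m)\<close> times \<psi> times the derivative of \<open>tilt\<close>, to first order.
  It vanishes in the variance, but multiplied by \<open>sqrt K\<close> its mean has a limit
  proportional to \<mu>. The uniform bound on \<open>dev\<close> dominates both passages to the
  limit.\<close>

lemma char_tendsto:
  fixes K :: "nat \<Rightarrow> nat" and t :: "nat \<Rightarrow> real" and a0 b0 r :: real
  assumes r: "\<gamma> * r < 1 / 2" and K: "filterlim K at_top sequentially" and t: "filterlim t at_top sequentially"
    and \<mu>: "(\<lambda>m. sqrt (real (K m)) * a (t m)) \<longlonglongrightarrow> \<mu>"
  defines "c \<equiv> a0 / (1 - \<gamma> * r) + b0 * \<gamma> / (1 - \<gamma> * r)\<^sup>2"
  shows "(\<lambda>m. (\<integral>x. iexp ((a0 * g_fun r 0 (u (t m + x) / u (t m)) + b0 * g_fun r 1 (u (t m + x) / u (t m))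
        - c) / sqrt (real (K m))) \<partial>expo) ^ K m) \<longlonglongrightarrow>
    limit_char \<gamma> \<rho> r \<mu> a0 b0"
proof -
  define d where "d = 1 - \<gamma> * r"
  obtain C t0 where C: "C \<ge> 0" "\<And>t s. t \<ge> t0 \<Longrightarrow> s \<ge> 0 \<Longrightarrow> \<bar>dev t s\<bar> \<le> C * \<bar>a t\<bar>"
    using dev_bounded by blast
  have at: "(\<lambda>m. a (t m)) \<longlonglongrightarrow> 0" by (rule filterlim_compose[OF a_tendsto t])
  have "(\<lambda>m. C * \<bar>a (t m)\<bar>) \<longlonglongrightarrow> C * \<bar>0\<bar>" by (intro tendsto_intros at)
  then have "\<forall>\<^sub>F m in sequentially. C * \<bar>a (t m)\<bar> < 1" by (rule order_tendstoD) simp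
  moreover have "\<forall>\<^sub>F m in sequentially. t0 \<le> t m" using t by (simp add: filterlim_at_top)
  moreover have "\<forall>\<^sub>F m in sequentially. 0 < u (t m)" by (rule eventually_compose_filterlim[OF u_pos t])
  moreover have "\<forall>\<^sub>F m in sequentially. 1 \<le> K m" using K by (simp only: filterlim_at_top)
  moreover have "\<forall>\<^sub>F m in sequentially. a (t m) \<noteq> 0" by (rule eventually_compose_filterlim[OF a_nonzero t])
  moreover have "\<forall>\<^sub>F m in sequentially. \<bar>sqrt (real (K m)) * a (t m)\<bar> < \<bar>\<mu>\<bar> + 1"
    using tendsto_rabs[OF \<mu>] by (rule order_tendstoD) simp
  ultimately have "\<forall>\<^sub>F m in sequentially. C * \<bar>a (t m)\<bar> < 1 \<and> t0 \<le> t m \<and> 0 < u (t m) \<and> 1 \<le> K m \<and> a (t m) \<noteq> 0 \<and>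
      \<bar>sqrt (real (K m)) * a (t m)\<bar> < \<bar>\<mu>\<bar> + 1"
    by eventually_elim simp
  then obtain m0 where m0: "\<And>m. m \<ge> m0 \<Longrightarrow> C * \<bar>a (t m)\<bar> < 1 \<and> t0 \<le> t m \<and> 0 < u (t m) \<and> 1 \<le> K m \<and> a (t m) \<noteq> 0 \<and>
      \<bar>sqrt (real (K m)) * a (t m)\<bar> < \<bar>\<mu>\<bar> + 1"
    by (auto simp: eventually_sequentially)
  \<comment> \<open>Finitely many terms are dropped so that all eventual bounds hold for every
    index, as the dominated convergence arguments require.\<close>
  define T where "T m = t (m + m0)" for m
  define J where "J m = K (m + m0)" for m
  have T: "C * \<bar>a (T m)\<bar> < 1" "t0 \<le> T m" "0 < u (T m)" "1 \<le> J m" "a (T m) \<noteq> 0" "\<bar>sqrt (real (J m)) *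
        a (T m)\<bar> < \<bar>\<mu>\<bar> + 1" for m
    using m0[of "m + m0"] by (auto simp: T_def J_def)
  have T_top: "filterlim T at_top sequentially" and J_top: "filterlim J at_top sequentially"
    unfolding T_def[abs_def] J_def[abs_def]
    by (rule filterlim_compose[OF t filterlim_add_const_nat_at_top], rule filterlim_compose[OF K
          filterlim_add_const_nat_at_top])
  have \<mu>': "(\<lambda>m. sqrt (real (J m)) * a (T m)) \<longlonglongrightarrow> \<mu>"
    unfolding T_def J_def using LIMSEQ_ignore_initial_segment[OF \<mu>, of m0] by simp
  have aT: "(\<lambda>m. a (T m)) \<longlonglongrightarrow> 0" by (rule filterlim_compose[OF a_tendsto T_top])
  have dev_bound: "\<bar>dev (T m) x\<bar> \<le> C * \<bar>a (T m)\<bar>" if "0 \<le> x" for m x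
    using C(2)[OF T(2) that] .
  \<comment> \<open>A nonnegative exponent above \<open>\<gamma> * r\<close> for which
    \<open>2 * \<kappa> < 1\<close>: the majorant \<open>e\<close> is then at least 1 and absorbs
    constants, also for negative \<open>r\<close>, while its square stays integrable.\<close>
  define \<kappa> where "\<kappa> = max 0 (\<gamma> * r)"
  have \<kappa>: "2 * \<kappa> < 1" "0 \<le> \<kappa>" "\<gamma> * r \<le> \<kappa>" using r by (auto simp: \<kappa>_def)
  define C0 where "C0 = \<bar>a0\<bar> + \<bar>b0\<bar> * \<bar>\<gamma>\<bar>"
  define C1 where "C1 = \<bar>r\<bar> * exp \<bar>r\<bar> * (\<bar>a0\<bar> + \<bar>b0\<bar> * (\<bar>\<gamma>\<bar> + 1)) + \<bar>b0\<bar>"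
  have C01: "0 \<le> C0" "0 \<le> C1" by (auto simp: C0_def C1_def)
  define e where "e x = (1 + x) * exp (\<kappa> * x)" for x :: real
  have e_ge: "1 \<le> e x" if "0 \<le> x" for x
    unfolding e_def using that \<kappa> mult_mono[of 1 "1 + x" 1 "exp (\<kappa> * x)"] by simp
  have exp_le: "exp (r * (\<gamma> * x)) \<le> exp (\<kappa> * x)" if "0 \<le> x" for x
    using mult_right_mono[OF \<kappa>(3) that] by (simp add: mult_ac)
  have tilt_bound: "\<bar>tilt r a0 b0 (\<gamma> * x)\<bar> \<le> C0 * e x" if x: "0 \<le> x" for x
  proof -
    have "\<bar>a0 + b0 * (\<gamma> * x)\<bar> \<le> \<bar>a0\<bar> + \<bar>b0\<bar> * \<bar>\<gamma>\<bar> * x"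
      using abs_triangle_ineq[of a0 "b0 * (\<gamma> * x)"] x by (simp add: abs_mult mult.assoc)
    also have "\<dots> \<le> C0 * (1 + x)" using x by (simp add: C0_def algebra_simps)
    finally have "\<bar>tilt r a0 b0 (\<gamma> * x)\<bar> \<le> exp (\<kappa> * x) * (C0 * (1 + x))"
      unfolding tilt_def abs_mult abs_exp_cancel by (intro mult_mono exp_le x) auto
    then show ?thesis by (simp add: e_def mult_ac)
  qed
  have diff_bound: "\<bar>tilt r a0 b0 (\<gamma> * x + dev (T m) x) - tilt r a0 b0 (\<gamma> * x)\<bar> \<le> C * \<bar>a (T m)\<bar> *
        (C1 * e x)" if x: "0 \<le> x" for m x
  proof -
    have small: "\<bar>dev (T m) x\<bar> \<le> 1" using dev_bound[OF x, of m] T(1)[of m] by linarith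
    let ?E = "\<bar>r\<bar> * exp \<bar>r\<bar> * (\<bar>a0\<bar> + \<bar>b0\<bar> * (\<bar>\<gamma> * x\<bar> + 1)) + \<bar>b0\<bar>"
    have "\<bar>a0\<bar> + \<bar>b0\<bar> * (\<bar>\<gamma> * x\<bar> + 1) \<le> (\<bar>a0\<bar> + \<bar>b0\<bar> * (\<bar>\<gamma>\<bar> + 1)) * (1 + x)"
      using x by (simp add: abs_mult algebra_simps)
    then have "\<bar>r\<bar> * exp \<bar>r\<bar> * (\<bar>a0\<bar> + \<bar>b0\<bar> * (\<bar>\<gamma> * x\<bar> + 1)) \<le> \<bar>r\<bar> * exp \<bar>r\<bar> * ((\<bar>a0\<bar> + \<bar>b0\<bar> * (\<bar>\<gamma>\<bar> + 1))
          * (1 + x))"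
      by (intro mult_left_mono) auto
    moreover have "\<bar>b0\<bar> \<le> \<bar>b0\<bar> * (1 + x)" using x by (simp add: algebra_simps)
    ultimately have E: "?E \<le> C1 * (1 + x)" unfolding C1_def by (simp only: distrib_right mult.assoc)
    have "\<bar>tilt r a0 b0 (\<gamma> * x + dev (T m) x) - tilt r a0 b0 (\<gamma> * x)\<bar> \<le> \<bar>dev (T m) x\<bar> *
          (exp (r * (\<gamma> * x)) * ?E)"
      by (rule tilt_diff_bound[OF small])
    also have "\<dots> \<le> (C * \<bar>a (T m)\<bar>) * (exp (\<kappa> * x) * (C1 * (1 + x)))"
      using C(1) x by (intro mult_mono dev_bound exp_le E) (auto intro!: mult_nonneg_nonneg add_nonneg_nonneg)
    finally show ?thesis by (simp add: e_def mult_ac)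
  qed
  define G where "G m x = tilt r a0 b0 (\<gamma> * x + dev (T m) x)" for m x
  have G_meas[measurable]: "G m \<in> borel_measurable borel" for m
    unfolding G_def by measurable
  have e_meas[measurable]: "e \<in> borel_measurable borel" unfolding e_def by measurable
  have e_int: "integrable expo e"
  proof -
    have "integrable expo (\<lambda>x. exp (\<kappa> * x) * x ^ 0 + exp (\<kappa> * x) * x ^ 1)"
      using \<kappa> by (intro Bochner_Integration.integrable_add integrable_expo_moment) auto
    then show ?thesis by (simp add: e_def[abs_def] algebra_simps)
  qed
  have e2_int: "integrable expo (\<lambda>x. (C * (e x))\<^sup>2)" for C
  proof -
    have "integrable expo (\<lambda>x. C\<^sup>2 * (exp (2 * \<kappa> * x) * x ^ 0) + (2 * C\<^sup>2) * (exp (2 * \<kappa> * x) * x ^ 1) +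
          C\<^sup>2 * (exp (2 * \<kappa> * x) * x ^ 2))"
      using \<kappa> by (intro Bochner_Integration.integrable_add integrable_mult_right integrable_expo_moment) auto
    moreover have "C\<^sup>2 * (exp (2 * \<kappa> * x) * x ^ 0) + (2 * C\<^sup>2) * (exp (2 * \<kappa> * x) * x ^ 1) + C\<^sup>2 *
          (exp (2 * \<kappa> * x) * x ^ 2) = (C * e x)\<^sup>2" for x
    proof -
      have "exp (2 * \<kappa> * x) = (exp (\<kappa> * x))\<^sup>2" by (simp add: power2_eq_square flip: exp_add)
      then show ?thesis by (simp add: e_def power2_eq_square algebra_simps)
    qed
    ultimately show ?thesis by simp
  qed
  have mean0: "integrable expo (\<lambda>x. tilt r a0 b0 (\<gamma> * x))" "integral\<^sup>L expo (\<lambda>x. tilt r a0 b0 (\<gamma> * x)) = c"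
    using tilt_mean[of \<gamma> r a0 b0] r by (auto simp: has_bochner_integral_iff c_def)
  have dev_null: "(\<lambda>m. dev (T m) x) \<longlonglongrightarrow> 0" and dev_ratio: "(\<lambda>m. dev (T m) x / a (T m)) \<longlonglongrightarrow> \<psi> x" for x
  proof -
    show ratio: "(\<lambda>m. dev (T m) x / a (T m)) \<longlonglongrightarrow> \<psi> x" by (rule filterlim_compose[OF dev_tendsto T_top])
    have "(\<lambda>m. dev (T m) x / a (T m) * a (T m)) \<longlonglongrightarrow> \<psi> x * 0" by (intro tendsto_mult ratio aT)
    then show "(\<lambda>m. dev (T m) x) \<longlonglongrightarrow> 0" using T(5) by simp
  qed
  have G_lim: "(\<lambda>m. G m x) \<longlonglongrightarrow> tilt r a0 b0 (\<gamma> * x)" for x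
  proof -
    have "isCont (tilt r a0 b0) (\<gamma> * x)" by (rule DERIV_isCont[OF tilt_derivative])
    moreover have "(\<lambda>m. \<gamma> * x + dev (T m) x) \<longlonglongrightarrow> \<gamma> * x"
      using tendsto_add[OF tendsto_const[of "\<gamma> * x"] dev_null[of x]] by simp
    ultimately show ?thesis unfolding G_def by (rule isCont_tendsto_compose)
  qed
  define w where "w x = (C0 + C1 + \<bar>c\<bar>) * e x" for x
  have G_bound: "\<bar>G m x - c\<bar> \<le> w x" and G_bound': "\<bar>G m x\<bar> \<le> w x" if x: "0 \<le> x" for m x
  proof -
    have "C * \<bar>a (T m)\<bar> * (C1 * e x) \<le> 1 * (C1 * e x)"
      using T(1)[of m] C01 e_ge[OF x] by (intro mult_right_mono) auto
    then have 1: "\<bar>G m x - tilt r a0 b0 (\<gamma> * x)\<bar> \<le> C1 * e x"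
      using diff_bound[OF x, of m] unfolding G_def by linarith
    have 2: "\<bar>c\<bar> \<le> \<bar>c\<bar> * e x" using mult_left_mono[OF e_ge[OF x], of "\<bar>c\<bar>"] by simp
    have tri: "\<bar>p - c'\<bar> \<le> A + B + D" if "\<bar>p - q\<bar> \<le> B" "\<bar>q\<bar> \<le> A" "\<bar>c'\<bar> \<le> D" for p q c' A B D :: real
      using that by linarith
    show "\<bar>G m x - c\<bar> \<le> w x"
      unfolding w_def distrib_right by (rule tri[OF 1 tilt_bound[OF x] 2])
    show "\<bar>G m x\<bar> \<le> w x"
      using tri[OF 1 tilt_bound[OF x], of 0 "\<bar>c\<bar> * e x"] 2 unfolding w_def distrib_right by simp
  qed
  have w_int: "integrable expo w" unfolding w_def using e_int by simp
  have w_meas[measurable]: "w \<in> borel_measurable borel" unfolding w_def by measurable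
  have G_int: "integrable expo (G m)" for m
    by (rule Bochner_Integration.integrable_bound[OF w_int])
       (use AE_expo_nonneg in \<open>auto simp: measurable_expo elim!: eventually_mono dest!: G_bound'[of _ m]\<close>)
  have mean: "(\<lambda>m. sqrt (real (J m)) * integral\<^sup>L expo (\<lambda>x. G m x - c)) \<longlonglongrightarrow>
      \<mu> * (a0 * (r / (d * (d - \<rho>))) + b0 * ((1 - \<rho> - \<gamma>\<^sup>2 * r\<^sup>2) / (d\<^sup>2 * (d - \<rho>)\<^sup>2)))"
  proof -
    define G' where "G' x = exp (r * (\<gamma> * x)) * (r * (a0 + b0 * (\<gamma> * x)) + b0)" for x
    have [measurable]: "G' \<in> borel_measurable borel" unfolding G'_def by measurable
    have [measurable]: "\<psi> \<in> borel_measurable borel" unfolding \<psi>_def[abs_def] by measurable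
    have "(\<lambda>m. integral\<^sup>L expo (\<lambda>x. sqrt (real (J m)) * (G m x - tilt r a0 b0 (\<gamma> * x)))) \<longlonglongrightarrow>
          integral\<^sup>L expo (\<lambda>x. \<mu> * (\<psi> x * G' x))"
    proof (rule integral_dominated_convergence[where w = "\<lambda>x. (\<bar>\<mu>\<bar> + 1) * C * (C1 * e x)"])
      show "AE x in expo. (\<lambda>m. sqrt (real (J m)) * (G m x - tilt r a0 b0 (\<gamma> * x))) \<longlonglongrightarrow> \<mu> * (\<psi> x * G' x)"
      proof (rule AE_I2)
        fix x
        \<comment> \<open>Caratheodory's form of the derivative at \<open>\<gamma> * x\<close>
          again, so that a vanishing deviation needs no separate case.\<close>
        obtain h where h: "\<And>z. tilt r a0 b0 z - tilt r a0 b0 (\<gamma> * x) = h z * (z - \<gamma> * x)" "isCont h (\<gamma> *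
              x)" "h (\<gamma> * x) = G' x"
          using tilt_derivative[of r a0 b0 "\<gamma> * x"] unfolding CARAT_DERIV G'_def by blast
        have "(\<lambda>m. \<gamma> * x + dev (T m) x) \<longlonglongrightarrow> \<gamma> * x"
          using tendsto_add[OF tendsto_const[of "\<gamma> * x"] dev_null[of x]] by simp
        from isCont_tendsto_compose[OF h(2) this]
        have "(\<lambda>m. (sqrt (real (J m)) * a (T m)) * ((dev (T m) x / a (T m)) * h (\<gamma> * x + dev (T m) x))) \<longlonglongrightarrow>
              \<mu> * (\<psi> x * G' x)"
          unfolding h(3) by (intro tendsto_mult \<mu>' dev_ratio)
        moreover have "(sqrt (real (J m)) * a (T m)) * ((dev (T m) x / a (T m)) * h (\<gamma> * x + dev (T m) x)) =
            sqrt (real (J m)) * (G m x - tilt r a0 b0 (\<gamma> * x))" for m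
          unfolding G_def h(1) using T(5)[of m] by simp
        ultimately show "(\<lambda>m. sqrt (real (J m)) * (G m x - tilt r a0 b0 (\<gamma> * x))) \<longlonglongrightarrow> \<mu> * (\<psi> x * G' x)" by simp
      qed
      show "AE x in expo. norm (sqrt (real (J m)) * (G m x - tilt r a0 b0 (\<gamma> * x))) \<le> (\<bar>\<mu>\<bar> + 1) * C *
            (C1 * e x)" for m
        using AE_expo_nonneg
      proof eventually_elim
        case (elim x)
        have "norm (sqrt (real (J m)) * (G m x - tilt r a0 b0 (\<gamma> * x))) \<le> sqrt (real (J m)) *
              (C * \<bar>a (T m)\<bar> * (C1 * e x))"
          unfolding real_norm_def abs_mult G_def using diff_bound[OF elim, of m] by (intro mult_mono) auto
        also have "\<dots> = \<bar>sqrt (real (J m)) * a (T m)\<bar> * (C * (C1 * e x))"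
          by (simp add: abs_mult mult_ac)
        also have "\<dots> \<le> (\<bar>\<mu>\<bar> + 1) * (C * (C1 * e x))"
          using T(6)[of m] C(1) C01 e_ge[OF elim] by (intro mult_right_mono) auto
        finally show ?case by (simp add: mult.assoc)
      qed
    qed (use e_int in \<open>auto simp: measurable_expo\<close>)
    moreover have "integral\<^sup>L expo (\<lambda>x. sqrt (real (J m)) * (G m x - tilt r a0 b0 (\<gamma> * x))) =
          sqrt (real (J m)) * integral\<^sup>L expo (\<lambda>x. G m x - c)" for m
      using G_int[of m] mean0 by simp
    moreover have "integral\<^sup>L expo (\<lambda>x. \<mu> * (\<psi> x * G' x)) =
        \<mu> * (a0 * (r / (d * (d - \<rho>))) + b0 * ((1 - \<rho> - \<gamma>\<^sup>2 * r\<^sup>2) / (d\<^sup>2 * (d - \<rho>)\<^sup>2)))"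
    proof -
      have "has_bochner_integral expo (\<lambda>x. \<psi> x * G' x) (a0 * (r / (d * (d - \<rho>))) + b0 *
            ((1 - \<rho> - \<gamma>\<^sup>2 * r\<^sup>2) / (d\<^sup>2 * (d - \<rho>)\<^sup>2)))"
        unfolding \<psi>_def G'_def d_def by (rule tilt_bias) (use r \<rho>_neg in auto)
      then show ?thesis by (simp only: integral_mult_right_zero has_bochner_integral_iff)
    qed
    ultimately show ?thesis by (simp only:)
  qed
  have "(\<lambda>m. (\<integral>x. iexp ((G m x - c) / sqrt (real (J m))) \<partial>expo) ^ J m) \<longlonglongrightarrow>
     limit_char \<gamma> \<rho> r \<mu> a0 b0"
    unfolding limit_char_def d_def[symmetric] c_def[symmetric, unfolded d_def[symmetric]]
  proof (rule expo.triangular_clt[where w = w, OF J_top])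
    show "0 < J m" for m using T(4)[of m] by simp
    show "AE x in expo. (\<lambda>m. G m x - c) \<longlonglongrightarrow> tilt r a0 b0 (\<gamma> * x) - c"
      by (intro AE_I2 tendsto_intros G_lim)
    show "AE x in expo. \<bar>G m x - c\<bar> \<le> w x" for m
      using AE_expo_nonneg by eventually_elim (rule G_bound)
    show "integrable expo (\<lambda>x. (w x)\<^sup>2)" unfolding w_def by (rule e2_int)
  qed (use mean in \<open>auto simp: measurable_expo\<close>)
  moreover have "(\<integral>x. iexp ((G m x - c) / sqrt (real (J m))) \<partial>expo) =
      (\<integral>x. iexp ((a0 * g_fun r 0 (u (T m + x) / u (T m)) + b0 * g_fun r 1 (u (T m + x) / u (T m)) - c) /
            sqrt (real (J m))) \<partial>expo)" for m
  proof (rule integral_cong_AE)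
    show "AE x in expo. iexp ((G m x - c) / sqrt (real (J m))) =
      iexp ((a0 * g_fun r 0 (u (T m + x) / u (T m)) + b0 * g_fun r 1 (u (T m + x) / u (T m)) - c) /
            sqrt (real (J m)))"
      using AE_expo_nonneg by eventually_elim (simp only: ratio_eq_exp[OF T(3)] G_def)
  qed (auto simp: measurable_expo g_fun_def)
  ultimately have "(\<lambda>m. (\<integral>x. iexp ((a0 * g_fun r 0 (u (T m + x) / u (T m)) + b0 * g_fun r 1 (u (T m + x) /
        u (T m)) - c) / sqrt (real (J m))) \<partial>expo) ^ J m) \<longlonglongrightarrow>
     limit_char \<gamma> \<rho> r \<mu> a0 b0" by simp
  then show ?thesis
    unfolding T_def J_def by (rule LIMSEQ_offset)
qed

end

section \<open>The limit theorem\<close>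

text \<open>The quantile transform for the inverse defined by a supremum. \<open>max 0 t\<close>
  extends \<open>u\<close> constantly to the negative axis, which is null for the exponential law,
  and keeps it monotone everywhere. Vanishing of the distribution function on the negative axis
  makes each set under \<open>Sup\<close> nonempty and its supremum nonnegative.\<close>

lemma distr_quantile_expo:
  fixes D :: "real measure"
  assumes "real_distribution D" and nonneg: "\<And>x. x < 0 \<Longrightarrow> cdf D x = 0"
  defines "u \<equiv> \<lambda>t. gen_inv (cdf D) (1 - 1 / exp (max 0 t))"
  shows "mono u" "\<And>t. 0 \<le> u t" "distr expo borel u = D"
proof -
  interpret D: real_distribution D by fact
  define p where "p t = 1 - 1 / exp (max 0 t)" for t :: real
  have p: "0 \<le> p t" "p t < 1" "mono p" for t
    by (auto simp: p_def mono_def field_simps)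
  have bdd: "bdd_above {x. cdf D x \<le> q}" if "q < 1" for q
  proof -
    have "\<forall>\<^sub>F x in at_top. q < cdf D x"
      using D.cdf_lim_at_top_prob that by (rule order_tendstoD)
    then obtain b where b: "q < cdf D b" by (auto simp: eventually_at_top_linorder)
    show ?thesis
    proof (rule bdd_aboveI[of _ b])
      fix x assume "x \<in> {x. cdf D x \<le> q}"
      then have "cdf D x < cdf D b" using b by simp
      then show "x \<le> b" using D.cdf_nondecreasing[of b x] by linarith
    qed
  qed
  have neg: "x \<in> {x. cdf D x \<le> p t}" if "x < 0" for x t using nonneg[OF that] p by simp
  have ne: "-1 \<in> {x. cdf D x \<le> p t}" for t by (rule neg) simp
  have u: "u t = Sup {x. cdf D x \<le> p t}" for t
    by (simp add: u_def gen_inv_def p_def)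
  show mono: "mono u"
  proof (rule monoI)
    fix s t :: real assume "s \<le> t"
    then have "p s \<le> p t" by (rule monoD[OF p(3)])
    then show "u s \<le> u t"
      unfolding u using ne[of s] by (intro cSup_subset_mono bdd p) auto
  qed
  show "0 \<le> u t" for t
    unfolding u by (rule dense_le) (rule cSup_upper[OF neg bdd[OF p(2)]])
  have u_meas[measurable]: "u \<in> borel_measurable borel" by (rule borel_measurable_mono[OF mono])
  have below: "u t \<le> x" if "p t < cdf D x" for t x
    unfolding u
  proof (rule cSup_least)
    fix y assume "y \<in> {y. cdf D y \<le> p t}"
    then have "cdf D y < cdf D x" using that by simp
    then show "y \<le> x" using D.cdf_nondecreasing[of x y] by linarith
  qed (use ne in blast)
  \<comment> \<open>Right continuity: if the distribution function were below \<open>p t\<close> at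
    \<open>x\<close>, it would be so at some \<open>y > x\<close> too, and the supremum would exceed
    \<open>x\<close>.\<close>
  have above: "p t \<le> cdf D x" if "u t \<le> x" for t x
  proof (rule ccontr)
    assume "\<not> ?thesis"
    then have lt: "cdf D x < p t" by simp
    have "(cdf D \<longlongrightarrow> cdf D x) (at_right x)"
      using D.cdf_is_right_cont[of x] by (simp add: continuous_within)
    then have "\<forall>\<^sub>F y in at_right x. cdf D y < p t" using lt by (rule order_tendstoD)
    then obtain b where b: "b > x" "\<And>y. y > x \<Longrightarrow> y < b \<Longrightarrow> cdf D y < p t"
      unfolding eventually_at_right_field by blast
    define y where "y = (x + b) / 2"
    have y: "x < y" "y < b" using b(1) by (auto simp: y_def)
    then have "y \<in> {y. cdf D y \<le> p t}" using b(2)[of y] by simp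
    then have "y \<le> u t" unfolding u by (rule cSup_upper[OF _ bdd[OF p(2)]])
    then show False using that y by simp
  qed
  show "distr expo borel u = D"
  proof (rule cdf_unique)
    show "real_distribution (distr expo borel u)"
      by (rule expo.real_distribution_distr) (simp add: measurable_expo)
    show "real_distribution D" by fact
    show "cdf (distr expo borel u) = cdf D"
    proof
      fix x
      have "cdf (distr expo borel u) x = measure expo {t. u t \<le> x}"
        unfolding cdf_def by (subst measure_distr) (auto simp: measurable_expo vimage_def)
      also have "\<dots> = cdf D x"
      proof (cases "cdf D x < 1")
        case False
        then have "cdf D x = 1" using D.cdf_bounded_prob[of x] by linarith
        moreover have "u t \<le> x" for t using below[of t x] p(2)[of t] \<open>cdf D x = 1\<close> by simp
        ultimately show ?thesis using expo.prob_space by simp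
      next
        case True
        \<comment> \<open>The level at which \<open>p\<close> reaches \<open>cdf D x\<close>. The
          one-sided implications \<open>below\<close> and \<open>above\<close> decide
          \<open>u t \<le> x\<close> for every nonnegative \<open>t\<close> except
          \<open>t = s\<close>, a null set.\<close>
        define s where "s = - ln (1 - cdf D x)"
        have q0: "0 \<le> cdf D x" by (rule D.cdf_nonneg)
        have s0: "0 \<le> s" using True q0 by (simp add: s_def)
        have es: "exp (- s) = 1 - cdf D x" using True by (simp add: s_def)
        have pt: "p t = 1 - exp (- t)" if "0 \<le> t" for t using that by (simp add: p_def exp_minus
              inverse_eq_divide)
        have lt: "u t \<le> x" if "0 \<le> t" "t < s" for t
        proof (rule below)
          have "exp (- s) < exp (- t)" using that by simp
          then show "p t < cdf D x" using pt[OF that(1)] es by linarith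
        qed
        have le: "t \<le> s" if "0 \<le> t" "u t \<le> x" for t
        proof -
          have "exp (- s) \<le> exp (- t)" using above[OF that(2)] pt[OF that(1)] es by linarith
          then show ?thesis by simp
        qed
        have "measure expo {t. u t \<le> x} = measure expo {..<s}"
        proof (rule expo.finite_measure_eq_AE)
          have "AE t in expo. t \<noteq> s" using AE_lborel_singleton[of s] by (auto simp: AE_density)
          then show "AE t in expo. t \<in> {t. u t \<le> x} \<longleftrightarrow> t \<in> {..<s}"
            using AE_expo_nonneg by eventually_elim (use lt le in force)
        qed (auto simp: measurable_expo)
        also have "\<dots> = cdf D x"
          using emeasure_expo_lessThan[OF s0] es q0 by (simp add: measure_def)
        finally show ?thesis .
      qed
      finally show "cdf (distr expo borel u) x = cdf D x" .
    qed
  qed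
qed

text \<open>No exponentials are constructed on \<open>M\<close>: the first \<open>n\<close>
  observations and the image of an exponential product under \<open>u\<close> have the same joint
  law, and the statistic depends on that law alone.\<close>

lemma (in prob_space) nn_integral_iid_order_stat:
  fixes X :: "nat \<Rightarrow> 'a \<Rightarrow> real" and u :: "real \<Rightarrow> real" and g :: "real \<Rightarrow> real \<times> real" and H :: "real \<times> real
        \<Rightarrow> ennreal"
  assumes X[measurable]: "\<And>i. X i \<in> borel_measurable M" and indep: "indep_vars (\<lambda>_. borel) X UNIV"
    and law: "\<And>i. distr M borel (X i) = distr expo borel u" and u: "mono u"
    and g[measurable]: "g \<in> borel_measurable borel" and H[measurable]: "H \<in> borel_measurable borel"
    and k: "k < n"
  shows "(\<integral>\<^sup>+\<omega>. H (\<Sum>l<k. g (order_stat X (n - l) n \<omega> / order_stat X (n - k) n \<omega>)) \<partial>M) =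
    (\<integral>\<^sup>+t. ennreal (pivot_weight n k t) * (\<integral>\<^sup>+x. H (\<Sum>j<k. g (u (t + x j) / u t)) \<partial>expos {..<k}) \<partial>expo)"
proof -
  let ?L = "distr expo borel u"
  have u_meas[measurable]: "u \<in> borel_measurable borel" by (rule borel_measurable_mono[OF u])
  have L: "prob_space ?L" by (rule expo.prob_space_distr) (simp add: measurable_expo)
  define E :: "nat \<Rightarrow> (nat \<Rightarrow> real) \<Rightarrow> real" where "E i x = x i" for i x
  define \<Phi> where "\<Phi> y = H (\<Sum>l<k. g (order_stat E (n - l) n y / order_stat E (n - k) n y))" for y
  have os: "order_stat E j n y = order_stat Y j n \<omega>" if "\<And>i. i < n \<Longrightarrow> y i = Y i \<omega>" for j y and \<omega> :: 'b and Y
    unfolding order_stat_def E_def using that by (intro arg_cong2[where f = nth] arg_cong[where f =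
          sort] map_cong) auto
  have \<Phi>: "\<Phi> \<in> borel_measurable (PiM {..<n} (\<lambda>_. ?L))"
  proof -
    have E: "E i \<in> borel_measurable (PiM {..<n} (\<lambda>_. ?L))" if "i < n" for i
    proof -
      have "(\<lambda>x. x i) \<in> measurable (PiM {..<n} (\<lambda>_. ?L)) ?L"
        using that by (intro measurable_component_singleton) simp
      then show ?thesis unfolding E_def[abs_def] by (simp cong: measurable_cong_sets)
    qed
    have [measurable]: "order_stat E (n - k) n \<in> borel_measurable (PiM {..<n} (\<lambda>_. ?L))"
      by (rule measurable_order_stat[OF E]) (use k in auto)
    have "(\<lambda>y. \<Sum>l<k. g (order_stat E (n - l) n y / order_stat E (n - k) n y)) \<in> borel_measurable
          (PiM {..<n} (\<lambda>_. ?L))"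
    proof (rule borel_measurable_sum)
      fix l assume "l \<in> {..<k}"
      then have [measurable]: "order_stat E (n - l) n \<in> borel_measurable (PiM {..<n} (\<lambda>_. ?L))"
        by (intro measurable_order_stat[OF E]) (use k in auto)
      show "(\<lambda>y. g (order_stat E (n - l) n y / order_stat E (n - k) n y)) \<in> borel_measurable (PiM {..<n}
            (\<lambda>_. ?L))"
        by measurable
    qed
    then show ?thesis unfolding \<Phi>_def[abs_def] by measurable
  qed
  have sets_L: "sets (PiM {..<n} (\<lambda>_. ?L)) = sets (PiM {..<n} (\<lambda>_. borel))"
    by (rule sets_PiM_cong) auto
  have "indep_vars (\<lambda>_. borel) X {..<n}" by (rule indep_vars_subset[OF indep]) simp
  moreover have "{..<n} \<noteq> {}" using k by (metis lessThan_iff empty_iff)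
  ultimately have lawX: "distr M (PiM {..<n} (\<lambda>_. borel)) (\<lambda>\<omega>. \<lambda>i\<in>{..<n}. X i \<omega>) = PiM {..<n} (\<lambda>_. ?L)"
    using indep_vars_iff_distr_eq_PiM[where I = "{..<n}" and M' = "\<lambda>_. borel" and X = X] X by (simp add: law)
  have "(\<integral>\<^sup>+y. \<Phi> y \<partial>PiM {..<n} (\<lambda>_. ?L)) = (\<integral>\<^sup>+\<omega>. \<Phi> (\<lambda>i\<in>{..<n}. X i \<omega>) \<partial>M)"
    unfolding lawX[symmetric]
    by (rule nn_integral_distr) (use \<Phi> in \<open>auto simp: measurable_cong_sets[OF sets_L refl] intro!:
          measurable_restrict\<close>)
  also have "\<dots> = (\<integral>\<^sup>+\<omega>. H (\<Sum>l<k. g (order_stat X (n - l) n \<omega> / order_stat X (n - k) n \<omega>)) \<partial>M)"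
    unfolding \<Phi>_def by (intro nn_integral_cong arg_cong[where f = H] sum.cong refl arg_cong[where f =
          g] arg_cong2[where f = "(/)"] os) auto
  finally have 1: "(\<integral>\<^sup>+\<omega>. H (\<Sum>l<k. g (order_stat X (n - l) n \<omega> / order_stat X (n - k) n \<omega>)) \<partial>M) =
        (\<integral>\<^sup>+y. \<Phi> y \<partial>PiM {..<n} (\<lambda>_. ?L))" ..
  have u_expo: "u \<in> measurable expo ?L" by (simp add: measurable_expo)
  have "distr expo ?L u = ?L" by (rule distr_cong) auto
  then have lawE: "distr (expos {..<n}) (PiM {..<n} (\<lambda>_. ?L)) (compose {..<n} u) = PiM {..<n} (\<lambda>_. ?L)"
    using distr_PiM_finite_prob_space'[of "{..<n}" "\<lambda>_. expo" "\<lambda>_. ?L" u] u_expo L expo.prob_space_axioms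
          by simp
  have comp: "compose {..<n} u \<in> measurable (expos {..<n}) (PiM {..<n} (\<lambda>_. ?L))"
    unfolding compose_def
  proof (rule measurable_restrict)
    fix i assume "i \<in> {..<n}"
    then show "(\<lambda>x. u (x i)) \<in> measurable (expos {..<n}) ?L"
      using measurable_compose[OF measurable_component_singleton[of i "{..<n}" "\<lambda>_. expo"] u_expo] by simp
  qed
  have "(\<integral>\<^sup>+y. \<Phi> y \<partial>PiM {..<n} (\<lambda>_. ?L)) = (\<integral>\<^sup>+x. \<Phi> (compose {..<n} u x) \<partial>expos {..<n})"
    by (subst lawE[symmetric], rule nn_integral_distr[OF comp]) (use \<Phi> in simp)
  also have "\<dots> = (\<integral>\<^sup>+x. H (\<Sum>l<k. g (order_stat (\<lambda>i x. u (x i)) (n - l) n x / order_stat (\<lambda>i x. u (x i))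
        (n - k) n x)) \<partial>expos {..<n})"
    unfolding \<Phi>_def
    by (intro nn_integral_cong arg_cong[where f = H] sum.cong refl arg_cong[where f =
          g] arg_cong2[where f = "(/)"] os) (auto simp: compose_def)
  finally show ?thesis
    unfolding 1 by (simp only: nn_integral_order_stat[OF k u g H])
qed

lemma psd_discriminant:
  fixes v1 v2 c :: real
  assumes psd: "\<And>a b. 0 \<le> a\<^sup>2 * v1 + 2 * a * b * c + b\<^sup>2 * v2"
  shows "0 \<le> v1" "0 \<le> v2" "c\<^sup>2 \<le> v1 * v2"
proof -
  show v1: "0 \<le> v1" using psd[of 1 0] by simp
  show "0 \<le> v2" using psd[of 0 1] by simp
  show "c\<^sup>2 \<le> v1 * v2"
  proof (cases "v1 = 0")
    case True
    have "c = 0"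
    proof (rule ccontr)
      assume "c \<noteq> 0"
      \<comment> \<open>For \<open>v1 = 0\<close> and \<open>b = 1\<close> the form is affine in
        \<open>a\<close> with slope \<open>2 * c\<close>; the chosen point gives it the value
        -1.\<close>
      then show False using psd[of "- (v2 + 1) / (2 * c)" 1] True by (simp add: field_simps)
    qed
    then show ?thesis using True by simp
  next
    case False
    have "(- c)\<^sup>2 * v1 + 2 * (- c) * v1 * c + v1\<^sup>2 * v2 = v1 * (v1 * v2 - c\<^sup>2)"
      by (simp add: power2_eq_square algebra_simps)
    then have "0 \<le> v1 * (v1 * v2 - c\<^sup>2)" using psd[of "- c" v1] by simp
    then show ?thesis using v1 False by (simp add: zero_le_mult_iff)
  qed
qed

section \<open>The standardised statistic as a function of a sum of pairs\<close>

definition g_pair :: "real \<Rightarrow> real \<Rightarrow> real \<times> real" where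
  "g_pair r x = (g_fun r 0 x, g_fun r 1 x)"

definition standardize :: "real \<Rightarrow> real \<Rightarrow> nat \<Rightarrow> real \<times> real \<Rightarrow> real \<times> real" where
  "standardize \<gamma> r k z = (sqrt (real k) * (1 / real k * fst z - xi \<gamma> r 0), sqrt (real k) * (1 / real k *
        snd z - xi \<gamma> r 1))"

lemma g_pair_measurable[measurable]: "g_pair r \<in> borel_measurable borel"
  unfolding g_pair_def[abs_def] g_fun_def by measurable

lemma continuous_standardize: "continuous_on UNIV (standardize \<gamma> r k)"
  unfolding standardize_def[abs_def] by (intro continuous_intros)

lemma standardize_measurable[measurable]: "standardize \<gamma> r k \<in> borel_measurable borel"
  by (rule borel_measurable_continuous_onI[OF continuous_standardize])

lemma xi_values: "xi \<gamma> r 0 = 1 / (1 - \<gamma> * r)" "xi \<gamma> r 1 = \<gamma> / (1 - \<gamma> * r)\<^sup>2"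
  using Gamma_fact[of 1, where 'a = real] by (simp_all add: xi_def power2_eq_square)

text \<open>Distributing the centring over the summands makes every projection a sum of functions of
  single arguments, so that its characteristic function factorises under independence.\<close>

lemma standardize_projection:
  "a * fst (standardize \<gamma> r k (\<Sum>j<k. g_pair r (y j))) + b * snd (standardize \<gamma> r k (\<Sum>j<k. g_pair r (y j))) =
    (\<Sum>j<k. (a * g_fun r 0 (y j) + b * g_fun r 1 (y j) - (a / (1 - \<gamma> * r) + b * \<gamma> / (1 - \<gamma> * r)\<^sup>2)) /
          sqrt (real k))"
proof (cases "k = 0")
  case False
  define s where "s = sqrt (real k)"
  define p where "p = (\<Sum>j<k. g_fun r 0 (y j))"
  define q where "q = (\<Sum>j<k. g_fun r 1 (y j))"
  have s: "s > 0" "real k = s * s" using False by (simp_all add: s_def)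
  have "(\<Sum>j<k. (a * g_fun r 0 (y j) + b * g_fun r 1 (y j) - (a / (1 - \<gamma> * r) + b * \<gamma> / (1 - \<gamma> * r)\<^sup>2)) / s) =
      (a * p + b * q - real k * (a / (1 - \<gamma> * r) + b * \<gamma> / (1 - \<gamma> * r)\<^sup>2)) / s"
    by (simp add: p_def q_def sum.distrib sum_subtractf sum_distrib_left flip: sum_divide_distrib)
  also have "\<dots> = a * (s * (1 / real k * p - xi \<gamma> r 0)) + b * (s * (1 / real k * q - xi \<gamma> r 1))"
  proof -
    have "(a * p + b * q - s * s * (a * x + b * y)) / s = a * (s * (1 / (s * s) * p - x)) + b *
          (s * (1 / (s * s) * q - y))" for x y
      using s(1) by (simp add: field_simps)
    from this[of "1 / (1 - \<gamma> * r)" "\<gamma> / (1 - \<gamma> * r)\<^sup>2"] show ?thesis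
      unfolding xi_values s(2) by simp
  qed
  finally show ?thesis
    by (simp add: standardize_def g_pair_def fst_sum snd_sum s_def p_def q_def)
qed (simp add: standardize_def)

lemma measurable_standardize_order_stat:
  assumes X: "\<And>i. X i \<in> borel_measurable M" and kn: "k < n"
  shows "(\<lambda>\<omega>. standardize \<gamma> r k (\<Sum>l<k. g_pair r (order_stat X (n - l) n \<omega> / order_stat X (n - k) n \<omega>)))
    \<in> borel_measurable M"
proof -
  have os: "order_stat X (n - l) n \<in> borel_measurable M" if "l \<le> k" for l
    by (rule measurable_order_stat[OF X]) (use kn that in auto)
  have "(\<lambda>\<omega>. \<Sum>l<k. g_pair r (order_stat X (n - l) n \<omega> / order_stat X (n - k) n \<omega>)) \<in> borel_measurable M"
  proof (rule borel_measurable_sum)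
    fix l assume "l \<in> {..<k}"
    then have [measurable]: "order_stat X (n - l) n \<in> borel_measurable M" "order_stat X (n - k) n \<in>
          borel_measurable M"
      using os by auto
    show "(\<lambda>\<omega>. g_pair r (order_stat X (n - l) n \<omega> / order_stat X (n - k) n \<omega>)) \<in> borel_measurable M"
      by measurable
  qed
  then show ?thesis by measurable
qed

context second_order_regular
begin

text \<open>The limit theorem given the pivot: characteristic functions of the excess sums are
  \<open>K m\<close>-th powers of a one-dimensional integral, and the plane continuity theorem
  upgrades their convergence.\<close>

lemma conditional_tendsto:
  fixes f :: "real \<times> real \<Rightarrow> real"
  assumes r: "\<gamma> * r < 1 / 2" and K: "filterlim K at_top sequentially" and t: "filterlim t at_top sequentially"
    and \<mu>: "(\<lambda>m. sqrt (real (K m)) * a (t m)) \<longlonglongrightarrow> \<mu>"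
    and N: "prob_space N" "sets N = sets borel"
    and char_N: "\<And>a0 b0. (\<integral>z. iexp (a0 * fst z + b0 * snd z) \<partial>N) =
      limit_char \<gamma> \<rho> r \<mu> a0 b0"
    and f: "continuous_on UNIV f" "\<And>z. \<bar>f z\<bar> \<le> B"
  shows "(\<lambda>m. \<integral>x. f (standardize \<gamma> r (K m) (\<Sum>j<K m. g_pair r (u (t m + x j) / u (t m)))) \<partial>expos {..<K m})
        \<longlonglongrightarrow> integral\<^sup>L N f"
proof -
  define V where "V m x = standardize \<gamma> r (K m) (\<Sum>j<K m. g_pair r (u (t m + x j) / u (t m)))" for m x
  have V[measurable]: "V m \<in> borel_measurable (expos {..<K m})" for m
  proof -
    have v: "(\<lambda>x. g_pair r (u (t m + x) / u (t m))) \<in> borel_measurable borel" by measurable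
    from measurable_PiM_expo_sum[OF order_refl[of "{..<K m}"] v]
    show ?thesis unfolding V_def by measurable
  qed
  interpret P: prob_space "expos {..<K m}" for m by (rule prob_space_PiM_expo)
  interpret plane_char_convergence "\<lambda>m. distr (expos {..<K m}) borel (V m)" N
  proof (rule plane_char_convergence.intro)
    show "prob_space (distr (expos {..<K m}) borel (V m))" for m
      by (rule P.prob_space_distr[OF V])
    show "prob_space N" "sets N = sets borel" by (rule N)+
    fix a0 b0
    let ?c = "a0 / (1 - \<gamma> * r) + b0 * \<gamma> / (1 - \<gamma> * r)\<^sup>2"
    define h where "h m x = iexp ((a0 * g_fun r 0 (u (t m + x) / u (t m)) + b0 * g_fun r 1 (u (t m + x) /
          u (t m)) - ?c) / sqrt (real (K m)))" for m x
    have h_meas: "h m \<in> borel_measurable borel" for m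
      unfolding h_def g_fun_def by measurable
    have h_int: "integrable expo (h m)" for m
      by (rule expo.integrable_const_bound[of _ 1]) (use h_meas[of m] in \<open>auto simp: measurable_expo h_def\<close>)
    have "(\<integral>z. iexp (a0 * fst z + b0 * snd z) \<partial>distr (expos {..<K m}) borel (V m)) =
          (\<integral>x. h m x \<partial>expo) ^ K m" for m
    proof -
      have "(\<integral>z. iexp (a0 * fst z + b0 * snd z) \<partial>distr (expos {..<K m}) borel (V m)) =
          (\<integral>x. iexp (a0 * fst (V m x) + b0 * snd (V m x)) \<partial>expos {..<K m})"
        by (rule integral_distr[OF V]) (intro borel_measurable_continuous_onI continuous_intros)
      also have "\<dots> = (\<integral>x. (\<Prod>j\<in>{..<K m}. h m (x j)) \<partial>expos {..<K m})"
        unfolding V_def standardize_projection h_def by (simp add: sum_distrib_left exp_sum)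
      also have "\<dots> = (\<Prod>j\<in>{..<K m}. integral\<^sup>L expo (h m))"
        by (rule expo_prod.product_integral_prod) (auto intro: h_int)
      finally show ?thesis by simp
    qed
    then show "(\<lambda>m. \<integral>z. iexp (a0 * fst z + b0 * snd z) \<partial>distr (expos {..<K m}) borel (V m)) \<longlonglongrightarrow>
          (\<integral>z. iexp (a0 * fst z + b0 * snd z) \<partial>N)"
      using char_tendsto[OF r K t \<mu>, of a0 b0] unfolding char_N h_def by simp
  qed simp
  have "(\<lambda>m. integral\<^sup>L (distr (expos {..<K m}) borel (V m)) f) \<longlonglongrightarrow> integral\<^sup>L N f"
    by (rule bounded_continuous_tendsto[OF f])
  moreover have "integral\<^sup>L (distr (expos {..<K m}) borel (V m)) f = (\<integral>x. f (V m x) \<partial>expos {..<K m})" for m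
    by (rule integral_distr[OF V borel_measurable_continuous_onI[OF f(1)]])
  ultimately show ?thesis by (simp add: V_def)
qed

text \<open>A threshold moved by o(1) leaves the limit of \<open>sqrt K * a\<close> unchanged, by
  uniform regular variation. Hence no rate for the fluctuations of the pivot is needed.\<close>

lemma a_tendsto_perturbed:
  fixes K :: "nat \<Rightarrow> nat" and \<tau> t :: "nat \<Rightarrow> real"
  assumes \<tau>: "filterlim \<tau> at_top sequentially" and near: "(\<lambda>m. t m - \<tau> m) \<longlonglongrightarrow> 0"
    and \<mu>: "(\<lambda>m. sqrt (real (K m)) * a (\<tau> m)) \<longlonglongrightarrow> \<mu>"
  shows "filterlim t at_top sequentially" "(\<lambda>m. sqrt (real (K m)) * a (t m)) \<longlonglongrightarrow> \<mu>"
proof -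
  show "filterlim t at_top sequentially"
    using filterlim_tendsto_add_at_top[OF near \<tau>] by simp
  \<comment> \<open>Clipping to \<open>{-1..1}\<close> meets the uniform lemma's bound at every
    index; eventually nothing is clipped.\<close>
  define s where "s m = max (-1) (min 1 (t m - \<tau> m))" for m
  have s: "\<bar>s m\<bar> \<le> 1" for m by (auto simp: s_def)
  have s0: "s \<longlonglongrightarrow> 0"
  proof -
    have "s \<longlonglongrightarrow> max (-1) (min 1 0)" unfolding s_def by (intro tendsto_intros near)
    then show ?thesis by simp
  qed
  have "(\<lambda>m. (sqrt (real (K m)) * a (\<tau> m)) * (a (\<tau> m + s m) / a (\<tau> m) * exp (- \<rho> * s m)) * exp (\<rho> * s m))
        \<longlonglongrightarrow> \<mu> * 1 * exp (\<rho> * 0)"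
    by (intro tendsto_intros \<mu> a_ratio_tendsto_uniform[OF \<tau> s] s0)
  moreover have "\<forall>\<^sub>F m in sequentially. (sqrt (real (K m)) * a (\<tau> m)) * (a (\<tau> m + s m) / a (\<tau> m) *
        exp (- \<rho> * s m)) * exp (\<rho> * s m) = sqrt (real (K m)) * a (t m)"
  proof -
    have "\<forall>\<^sub>F m in sequentially. \<bar>t m - \<tau> m\<bar> < 1"
      using tendsto_rabs[OF near] by (rule order_tendstoD) simp
    then show ?thesis
      using eventually_compose_filterlim[OF a_nonzero \<tau>]
    proof eventually_elim
      case (elim m)
      have "\<tau> m + s m = t m" using elim(1) by (auto simp: s_def)
      moreover have "exp (- \<rho> * s m) * exp (\<rho> * s m) = 1" by (simp flip: exp_add)
      ultimately show ?case using elim(2) by (simp add: mult.assoc)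
    qed
  qed
  ultimately have "(\<lambda>m. sqrt (real (K m)) * a (t m)) \<longlonglongrightarrow> \<mu> * 1 * exp (\<rho> * 0)"
    by (rule Lim_transform_eventually)
  then show "(\<lambda>m. sqrt (real (K m)) * a (t m)) \<longlonglongrightarrow> \<mu>" by simp
qed

text \<open>\<open>f\<close> is taken nonnegative because the mixture formula is stated for
  nonnegative integrals. The conditional expectation \<phi> is averaged over the pivot, whose
  concentration \<open>exp (- t) * (n / k)\<close> near 1 means that \<open>t\<close> is within o(1)
  of \<open>ln (n / k)\<close>.\<close>

lemma order_stat_tendsto:
  fixes f :: "real \<times> real \<Rightarrow> real" and M :: "'b measure" and X :: "nat \<Rightarrow> 'b \<Rightarrow> real" and k :: "nat \<Rightarrow> nat"
  assumes "prob_space M" and X: "\<And>i. X i \<in> borel_measurable M" and indep: "prob_space.indep_vars M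
        (\<lambda>_. borel) X UNIV"
    and law: "\<And>i. distr M borel (X i) = distr expo borel u"
    and r: "\<gamma> * r < 1 / 2"
    and k: "\<And>n. n \<ge> 2 \<Longrightarrow> 1 \<le> k n \<and> k n < n" and k_top: "filterlim k at_top sequentially"
    and nk: "filterlim (\<lambda>n. real n / real (k n)) at_top sequentially"
    and \<mu>: "(\<lambda>n. sqrt (real (k n)) * a (ln (real n / real (k n)))) \<longlonglongrightarrow> \<mu>"
    and N: "prob_space N" "sets N = sets borel"
    and char_N: "\<And>a0 b0. (\<integral>z. iexp (a0 * fst z + b0 * snd z) \<partial>N) =
      limit_char \<gamma> \<rho> r \<mu> a0 b0"
    and f: "continuous_on UNIV f" "\<And>z. 0 \<le> f z" "\<And>z. f z \<le> B"
  shows "(\<lambda>n. \<integral>\<omega>. f (standardize \<gamma> r (k n) (\<Sum>l<k n. g_pair r (order_stat X (n - l) n \<omega> / order_stat X (n -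
        k n) n \<omega>))) \<partial>M) \<longlonglongrightarrow> integral\<^sup>L N f"
proof -
  interpret prob_space M by fact
  interpret N: prob_space N by fact
  have f_meas[measurable]: "f \<in> borel_measurable borel" by (rule borel_measurable_continuous_onI[OF f(1)])
  have fB: "\<bar>f z\<bar> \<le> B" for z using f(2,3)[of z] by simp
  define \<phi> where "\<phi> n t = (\<integral>x. f (standardize \<gamma> r (k n) (\<Sum>j<k n. g_pair r (u (t + x j) / u t))) \<partial>expos
        {..<k n})" for n t
  have P: "prob_space (expos {..<k n})" for n by (rule prob_space_PiM_expo)
  have in_meas: "(\<lambda>x. f (standardize \<gamma> r (k n) (\<Sum>j<k n. g_pair r (u (t + x j) / u t)))) \<in> borel_measurable
        (expos {..<k n})" for n t
  proof -
    have v: "(\<lambda>x. g_pair r (u (t + x) / u t)) \<in> borel_measurable borel" by measurable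
    from measurable_PiM_expo_sum[OF order_refl[of "{..<k n}"] v] show ?thesis by measurable
  qed
  have in_int: "integrable (expos {..<k n}) (\<lambda>x. f (standardize \<gamma> r (k n) (\<Sum>j<k n. g_pair r (u (t + x j) /
        u t))))" for n t
    by (rule finite_measure.integrable_const_bound[OF prob_space.finite_measure[OF P], of _ B])
          (use fB in_meas in auto)
  have inner: "(\<integral>\<^sup>+x. ennreal (f (standardize \<gamma> r (k n) (\<Sum>j<k n. g_pair r (u (t + x j) / u t)))) \<partial>expos
        {..<k n}) = ennreal (\<phi> n t)" for n t
    unfolding \<phi>_def by (rule nn_integral_eq_integral[OF in_int]) (use f(2) in simp)
  have \<phi>_nonneg: "0 \<le> \<phi> n t" for n t unfolding \<phi>_def by (rule integral_nonneg_AE) (use f(2) in simp)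
  have \<phi>_le: "\<bar>\<phi> n t\<bar> \<le> B" for n t
  proof -
    have "\<phi> n t \<le> (\<integral>x. B \<partial>expos {..<k n})"
      unfolding \<phi>_def by (rule integral_mono[OF in_int]) (use f(3) prob_space.finite_measure[OF P] in
            \<open>auto intro: finite_measure.integrable_const\<close>)
    also have "\<dots> = B" by (simp add: prob_space.prob_space[OF P])
    finally show ?thesis using \<phi>_nonneg[of n t] by simp
  qed
  have \<phi>_meas[measurable]: "\<phi> n \<in> borel_measurable borel" for n
  proof -
    have w: "(\<lambda>(t, x). g_pair r (u (t + x) / u t)) \<in> borel_measurable (borel \<Otimes>\<^sub>M borel)" by measurable
    have H: "(\<lambda>z. ennreal (f (standardize \<gamma> r (k n) z))) \<in> borel_measurable borel" by measurable
    have "(\<lambda>t. enn2real (ennreal (\<phi> n t))) \<in> borel_measurable borel"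
      using measurable_nn_integral_expo_sum[OF w H, of "\<lambda>_. 0" "k n"] inner by
            (intro borel_measurable_enn2real) simp
    then show ?thesis using \<phi>_nonneg by simp
  qed
  have k_ev: "\<forall>\<^sub>F n in sequentially. 1 \<le> k n \<and> k n < n"
    using eventually_ge_at_top[of 2] by eventually_elim (rule k)
  have "(\<lambda>n. \<integral>t. pivot_weight n (k n) t * \<phi> n t \<partial>expo) \<longlonglongrightarrow> integral\<^sup>L N f"
  proof (rule pivot_weight_average_tendsto[OF k_ev k_top \<phi>_meas \<phi>_le])
    have N_int: "integrable N f" by (rule integrable_bounded_continuous[OF N f(1) fB])
    have "integral\<^sup>L N f \<le> (\<integral>z. B \<partial>N)" by (rule integral_mono[OF N_int]) (use f(3) in auto)
    moreover have "0 \<le> integral\<^sup>L N f" by (rule integral_nonneg_AE) (use f(2) in simp)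
    ultimately show "\<bar>integral\<^sup>L N f\<bar> \<le> B" by (simp add: N.prob_space)
    fix L :: "nat \<Rightarrow> nat" and t :: "nat \<Rightarrow> real"
    assume L: "filterlim L at_top sequentially" and t: "(\<lambda>m. exp (- t m) * (real (L m) / real (k (L m)))) \<longlonglongrightarrow> 1"
    define \<tau> where "\<tau> m = ln (real (L m) / real (k (L m)))" for m
    have \<tau>: "filterlim \<tau> at_top sequentially"
      unfolding \<tau>_def by (intro filterlim_compose[OF ln_at_top] filterlim_compose[OF nk L])
    have "(\<lambda>m. - ln (exp (- t m) * (real (L m) / real (k (L m))))) \<longlonglongrightarrow> - ln 1"
      by (intro tendsto_intros t) simp
    moreover have "\<forall>\<^sub>F m in sequentially. - ln (exp (- t m) * (real (L m) / real (k (L m)))) = t m - \<tau> m"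
      using eventually_compose_filterlim[OF k_ev L]
    proof eventually_elim
      case (elim m)
      then have "real (L m) / real (k (L m)) > 0" by simp
      then have "ln (exp (- t m) * (real (L m) / real (k (L m)))) = ln (exp (- t m)) + \<tau> m"
        unfolding \<tau>_def by (intro ln_mult_pos) auto
      then show ?case by simp
    qed
    ultimately have near: "(\<lambda>m. t m - \<tau> m) \<longlonglongrightarrow> 0"
      using Lim_transform_eventually by fastforce
    have \<mu>L: "(\<lambda>m. sqrt (real (k (L m))) * a (\<tau> m)) \<longlonglongrightarrow> \<mu>"
      unfolding \<tau>_def by (rule filterlim_compose[OF \<mu> L])
    note pert = a_tendsto_perturbed[OF \<tau> near \<mu>L]
    show "(\<lambda>m. \<phi> (L m) (t m)) \<longlonglongrightarrow> integral\<^sup>L N f"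
      unfolding \<phi>_def
      by (rule conditional_tendsto[OF r filterlim_compose[OF k_top L] pert N char_N f(1) fB])
  qed
  moreover have "\<forall>\<^sub>F n in sequentially. (\<integral>t. pivot_weight n (k n) t * \<phi> n t \<partial>expo) =
      (\<integral>\<omega>. f (standardize \<gamma> r (k n) (\<Sum>l<k n. g_pair r (order_stat X (n - l) n \<omega> / order_stat X (n - k n) n
            \<omega>))) \<partial>M)"
    using k_ev
  proof eventually_elim
    case (elim n)
    then have kn: "k n < n" by simp
    let ?Z = "\<lambda>\<omega>. f (standardize \<gamma> r (k n) (\<Sum>l<k n. g_pair r (order_stat X (n - l) n \<omega> / order_stat X (n -
          k n) n \<omega>)))"
    have Z: "?Z \<in> borel_measurable M"
      by (rule measurable_compose[OF measurable_standardize_order_stat[OF X kn] f_meas])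
    have "integral\<^sup>L M ?Z = enn2real (\<integral>\<^sup>+\<omega>. ennreal (?Z \<omega>) \<partial>M)"
      by (rule integral_eq_nn_integral[OF Z]) (use f(2) in simp)
    also have "(\<integral>\<^sup>+\<omega>. ennreal (?Z \<omega>) \<partial>M) = (\<integral>\<^sup>+t. ennreal (pivot_weight n (k n) t) * ennreal (\<phi> n t) \<partial>expo)"
      unfolding inner[symmetric]
      by (rule nn_integral_iid_order_stat[OF X indep law mono_u g_pair_measurable _ kn, of "\<lambda>z. ennreal
            (f (standardize \<gamma> r (k n) z))"]) measurable
    also have "\<dots> = (\<integral>\<^sup>+t. ennreal (pivot_weight n (k n) t * \<phi> n t) \<partial>expo)"
    proof (rule nn_integral_cong_AE)
      show "AE t in expo. ennreal (pivot_weight n (k n) t) * ennreal (\<phi> n t) =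
            ennreal (pivot_weight n (k n) t * \<phi> n t)"
        using AE_expo_nonneg by eventually_elim (simp add: ennreal_mult pivot_weight_nonneg \<phi>_nonneg)
    qed
    also have "enn2real \<dots> = (\<integral>t. pivot_weight n (k n) t * \<phi> n t \<partial>expo)"
    proof (rule integral_eq_nn_integral[symmetric])
      show "AE t in expo. 0 \<le> pivot_weight n (k n) t * \<phi> n t"
        using AE_expo_nonneg by eventually_elim (simp add: pivot_weight_nonneg \<phi>_nonneg)
    qed (simp add: measurable_expo)
    finally show ?case ..
  qed
  ultimately show ?thesis by (rule Lim_transform_eventually)
qed

end

theorem theorem2:
  fixes M :: "'a measure" and X :: "nat \<Rightarrow> 'a \<Rightarrow> real"
    and F U A :: "real \<Rightarrow> real" and \<gamma> \<rho> r \<mu> :: real and k :: "nat \<Rightarrow> nat"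
  assumes "prob_space M"
    and "\<And>i. X i \<in> borel_measurable M"
    and "prob_space.indep_vars M (\<lambda>_. borel) X UNIV"
    and "\<And>i. distr M borel (X i) = distr M borel (X 0)"
    and "\<And>i \<omega>. \<omega> \<in> space M \<Longrightarrow> X i \<omega> \<ge> 0"
    and "\<And>x. F x = measure M {\<omega> \<in> space M. X 0 \<omega> \<le> x}"
    and "\<And>t. U t = gen_inv F (1 - 1 / t)"
    and "\<gamma> > 0" and "\<rho> < 0"
    and "A \<in> borel_measurable borel"
    and "(\<forall>\<^sub>F t in at_top. A t > 0) \<or> (\<forall>\<^sub>F t in at_top. A t < 0)"
    and "(A \<longlongrightarrow> 0) at_top"
    and "\<And>x. x > 0 \<Longrightarrow>
           ((\<lambda>t. (U (t * x) / U t - x powr \<gamma>) / A t) \<longlongrightarrow> x powr \<gamma> * (x powr \<rho> - 1) / \<rho>) at_top"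
    and "\<gamma> * r < 1 / 2"
    and "\<And>n. n \<ge> 2 \<Longrightarrow> 1 \<le> k n \<and> k n < n"
    and "filterlim k at_top sequentially"
    and "filterlim (\<lambda>n. real n / real (k n)) at_top sequentially"
    and "(\<lambda>n. sqrt (real (k n)) * A (real n / real (k n))) \<longlonglongrightarrow> \<mu>"
  shows "let d = (\<lambda>m::real. 1 - m * \<gamma> * r);
             \<nu>1 = r / (d 1 * (d 1 - \<rho>));
             \<nu>2 = (1 - \<rho> - \<gamma>\<^sup>2 * r\<^sup>2) / ((d 1)\<^sup>2 * (d 1 - \<rho>)\<^sup>2);
             s1 = \<gamma>\<^sup>2 * r\<^sup>2 / (d 2 * (d 1)\<^sup>2);
             s2 = \<gamma>\<^sup>2 * (d 2 + 2 * \<gamma> ^ 4 * r ^ 4) / ((d 2) ^ 3 * (d 1) ^ 4);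
             s12 = \<gamma>\<^sup>2 * r * (d 1 - \<gamma>\<^sup>2 * r\<^sup>2) / ((d 2)\<^sup>2 * (d 1) ^ 3);
             Z = (\<lambda>n \<omega>. (sqrt (real (k n)) * (G_n X n (k n) r 0 \<omega> - xi \<gamma> r 0),
                          sqrt (real (k n)) * (G_n X n (k n) r 1 \<omega> - xi \<gamma> r 1)))
         in \<exists>N. gaussian2 N (\<mu> * \<nu>1, \<mu> * \<nu>2) s1 s2 s12 \<and> conv_distr2 M Z N"
proof -
  interpret prob_space M by fact
  note X = assms(2)
  define D where "D = distr M borel (X 0)"
  have D: "real_distribution D" unfolding D_def by (rule real_distribution_distr[OF X])
  have F: "F = cdf D"
  proof
    fix x
    have "cdf D x = measure M (X 0 -` {..x} \<inter> space M)"
      unfolding cdf_def D_def by (rule measure_distr) (use X in auto)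
    also have "X 0 -` {..x} \<inter> space M = {\<omega> \<in> space M. X 0 \<omega> \<le> x}" by auto
    finally show "F x = cdf D x" using assms(6) by simp
  qed
  have neg: "cdf D x = 0" if "x < 0" for x
  proof -
    have "{\<omega> \<in> space M. X 0 \<omega> \<le> x} = {}" using assms(5)[of _ 0] that by force
    then show ?thesis unfolding F[symmetric] assms(6) by (simp only: measure_empty)
  qed
  define u where "u t = gen_inv (cdf D) (1 - 1 / exp (max 0 t))" for t
  have uU: "u t = U (exp (max 0 t))" for t using assms(7) F by (simp add: u_def)
  have quantile: "mono u" "\<And>t. 0 \<le> u t" "distr expo borel u = D"
    using distr_quantile_expo[OF D neg] unfolding u_def by auto
  define a where "a t = A (exp t)" for t
  interpret second_order_regular u a \<gamma> \<rho>
  proof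
    show "mono u" by (rule quantile)
    show "0 \<le> u t" for t by (rule quantile)
    show "a \<in> borel_measurable borel" unfolding a_def using assms(10) by measurable
    show "(\<forall>\<^sub>F t in at_top. 0 < a t) \<or> (\<forall>\<^sub>F t in at_top. a t < 0)"
      unfolding a_def using assms(11) eventually_compose_filterlim[OF _ exp_at_top] by blast
    show "(a \<longlongrightarrow> 0) at_top" unfolding a_def by (rule filterlim_compose[OF assms(12) exp_at_top])
    show "\<rho> < 0" by fact
    fix s :: real
    have "((\<lambda>t. (U (exp t * exp s) / U (exp t) - exp s powr \<gamma>) / A (exp t)) \<longlongrightarrow> exp s powr \<gamma> *
          (exp s powr \<rho> - 1) / \<rho>) at_top"
      by (rule filterlim_compose[OF assms(13) exp_at_top]) simp
    moreover have "\<forall>\<^sub>F t in at_top. (U (exp t * exp s) / U (exp t) - exp s powr \<gamma>) / A (exp t) =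
          (u (t + s) / u t - exp (\<gamma> * s)) / a t"
      \<comment> \<open>From \<open>\<bar>s\<bar>\<close> on, both \<open>t\<close> and
        \<open>t + s\<close> are nonnegative, so the truncation \<open>max 0\<close> in
        \<open>u\<close> is inactive.\<close>
      using eventually_ge_at_top[of "\<bar>s\<bar>"]
      by eventually_elim (auto simp: uU a_def max_def powr_def exp_add)
    ultimately have "((\<lambda>t. (u (t + s) / u t - exp (\<gamma> * s)) / a t) \<longlongrightarrow> exp s powr \<gamma> * (exp s powr \<rho> - 1) /
          \<rho>) at_top"
      by (rule Lim_transform_eventually)
    then show "((\<lambda>t. (u (t + s) / u t - exp (\<gamma> * s)) / a t) \<longlongrightarrow> exp (\<gamma> * s) * (exp (\<rho> * s) - 1) / \<rho>) at_top"
      by (simp add: powr_def)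
  qed
  have law: "distr M borel (X i) = distr expo borel u" for i
    using assms(4)[of i] quantile(3) by (simp add: D_def)
  define d where "d m = 1 - m * \<gamma> * r" for m
  define \<nu>1 where "\<nu>1 = r / (d 1 * (d 1 - \<rho>))"
  define \<nu>2 where "\<nu>2 = (1 - \<rho> - \<gamma>\<^sup>2 * r\<^sup>2) / ((d 1)\<^sup>2 * (d 1 - \<rho>)\<^sup>2)"
  define s1 where "s1 = \<gamma>\<^sup>2 * r\<^sup>2 / (d 2 * (d 1)\<^sup>2)"
  define s2 where "s2 = \<gamma>\<^sup>2 * (d 2 + 2 * \<gamma> ^ 4 * r ^ 4) / ((d 2) ^ 3 * (d 1) ^ 4)"
  define s12 where "s12 = \<gamma>\<^sup>2 * r * (d 1 - \<gamma>\<^sup>2 * r\<^sup>2) / ((d 2)\<^sup>2 * (d 1) ^ 3)"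
  have d1: "1 - \<gamma> * r = d 1" "1 - 2 * (\<gamma> * r) = d 2" by (simp_all add: d_def)
  have dpos: "d 1 > 0" "d 2 > 0" using assms(14) by (simp_all add: d_def)
  have variance: "integral\<^sup>L expo (\<lambda>x. (tilt r a0 b0 (\<gamma> * x) - (a0 / (1 - \<gamma> * r) + b0 * \<gamma> / (1 - \<gamma> * r)\<^sup>2))\<^sup>2) =
      a0\<^sup>2 * s1 + 2 * a0 * b0 * s12 + b0\<^sup>2 * s2" for a0 b0
  proof -
    have "inverse (d 2) - (inverse (d 1))\<^sup>2 = ((d 1)\<^sup>2 - d 2) / (d 2 * (d 1)\<^sup>2)"
      using dpos by (simp add: field_simps)
    also have "(d 1)\<^sup>2 - d 2 = \<gamma>\<^sup>2 * r\<^sup>2" unfolding d_def by algebra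
    finally have 1: "inverse (d 2) - (inverse (d 1))\<^sup>2 = s1" by (simp add: s1_def)
    have "\<gamma> * (inverse (d 2))\<^sup>2 - \<gamma> * inverse (d 1) ^ 3 = \<gamma> * ((d 1) ^ 3 - (d 2)\<^sup>2) / ((d 2)\<^sup>2 * (d 1) ^ 3)"
      using dpos by (simp add: field_simps)
    also have "\<gamma> * ((d 1) ^ 3 - (d 2)\<^sup>2) = \<gamma>\<^sup>2 * r * (d 1 - \<gamma>\<^sup>2 * r\<^sup>2)" unfolding d_def by algebra
    finally have 2: "\<gamma> * (inverse (d 2))\<^sup>2 - \<gamma> * inverse (d 1) ^ 3 = s12" by (simp add: s12_def)
    have "2 * \<gamma>\<^sup>2 * inverse (d 2) ^ 3 - \<gamma>\<^sup>2 * inverse (d 1) ^ 4 = \<gamma>\<^sup>2 * (2 * (d 1) ^ 4 - (d 2) ^ 3) /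
          ((d 2) ^ 3 * (d 1) ^ 4)"
      using dpos by (simp add: field_simps)
    also have "2 * (d 1) ^ 4 - (d 2) ^ 3 = d 2 + 2 * \<gamma> ^ 4 * r ^ 4" unfolding d_def by algebra
    finally have 3: "2 * \<gamma>\<^sup>2 * inverse (d 2) ^ 3 - \<gamma>\<^sup>2 * inverse (d 1) ^ 4 = s2" by (simp add: s2_def)
    show ?thesis
      using tilt_variance[OF assms(14), of a0 b0] unfolding d1 1 2 3 .
  qed
  \<comment> \<open>Positive semidefiniteness is read from the integral of a square, so the closed
    forms of \<open>s1\<close>, \<open>s2\<close>, \<open>s12\<close> need no sign analysis.\<close>
  have "0 \<le> a0\<^sup>2 * s1 + 2 * a0 * b0 * s12 + b0\<^sup>2 * s2" for a0 b0
    unfolding variance[symmetric] by (rule integral_nonneg_AE) simp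
  note psd = psd_discriminant[OF this]
  from gaussian2_exists[OF psd, of "(\<mu> * \<nu>1, \<mu> * \<nu>2)"]
  obtain N where N: "gaussian2 N (\<mu> * \<nu>1, \<mu> * \<nu>2) s1 s2 s12"
    and char_N: "\<forall>a0 b0. (\<integral>z. iexp (a0 * fst z + b0 * snd z) \<partial>N) =
      exp (\<i> * of_real (a0 * fst (\<mu> * \<nu>1, \<mu> * \<nu>2) + b0 * snd (\<mu> * \<nu>1, \<mu> * \<nu>2)) - of_real ((a0\<^sup>2 * s1 + 2 *
            a0 * b0 * s12 + b0\<^sup>2 * s2) / 2))"
    by blast
  have prob_N: "prob_space N" and sets_N: "sets N = sets borel" using N by (simp_all add: gaussian2_def)
  interpret N: prob_space N by (rule prob_N)
  define Z where "Z = (\<lambda>n \<omega>. (sqrt (real (k n)) * (G_n X n (k n) r 0 \<omega> - xi \<gamma> r 0),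
                          sqrt (real (k n)) * (G_n X n (k n) r 1 \<omega> - xi \<gamma> r 1)))"
  have Z: "Z n \<omega> = standardize \<gamma> r (k n) (\<Sum>l<k n. g_pair r (order_stat X (n - l) n \<omega> / order_stat X (n -
        k n) n \<omega>))" for n \<omega>
    by (simp add: Z_def standardize_def G_n_def g_pair_def fst_sum snd_sum)
  have \<mu>': "(\<lambda>n. sqrt (real (k n)) * a (ln (real n / real (k n)))) \<longlonglongrightarrow> \<mu>"
  proof (rule Lim_transform_eventually[OF assms(18)])
    show "\<forall>\<^sub>F n in sequentially. sqrt (real (k n)) * A (real n / real (k n)) = sqrt (real (k n)) *
          a (ln (real n / real (k n)))"
      using eventually_ge_at_top[of 2]
    proof eventually_elim
      case (elim n)
      then have "real n / real (k n) > 0" using assms(15)[of n] by simp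
      then show ?case by (simp add: a_def)
    qed
  qed
  have char_N': "(\<integral>z. iexp (a0 * fst z + b0 * snd z) \<partial>N) =
      limit_char \<gamma> \<rho> r \<mu> a0 b0" for a0 b0
  proof -
    have "a0 * fst (\<mu> * \<nu>1, \<mu> * \<nu>2) + b0 * snd (\<mu> * \<nu>1, \<mu> * \<nu>2) = \<mu> * (a0 * \<nu>1 + b0 * \<nu>2)"
      by (simp add: algebra_simps)
    then show ?thesis
      unfolding limit_char_def char_N[rule_format] variance unfolding d1 \<nu>1_def[symmetric]
            \<nu>2_def[symmetric] by (simp only:)
  qed
  have "conv_distr2 M Z N"
    unfolding conv_distr2_def
  proof (intro allI impI)
    fix f :: "real \<times> real \<Rightarrow> real"
    assume f: "continuous_on UNIV f \<and> bounded (range f)"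
    then obtain B where B: "\<And>z. \<bar>f z\<bar> \<le> B" by (auto simp: bounded_iff)
    \<comment> \<open>Adding \<open>B\<close> makes the test function nonnegative; the constant is
      removed again at the end since both sides are probability measures.\<close>
    have fB: "0 \<le> f z + B" "f z + B \<le> 2 * B" for z using B[of z] by auto
    have "continuous_on UNIV (\<lambda>z. f z + B)" using f by (intro continuous_intros) auto
    from order_stat_tendsto[OF prob_space_axioms X assms(3) law assms(14,15,16,17) \<mu>' prob_N sets_N
          char_N' this fB]
    have lim: "(\<lambda>n. \<integral>\<omega>. f (Z n \<omega>) + B \<partial>M) \<longlonglongrightarrow> (\<integral>z. f z + B \<partial>N)"
      unfolding Z .
    have f_meas: "f \<in> borel_measurable borel" using f by (intro borel_measurable_continuous_onI) auto
    have "(\<integral>z. f z + B \<partial>N) = integral\<^sup>L N f + B"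
      using integrable_bounded_continuous[OF prob_N sets_N _ B] f by (simp add: N.prob_space)
    moreover have "\<forall>\<^sub>F n in sequentially. (\<integral>\<omega>. f (Z n \<omega>) + B \<partial>M) = (\<integral>\<omega>. f (Z n \<omega>) \<partial>M) + B"
      \<comment> \<open>The condition \<open>k n < n\<close> is given only from 2 on, and it is what
        makes the order statistics well-defined measurable functions.\<close>
      using eventually_ge_at_top[of 2]
    proof eventually_elim
      case (elim n)
      then have kn: "k n < n" using assms(15) by blast
      have "Z n \<in> borel_measurable M"
        unfolding Z[abs_def] by (rule measurable_standardize_order_stat[OF X kn])
      from measurable_compose[OF this f_meas] have "integrable M (\<lambda>\<omega>. f (Z n \<omega>))"
        by (intro integrable_const_bound[of _ B]) (use B in auto)
      then show ?case by (simp add: prob_space)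
    qed
    ultimately have "(\<lambda>n. (\<integral>\<omega>. f (Z n \<omega>) \<partial>M) + B) \<longlonglongrightarrow> integral\<^sup>L N f + B"
      using Lim_transform_eventually[OF lim] by simp
    then show "(\<lambda>n. \<integral>\<omega>. f (Z n \<omega>) \<partial>M) \<longlonglongrightarrow> integral\<^sup>L N f"
      using tendsto_diff[OF _ tendsto_const[of B]] by fastforce
  qed
  with N show ?thesis
    unfolding Let_def d_def[symmetric] \<nu>1_def[symmetric] \<nu>2_def[symmetric] s1_def[symmetric]
          s2_def[symmetric] s12_def[symmetric] Z_def[symmetric]
    by blast
qed

end
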